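(* For $\beta>1/2$ let $B_\beta$ be the Blaschke product with simple zeros $n^\beta+i$, $n\in\mathbb{N}$, and let $W_A(t)=\exp(-A|t|^{1/2})$. 1. If $0<A<\pi$, then $W_A\in\mathrm{Adm}_-(B_2)$. 2. If $1\le\beta<2$, then $W_A\in\mathrm{Adm}_-(B_\beta)$ for every $A>0$.
   Context: $H^2$ is the Hardy space of $\mathbb{C}^+$, $K_B=H^2\ominus BH^2$; $w\in\mathrm{Adm}_-(B)$ means there is a nonzero $f\in K_B$ with $|f(x)|\le w(x)$ for a.e. $x<0$. *)

theory Defs
  imports "HOL-Analysis.Analysis"
begin

definition UHP :: "complex set" where
  "UHP = {z. Im z > 0}"

definition H2 :: "(complex \<Rightarrow> complex) set" where
  "H2 = {f. f holomorphic_on UHP \<and>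
          (\<exists>C. \<forall>y>0. (\<lambda>x. (cmod (f (Complex x y)))\<^sup>2) integrable_on UNIV \<and>
                    integral UNIV (\<lambda>x. (cmod (f (Complex x y)))\<^sup>2) \<le> C)}"

text \<open>Boundary values on the real line (vertical limit, exists a.e. for H^2 functions).\<close>
definition bv :: "(complex \<Rightarrow> complex) \<Rightarrow> real \<Rightarrow> complex" where
  "bv f x = Lim (at_right 0) (\<lambda>y. f (Complex x y))"

definition H2_inner :: "(complex \<Rightarrow> complex) \<Rightarrow> (complex \<Rightarrow> complex) \<Rightarrow> complex" where
  "H2_inner f g = integral UNIV (\<lambda>x. bv f x * cnj (bv g x))"

definition model_space :: "(complex \<Rightarrow> complex) \<Rightarrow> (complex \<Rightarrow> complex) set" where
  "model_space B = {f \<in> H2. \<forall>g \<in> H2. H2_inner f (\<lambda>z. B z * g z) = 0}"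

definition Adm_minus :: "(complex \<Rightarrow> complex) \<Rightarrow> (real \<Rightarrow> real) \<Rightarrow> bool" where
  "Adm_minus B w \<longleftrightarrow> (\<exists>f \<in> model_space B. (\<exists>z \<in> UHP. f z \<noteq> 0) \<and>
       (AE x in lborel. x < 0 \<longrightarrow> cmod (bv f x) \<le> w x))"

text \<open>Blaschke product in the upper half-plane with simple zeros w_n,
  with the standard convergence factors |w_n^2+1|/(w_n^2+1).\<close>
definition blaschke_UHP :: "(nat \<Rightarrow> complex) \<Rightarrow> complex \<Rightarrow> complex" where
  "blaschke_UHP w z = (\<Prod>n. (of_real (cmod ((w n)\<^sup>2 + 1)) / ((w n)\<^sup>2 + 1)) *
                            ((z - w n) / (z - cnj (w n))))"

definition zeros_beta :: "real \<Rightarrow> nat \<Rightarrow> complex" where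
  "zeros_beta \<beta> n = of_real (real (Suc n) powr \<beta>) + \<i>"

definition B_beta :: "real \<Rightarrow> complex \<Rightarrow> complex" where
  "B_beta \<beta> = blaschke_UHP (zeros_beta \<beta>)"

definition W :: "real \<Rightarrow> real \<Rightarrow> real" where
  "W A t = exp (- A * sqrt \<bar>t\<bar>)"

end

theory Submission
  imports Defs "HOL-Complex_Analysis.Complex_Analysis"
begin

text \<open>
  Every boundary function in \<open>K\<^sub>B\<close> used here is a reciprocal \<open>1 / E\<close>, where \<open>E\<close> is the canonical product over a
  subsequence \<open>l k\<close> of the \<open>n\<^sup>\<beta>\<close>, with zeros in the conjugates \<open>l k - \<i>\<close>. The subsequence interlaces the
  squares \<open>e\<^sup>2 j\<^sup>2\<close> up to an index shift \<open>s\<close>. Comparison with the sine product makes \<open>\<bar>E\<bar>\<close> grow like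
  \<open>exp (\<pi> \<surd>\<bar>x\<bar> / e)\<close>, up to a power of \<open>x\<close>, on the negative axis, and the \<open>s\<close> surplus zeros make it grow at least
  linearly on the positive one. For \<open>\<beta> = 2\<close> surplus zeros exist exactly when \<open>e > 1\<close>, which is the
  restriction \<open>A < \<pi>\<close>; for \<open>\<beta> < 2\<close> the sequence \<open>n\<^sup>\<beta>\<close> is dense enough for every \<open>e > 0\<close>.

  The partial products have reciprocals which are sums of reproducing kernels at zeros of \<open>B\<close>, hence
  orthogonal to \<open>B H\<^sup>2\<close>, and the bounds are uniform, so orthogonality survives in the limit. The inner product
  is defined through vertical boundary limits, so Fatou's theorem is needed: the Poisson semigroup is
  self-adjoint, hence horizontal lines of an \<open>H\<^sup>2\<close> function are Cauchy in \<open>L\<^sup>2\<close>, and a Vitali covering bound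
  for the vertical maximal function turns this into convergence almost everywhere.
\<close>

section \<open>Cauchy and Poisson formulas in the half-plane\<close>

text \<open>Admissibility asks for decay on the negative half-line only, but membership in
  \<open>H2\<close> asks for control on every horizontal line, and the zeros of \<open>E\<close> sit
  at distance 1 under the positive axis, where no exponential growth can be claimed. Two facts keep
  the estimate there elementary. All zeros lie below the real axis, so each factor grows in modulus
  on moving up, and a bound on the real line is a bound on the closed half-plane. And the product of
  the factors \<open>1 - m^2 / j^2\<close> with \<open>j = m\<close> left out has an explicit
  factorial value, so the comparison with the sine is exact up to finitely many factors; these cost
  a power of \<open>x\<close>. On the negative axis powers cost nothing, since
  \<open>pi - A * e > 0\<close> leaves an exponential to absorb them. An arbitrary \<open>g\<close>
  in \<open>H2\<close> enters orthogonality only through the values of \<open>B * g\<close> at the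
  points \<open>l k + \<i>\<close>, where it vanishes; a Cauchy formula for boundary values is
  therefore the one aim of the Hardy space part.\<close>

lemma integrable_inverse_one_plus_square:
  "integrable lborel (\<lambda>t::real. 1 / (1 + t\<^sup>2))"
proof -
  have "set_integrable lborel (einterval (-\<infinity>) \<infinity>) (\<lambda>t::real. 1 / (1 + t\<^sup>2))"
    by (rule interval_integral_FTC_nonneg(1)[where F = arctan and A = "-(pi/2)" and B = "pi/2"])
       (auto intro!: derivative_eq_intros continuous_intros tendsto_arctan_at_top tendsto_arctan_at_bot
            simp: power2_eq_square ereal_tendsto_simps inverse_eq_divide add_nonneg_eq_0_iff)
  then show ?thesis
    by (simp add: set_integrable_def)
qed

text \<open>Since \<open>z\<close> and \<open>w\<close> lie on opposite sides of the real axis,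
  \<open>cmod (z - w)\<close> is at least \<open>Im w\<close>, so a multiple of the distance absorbs
  \<open>1 + cmod w\<close>. Kernels at \<open>w\<close> decay, and single factors of
  \<open>E\<close> grow, for this reason.\<close>

lemma one_plus_norm_le_dist:
  fixes w :: complex
  assumes "Im w > 0" "Im z \<le> 0"
  shows "1 + cmod z \<le> ((1 + cmod w) / Im w + 1) * cmod (z - w)"
proof -
  have 1: "Im w \<le> cmod (z - w)"
    using abs_Im_le_cmod[of "z - w"] assms by auto
  have "1 + cmod z \<le> (1 + cmod w) + cmod (z - w)"
    using norm_triangle_ineq[of w "z - w"] by simp
  also have "1 + cmod w \<le> (1 + cmod w) / Im w * cmod (z - w)"
  proof -
    have "(1 + cmod w) / Im w * Im w \<le> (1 + cmod w) / Im w * cmod (z - w)"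
      using 1 assms by (intro mult_left_mono divide_nonneg_pos add_nonneg_nonneg) auto
    then show ?thesis using assms by simp
  qed
  finally show ?thesis by (simp add: algebra_simps)
qed

lemma integrable_dominated_inverse_square:
  fixes f :: "real \<Rightarrow> 'a::{banach, second_countable_topology}"
  assumes "f \<in> borel_measurable borel" "\<And>t. norm (f t) \<le> C / (1 + t\<^sup>2)"
  shows "integrable lborel f"
proof (rule Bochner_Integration.integrable_bound)
  show "integrable lborel (\<lambda>t. C * (1 / (1 + t\<^sup>2)))"
    by (intro integrable_mult_right integrable_inverse_one_plus_square)
  show "AE t in lborel. norm (f t) \<le> norm (C * (1 / (1 + t\<^sup>2)))"
    using order_trans[OF assms(2) abs_ge_self] by (intro AE_I2) simp
qed (use assms in auto)

lemma integrable_cauchy_kernel: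
  fixes g :: "real \<Rightarrow> complex"
  assumes "g \<in> borel_measurable borel" "\<And>t. cmod (g t) \<le> C / (1 + \<bar>t\<bar>)" "Im w > 0"
  shows "integrable lborel (\<lambda>t. g t / (of_real t - w))"
proof (rule integrable_dominated_inverse_square)
  define D where "D = (1 + cmod w) / Im w + 1"
  have D: "D > 0" using assms(3) by (auto simp: D_def intro!: add_nonneg_pos divide_nonneg_pos add_nonneg_nonneg)
  have C: "C \<ge> 0" using assms(2)[of 0] by (simp add: order_trans[OF norm_ge_zero])
  fix t
  have k: "1 + \<bar>t\<bar> \<le> D * cmod (of_real t - w)"
    using one_plus_norm_le_dist[of w "of_real t"] assms(3) by (simp add: D_def)
  have pos: "cmod (of_real t - w) > 0"
    using k D zero_less_mult_pos[of D "cmod (of_real t - w)"] by linarith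
  have "cmod (g t / (of_real t - w)) \<le> C / (1 + \<bar>t\<bar>) / cmod (of_real t - w)"
    unfolding norm_divide by (intro divide_right_mono assms norm_ge_zero)
  also have "\<dots> \<le> C / (1 + \<bar>t\<bar>) / ((1 + \<bar>t\<bar>) / D)"
    using k pos D C by (intro divide_left_mono) (auto simp: pos_divide_le_eq mult.commute intro!: mult_pos_pos divide_pos_pos)
  also have "\<dots> = C * D / ((1 + \<bar>t\<bar>) * (1 + \<bar>t\<bar>))"
    by simp
  also have "\<dots> \<le> C * D / (1 + t\<^sup>2)"
  proof (intro divide_left_mono)
    have "t\<^sup>2 = \<bar>t\<bar> * \<bar>t\<bar>" by (simp add: power2_eq_square)
    then show "1 + t\<^sup>2 \<le> (1 + \<bar>t\<bar>) * (1 + \<bar>t\<bar>)" by (simp add: algebra_simps)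
  qed (use C D in \<open>auto intro!: mult_pos_pos add_pos_nonneg\<close>)
  finally show "cmod (g t / (of_real t - w)) \<le> C * D / (1 + t\<^sup>2)" .
qed (use assms in measurable)

text \<open>Cauchy's formula on the rectangle with corners \<open>-R\<close> and
  \<open>R + \<i> * R\<close>: on each of the three upper sides the integrand is at most
  \<open>C / R / (R - cmod w)\<close> and the length at most \<open>2 * R\<close>, so they vanish as
  \<open>R\<close> grows. Holomorphy a little below the axis lets the fourth side lie on the
  axis.\<close>

lemma halfplane_cauchy:
  fixes g :: "complex \<Rightarrow> complex"
  assumes hol: "g holomorphic_on {z. Im z > -d}" and d: "d > 0"
    and bnd: "\<And>z. Im z \<ge> 0 \<Longrightarrow> cmod (g z) \<le> C / (1 + cmod z)" and w: "Im w > 0"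
  shows "integrable lborel (\<lambda>t. g (of_real t) / (of_real t - w))"
    and "(LBINT t. g (of_real t) / (of_real t - w)) = 2 * pi * \<i> * g w"
proof -
  have cont: "continuous_on {z. Im z > -d} g"
    using hol holomorphic_on_imp_continuous_on by blast
  have C: "C \<ge> 0" using bnd[of 0] by (simp add: order_trans[OF norm_ge_zero])
  have meas: "(\<lambda>t. g (complex_of_real t)) \<in> borel_measurable borel"
    by (intro borel_measurable_continuous_onI continuous_on_compose2[OF cont] continuous_intros)
       (use d in auto)
  show int: "integrable lborel (\<lambda>t. g (of_real t) / (of_real t - w))"
    by (rule integrable_cauchy_kernel[OF meas _ w, of C]) (use bnd[of "of_real _"] in simp)
  define F where "F = (\<lambda>t. g (of_real t) / (of_real t - w))"
  define r where "r = cmod w"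
  have bd: "cmod ((LBINT t. indicator {-R..R} t *\<^sub>R F t) - 2 * pi * \<i> * g w) \<le> 6 * C / (R - r)"
    if R: "R > r" for R
  proof -
    have rw: "\<bar>Re w\<bar> \<le> r" "Im w \<le> r" using abs_Re_le_cmod[of w] abs_Im_le_cmod[of w] by (auto simp: r_def)
    have R0: "R > 0" using R r_def by (smt (verit) norm_ge_zero)
    define f where "f = (\<lambda>z. g z / (z - w))"
    define a1 a2 a3 a4 where "a1 = complex_of_real (-R)" and "a2 = complex_of_real R"
      and "a3 = Complex R R" and "a4 = Complex (-R) R"
    have rp: "rectpath a1 a3 = linepath a1 a2 +++ linepath a2 a3 +++ linepath a3 a4 +++ linepath a4 a1"
      by (simp add: rectpath_def Let_def a1_def a2_def a3_def a4_def complex_of_real_def)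
    have pi: "path_image (rectpath a1 a3) \<subseteq> {z. Im z \<ge> 0} - {w}"
      using rw w R R0 by (auto simp: path_image_rectpath a1_def a3_def)
    have conv: "convex {z. Im z > -d}"
      using convex_halfspace_Im_gt[of "-d"] by simp
    have "(f has_contour_integral (2*pi * \<i> * winding_number (rectpath a1 a3) w * g w)) (rectpath a1 a3)"
      unfolding f_def
    proof (rule Cauchy_integral_formula_convex_simple[OF conv hol])
      have "open {z. Im z > -d}" by (simp add: open_halfspace_Im_gt)
      then show "w \<in> interior {z. - d < Im z}" using w d by (simp add: interior_open)
    qed (use pi d in auto)
    moreover have "winding_number (rectpath a1 a3) w = 1"
      by (rule winding_number_rectpath)
         (use rw w R R0 in \<open>auto simp: in_box_complex_iff a1_def a3_def\<close>)
    ultimately have tot: "(f has_contour_integral (2*pi*\<i>*g w)) (rectpath a1 a3)" by simp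
    have contf: "continuous_on ({z. Im z \<ge> 0} - {w}) f"
      unfolding f_def by (intro continuous_intros continuous_on_subset[OF cont]) (use d in auto)
    have sub: "closed_segment a1 a2 \<union> closed_segment a2 a3 \<union> closed_segment a3 a4 \<union> closed_segment a4 a1 \<subseteq> {z. Im z \<ge> 0} - {w}"
      using pi unfolding rp by (simp add: path_image_join)
    have ci: "f contour_integrable_on linepath a1 a2" "f contour_integrable_on linepath a2 a3"
        "f contour_integrable_on linepath a3 a4" "f contour_integrable_on linepath a4 a1"
      by (intro contour_integrable_continuous_linepath continuous_on_subset[OF contf]; use sub in blast)+
    have eq: "2*pi*\<i>*g w = contour_integral (linepath a1 a2) f + (contour_integral (linepath a2 a3) f
        + (contour_integral (linepath a3 a4) f + contour_integral (linepath a4 a1) f))"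
      using contour_integral_unique[OF tot] ci unfolding rp
      by (simp add: contour_integrable_join)
    have b: "cmod (f z) \<le> C / R / (R - r)" if "Im z \<ge> 0" "cmod z \<ge> R" for z
    proof -
      have "cmod (z - w) \<ge> R - r" using that norm_triangle_ineq2[of z w] by (simp add: r_def)
      moreover have "cmod (g z) \<le> C / R"
        using bnd[OF that(1)] that R0 C by (smt (verit) frac_le)
      ultimately show ?thesis
        unfolding f_def norm_divide using R R0 C by (intro frac_le) auto
    qed
    have RR: "cmod z \<ge> R" if "\<bar>Re z\<bar> \<ge> R \<or> \<bar>Im z\<bar> \<ge> R" for z
      using that abs_Re_le_cmod[of z] abs_Im_le_cmod[of z] by linarith
    define K where "K = C / R / (R - r) * (2 * R)"
    have s: "cmod (contour_integral (linepath p q) f) \<le> K"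
      if "f contour_integrable_on linepath p q" "cmod (q - p) \<le> 2 * R"
         "\<And>z. z \<in> closed_segment p q \<Longrightarrow> Im z \<ge> 0 \<and> (\<bar>Re z\<bar> \<ge> R \<or> \<bar>Im z\<bar> \<ge> R)" for p q
    proof -
      have "cmod (contour_integral (linepath p q) f) \<le> C / R / (R - r) * cmod (q - p)"
        by (rule contour_integral_bound_linepath[OF that(1)]) (use that b RR C R R0 in auto)
      also have "\<dots> \<le> K" unfolding K_def
        by (rule mult_left_mono[OF that(2)]) (use C R R0 in auto)
      finally show ?thesis .
    qed
    have s2: "cmod (contour_integral (linepath a2 a3) f) \<le> K"
      by (rule s[OF ci(2)]) (use R0 in \<open>auto simp: a2_def a3_def cmod_def closed_segment_same_Re closed_segment_eq_real_ivl\<close>)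
    have s3: "cmod (contour_integral (linepath a3 a4) f) \<le> K"
      by (rule s[OF ci(3)]) (use R0 in \<open>auto simp: a4_def a3_def cmod_def real_sqrt_mult closed_segment_same_Im closed_segment_eq_real_ivl\<close>)
    have s4: "cmod (contour_integral (linepath a4 a1) f) \<le> K"
      by (rule s[OF ci(4)]) (use R0 in \<open>auto simp: a4_def a1_def cmod_def closed_segment_same_Re closed_segment_eq_real_ivl\<close>)
    have "contour_integral (linepath a1 a2) f = integral {-R..R} F"
      unfolding f_def F_def
      by (subst contour_integral_linepath_Reals_eq) (use R0 in \<open>auto simp: a1_def a2_def\<close>)
    also have "\<dots> = (LBINT t. indicator {-R..R} t *\<^sub>R F t)"
    proof -
      have "set_integrable lborel {-R..R} F"
        unfolding set_integrable_def using integrable_mult_indicator[OF _ int, of "{-R..R}"] by (simp add: F_def)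
      from set_borel_integral_eq_integral(2)[OF this] show ?thesis
        by (simp add: set_lebesgue_integral_def)
    qed
    finally have e1: "contour_integral (linepath a1 a2) f = (LBINT t. indicator {-R..R} t *\<^sub>R F t)" .
    have "(LBINT t. indicator {-R..R} t *\<^sub>R F t) - 2 * pi * \<i> * g w =
       - (contour_integral (linepath a2 a3) f
        + (contour_integral (linepath a3 a4) f + contour_integral (linepath a4 a1) f))"
      using eq e1 by simp
    then have "cmod ((LBINT t. indicator {-R..R} t *\<^sub>R F t) - 2 * pi * \<i> * g w) \<le> 3 * K"
      using s2 s3 s4 norm_triangle_ineq[of "contour_integral (linepath a2 a3) f" "contour_integral (linepath a3 a4) f + contour_integral (linepath a4 a1) f"]
       norm_triangle_ineq[of "contour_integral (linepath a3 a4) f" "contour_integral (linepath a4 a1) f"]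
      by (simp only: norm_minus_cancel)
    also have "\<dots> = 6 * C / (R - r)" using R0 by (simp add: K_def)
    finally show ?thesis .
  qed
  have "(\<lambda>n::nat. LBINT t. indicator {-real n..real n} t *\<^sub>R F t) \<longlonglongrightarrow> (LBINT t. F t)"
  proof (rule integral_dominated_convergence[where w = "\<lambda>t. cmod (F t)"])
    show "AE t in lborel. (\<lambda>n. indicator {-real n..real n} t *\<^sub>R F t) \<longlonglongrightarrow> F t"
    proof (rule AE_I2)
      fix t :: real
      obtain N where "real N \<ge> \<bar>t\<bar>" using real_arch_simple by blast
      then have "\<forall>\<^sub>F n in sequentially. indicator {-real n..real n} t *\<^sub>R F t = F t"
        by (intro eventually_sequentiallyI[of N]) (auto simp: indicator_def)
      then show "(\<lambda>n. indicator {-real n..real n} t *\<^sub>R F t) \<longlonglongrightarrow> F t"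
        by (rule tendsto_eventually)
    qed
  qed (use int in \<open>auto simp: F_def indicator_def\<close>)
  moreover have "(\<lambda>n::nat. LBINT t. indicator {-real n..real n} t *\<^sub>R F t) \<longlonglongrightarrow> 2 * pi * \<i> * g w"
  proof (rule Lim_transform_bound[of _ "\<lambda>n. 6 * C / (real n - r)", THEN LIM_zero_cancel])
    show "\<forall>\<^sub>F n in sequentially. norm ((LBINT t. indicator {-real n..real n} t *\<^sub>R F t) - 2 * pi * \<i> * g w)
        \<le> norm (6 * C / (real n - r))"
    proof -
      obtain N where "real N > r" using reals_Archimedean2 by blast
      then show ?thesis
        by (intro eventually_sequentiallyI[of N] order_trans[OF bd]) (use C in auto)
    qed
    show "(\<lambda>n. 6 * C / (real n - r)) \<longlonglongrightarrow> 0"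
      using filterlim_tendsto_add_at_top[OF tendsto_const[of "-r"] filterlim_real_sequentially]
      by (intro real_tendsto_divide_at_top[OF tendsto_const]) simp
  qed
  ultimately show "(LBINT t. g (of_real t) / (of_real t - w)) = 2 * pi * \<i> * g w"
    using LIMSEQ_unique unfolding F_def by blast
qed

text \<open>A bounded \<open>q\<close> lacks the decay that \<open>halfplane_cauchy\<close> wants;
  the factor \<open>y / (z - cnj w)\<close> supplies it and also turns the Cauchy kernel into the
  Poisson kernel. The kernel carries no \<open>1 / pi\<close>, hence the \<open>pi\<close> on the
  right.\<close>

lemma halfplane_poisson:
  fixes q :: "complex \<Rightarrow> complex"
  assumes hol: "q holomorphic_on {z. Im z > -d}" and d: "d > 0"
    and bnd: "\<And>z. Im z \<ge> 0 \<Longrightarrow> cmod (q z) \<le> M" and y: "y > 0"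
  shows "integrable lborel (\<lambda>t. of_real (y / ((t - x)\<^sup>2 + y\<^sup>2)) * q (of_real t))"
    and "(LBINT t. of_real (y / ((t - x)\<^sup>2 + y\<^sup>2)) * q (of_real t)) = pi * q (Complex x y)"
proof -
  define w where "w = Complex x y"
  define g where "g = (\<lambda>z. q z * y / (z - cnj w))"
  define D where "D = (1 + cmod w) / y + 1"
  have M: "M \<ge> 0" using bnd[of 0] by (simp add: order_trans[OF norm_ge_zero])
  have w: "Im w > 0" using y by (simp add: w_def)
  have D: "D > 0" using y by (auto simp: D_def intro!: add_nonneg_pos divide_nonneg_pos add_nonneg_nonneg)
  have hg: "g holomorphic_on {z. Im z > - min d y}"
    unfolding g_def
    by (intro holomorphic_intros holomorphic_on_subset[OF hol]) (use y in \<open>auto simp: w_def\<close>)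
  have bg: "cmod (g z) \<le> (M * y * D) / (1 + cmod z)" if z: "Im z \<ge> 0" for z
  proof -
    have "1 + cmod (cnj z) \<le> D * cmod (cnj z - w)"
      using one_plus_norm_le_dist[of w "cnj z"] z w by (simp add: D_def w_def)
    moreover have "cmod (cnj z - w) = cmod (z - cnj w)"
      by (metis complex_cnj_cnj complex_cnj_diff complex_mod_cnj)
    ultimately have k: "1 + cmod z \<le> D * cmod (z - cnj w)" by simp
    then have p: "cmod (z - cnj w) > 0"
      using D zero_less_mult_pos[of D "cmod (z - cnj w)"] norm_ge_zero[of z] by linarith
    have "cmod (g z) = cmod (q z) * y / cmod (z - cnj w)"
      using y by (simp add: g_def norm_mult norm_divide)
    also have "\<dots> \<le> M * y / cmod (z - cnj w)"
      using y p bnd[OF z] by (intro divide_right_mono mult_right_mono) auto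
    also have "\<dots> \<le> M * y / ((1 + cmod z) / D)"
      using k p D y M norm_ge_zero[of z] by (intro divide_left_mono) (auto simp: field_simps intro!: mult_pos_pos add_pos_nonneg)
    finally show ?thesis by simp
  qed
  have mn: "min d y > 0" using d y by simp
  have eq: "g (of_real t) / (of_real t - w) = of_real (y / ((t - x)\<^sup>2 + y\<^sup>2)) * q (of_real t)" for t
  proof -
    have "(of_real t - cnj w) * (of_real t - w) = of_real ((t - x)\<^sup>2 + y\<^sup>2)"
      by (simp add: w_def complex_eq_iff power2_eq_square algebra_simps)
    then have "of_real (y / ((t - x)\<^sup>2 + y\<^sup>2)) = of_real y / ((of_real t - cnj w) * (of_real t - w))"
      by simp
    then show ?thesis unfolding g_def divide_divide_eq_left
      by (simp only: times_divide_eq_left times_divide_eq_right mult.commute)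
  qed
  show "integrable lborel (\<lambda>t. of_real (y / ((t - x)\<^sup>2 + y\<^sup>2)) * q (of_real t))"
    using halfplane_cauchy(1)[OF hg mn bg w] unfolding eq .
  have "w - cnj w = 2 * y * \<i>" by (simp add: w_def complex_eq_iff)
  then have "2 * pi * \<i> * g w = pi * q (Complex x y)"
    using y by (simp add: g_def flip: w_def)
  then show "(LBINT t. of_real (y / ((t - x)\<^sup>2 + y\<^sup>2)) * q (of_real t)) = pi * q (Complex x y)"
    using halfplane_cauchy(2)[OF hg mn bg w] unfolding eq by simp
qed

section \<open>Weak-type bound for the Poisson maximal function\<close>

text \<open>The Hardy-Littlewood weak bound. An interval whose mean exceeds \<open>lam\<close> has
  radius at most the total mass over \<open>2 * lam\<close>, so Vitali's lemma picks disjoint ones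
  whose fivefold enlargements cover the rest. The Borel set \<open>S\<close> stands in for a
  superlevel set of the maximal function.\<close>

lemma vitali_weak_type:
  fixes v :: "real \<Rightarrow> ennreal"
  assumes v [measurable]: "v \<in> borel_measurable borel" and fin: "(\<integral>\<^sup>+t. v t \<partial>lborel) < \<infinity>" and lam: "lam > 0"
  obtains S where "S \<in> sets borel" "ennreal lam * emeasure lborel S \<le> 5 * (\<integral>\<^sup>+t. v t \<partial>lborel)"
    "\<And>x r. x \<notin> S \<Longrightarrow> r > 0 \<Longrightarrow> (\<integral>\<^sup>+t. indicator (cball x r) t * v t \<partial>lborel) \<le> ennreal (2 * r * lam)"
proof -
  define I where "I = (\<lambda>i::real \<times> real. \<integral>\<^sup>+t. indicator (cball (fst i) (snd i)) t * v t \<partial>lborel)"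
  define K where "K = {i. snd i > 0 \<and> I i > ennreal (2 * snd i * lam)}"
  define A where "A = enn2real (\<integral>\<^sup>+t. v t \<partial>lborel)"
  have A: "(\<integral>\<^sup>+t. v t \<partial>lborel) = ennreal A" "A \<ge> 0"
    using fin by (auto simp: A_def)
  have le: "I i \<le> ennreal A" for i
    unfolding A(1)[symmetric] I_def by (intro nn_integral_mono) (auto simp: indicator_def)
  have r: "0 < snd i \<and> snd i \<le> A / (2 * lam)" if "i \<in> K" for i
  proof -
    have "ennreal (2 * snd i * lam) < ennreal A" using that le[of i] by (auto simp: K_def)
    then have "2 * snd i * lam < A" using that lam by (subst (asm) ennreal_less_iff) (auto simp: K_def)
    then show ?thesis using that lam by (auto simp: K_def field_simps)
  qed
  obtain C where C: "countable C" "C \<subseteq> K"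
     "pairwise (\<lambda>i j. disjnt (cball (fst i) (snd i)) (cball (fst j) (snd j))) C"
     "(\<Union>i\<in>K. cball (fst i) (snd i)) \<subseteq> (\<Union>i\<in>C. cball (fst i) (5 * snd i))"
    by (rule Vitali_covering_lemma_cballs[OF subset_refl r, where a = fst]) auto
  define S where "S = (\<Union>i\<in>C. cball (fst i) (5 * snd i))"
  \<comment> \<open>Each \<open>D n\<close> has at most one element, so the countable family, finite
    or not, becomes a sequence padded with empty sets, to which countable additivity
    applies.\<close>
  define e where "e = to_nat_on C"
  have inj: "inj_on e C" using inj_on_to_nat_on[OF C(1)] by (simp add: e_def)
  define D where "D = (\<lambda>n. {i\<in>C. e i = n})"
  have D: "D n = {} \<or> (\<exists>i\<in>C. D n = {i})" for n
  proof (cases "D n = {}")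
    case False
    then obtain i where "i \<in> C" "e i = n" by (auto simp: D_def)
    have "D n \<subseteq> {i}"
    proof
      fix j assume "j \<in> D n"
      then have "j \<in> C" "e j = e i" using \<open>e i = n\<close> by (auto simp: D_def)
      then show "j \<in> {i}" using inj \<open>i \<in> C\<close> by (metis inj_onD singletonI)
    qed
    then have "D n = {i}" using False by blast
    then show ?thesis using \<open>i \<in> C\<close> by blast
  qed simp
  define X where "X = (\<lambda>n. \<Union>i\<in>D n. cball (fst i) (5 * snd i))"
  define Y where "Y = (\<lambda>n. \<Union>i\<in>D n. cball (fst i) (snd i))"
  have Y [measurable]: "Y n \<in> sets borel" for n using D[of n] by (auto simp: Y_def)
  have X [measurable]: "X n \<in> sets borel" for n using D[of n] by (auto simp: X_def)
  have disj: "disjoint_family Y"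
  proof (unfold disjoint_family_on_def, intro ballI impI)
    fix m n :: nat assume "m \<noteq> n"
    have "cball (fst i) (snd i) \<inter> cball (fst j) (snd j) = {}" if "i \<in> D m" "j \<in> D n" for i j
    proof -
      have "i \<in> C" "j \<in> C" "i \<noteq> j" using that \<open>m \<noteq> n\<close> by (auto simp: D_def)
      then show ?thesis using C(3) by (auto simp: pairwise_def disjnt_def)
    qed
    then show "Y m \<inter> Y n = {}" unfolding Y_def by blast
  qed
  have SX: "S = (\<Union>n. X n)" by (auto simp: S_def X_def D_def)
  have SB: "S \<in> sets borel" unfolding SX by measurable
  have step: "ennreal lam * emeasure lborel (X n) \<le> 5 * emeasure (density lborel v) (Y n)" for n
  proof (cases "D n = {}")
    case False
    then obtain i where i: "i \<in> C" "D n = {i}" using D[of n] by blast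
    then have iK: "snd i > 0" "I i > ennreal (2 * snd i * lam)" using C(2) by (auto simp: K_def)
    have "emeasure lborel (X n) = ennreal (10 * snd i)"
      using i iK by (simp add: X_def cball_eq_atLeastAtMost)
    then have "ennreal lam * emeasure lborel (X n) = 5 * ennreal (2 * snd i * lam)"
      using lam iK by (simp add: ennreal_mult' [symmetric] flip: ennreal_numeral ennreal_mult)
    also have "\<dots> \<le> 5 * I i" using iK by (intro mult_left_mono) auto
    also have "I i = emeasure (density lborel v) (Y n)"
      using i by (simp add: I_def Y_def emeasure_density mult.commute)
    finally show ?thesis .
  qed (simp add: X_def Y_def)
  have "ennreal lam * emeasure lborel S \<le> ennreal lam * (\<Sum>n. emeasure lborel (X n))"
    unfolding SX by (intro mult_left_mono emeasure_subadditive_countably) auto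
  also have "\<dots> = (\<Sum>n. ennreal lam * emeasure lborel (X n))" by simp
  also have "\<dots> \<le> (\<Sum>n. 5 * emeasure (density lborel v) (Y n))"
    by (intro suminf_le step) auto
  also have "\<dots> = 5 * emeasure (density lborel v) (\<Union>n. Y n)"
    using disj by (subst suminf_emeasure[symmetric]) auto
  also have "\<dots> \<le> 5 * emeasure (density lborel v) UNIV"
    by (intro mult_left_mono emeasure_mono) auto
  also have "emeasure (density lborel v) UNIV = (\<integral>\<^sup>+t. v t \<partial>lborel)"
    by (simp add: emeasure_density)
  finally have 1: "ennreal lam * emeasure lborel S \<le> 5 * (\<integral>\<^sup>+t. v t \<partial>lborel)" .
  have 2: "(\<integral>\<^sup>+t. indicator (cball x r) t * v t \<partial>lborel) \<le> ennreal (2 * r * lam)"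
    if "x \<notin> S" "r > 0" for x r
  proof (rule ccontr)
    assume "\<not> ?thesis"
    then have "(x, r) \<in> K" using that by (auto simp: K_def I_def not_le)
    moreover have "x \<in> cball x r" using that by simp
    ultimately have "x \<in> (\<Union>i\<in>K. cball (fst i) (snd i))" by force
    then show False using C(4) that unfolding S_def by blast
  qed
  show ?thesis using that[OF SB 1 2] .
qed

text \<open>Take the least \<open>k\<close> with \<open>\<bar>s\<bar> \<le> 2^k * y\<close>. Either
  \<open>k = 0\<close> and the peak value \<open>1 / y\<close> suffices, or
  \<open>\<bar>s\<bar>\<close> exceeds \<open>2^(k-1) * y\<close> and the kernel is at most
  \<open>1 / (4^(k-1) * y)\<close>. One term suffices pointwise; the whole sum can be integrated
  ball by ball.\<close>

lemma poisson_kernel_le_dyadic: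
  fixes s y :: real
  assumes y: "y > 0"
  shows "ennreal (y / (s\<^sup>2 + y\<^sup>2)) \<le> (\<Sum>k. ennreal (4 / (4 ^ k * y)) * indicator (cball 0 (2 ^ k * y)) s)"
proof -
  obtain n0 where "\<bar>s\<bar> / y < 2 ^ n0" using real_arch_pow[of 2 "\<bar>s\<bar> / y"] by auto
  then have n0: "\<bar>s\<bar> \<le> 2 ^ n0 * y" using y by (simp add: field_simps)
  define k where "k = (LEAST k. \<bar>s\<bar> \<le> 2 ^ k * y)"
  have k: "\<bar>s\<bar> \<le> 2 ^ k * y" unfolding k_def by (rule LeastI[where P = "\<lambda>k. \<bar>s\<bar> \<le> 2 ^ k * y", OF n0])
  have "y / (s\<^sup>2 + y\<^sup>2) \<le> 4 / (4 ^ k * y)"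
  proof (cases k)
    case 0
    have "y / (s\<^sup>2 + y\<^sup>2) \<le> y / y\<^sup>2" using y by (intro frac_le) auto
    also have "\<dots> \<le> 4 / y" using y by (simp add: power2_eq_square field_simps)
    finally show ?thesis using 0 by simp
  next
    case (Suc j)
    have "\<not> \<bar>s\<bar> \<le> 2 ^ j * y" using not_less_Least[of j "\<lambda>k. \<bar>s\<bar> \<le> 2 ^ k * y"] Suc k_def by simp
    then have "(2 ^ j * y)\<^sup>2 \<le> \<bar>s\<bar>\<^sup>2" using y by (intro power_mono) auto
    moreover have "(2 ^ j * y)\<^sup>2 = 4 ^ j * y\<^sup>2"
    proof -
      have "((2::real) ^ j)\<^sup>2 = 4 ^ j" by (simp add: power2_eq_square flip: power_mult_distrib)
      then show ?thesis by (simp add: power_mult_distrib)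
    qed
    ultimately have "4 ^ j * y\<^sup>2 \<le> s\<^sup>2" by simp
    then have "4 ^ j * y\<^sup>2 \<le> s\<^sup>2 + y\<^sup>2" using zero_le_power2[of y] by linarith
    moreover have "0 < s\<^sup>2 + y\<^sup>2" using y by (simp add: add_nonneg_pos)
    ultimately have "y / (s\<^sup>2 + y\<^sup>2) \<le> y / (4 ^ j * y\<^sup>2)" using y by (intro divide_left_mono) auto
    also have "\<dots> = 4 / (4 ^ k * y)" using y Suc by (simp add: power2_eq_square)
    finally show ?thesis .
  qed
  then have "ennreal (y / (s\<^sup>2 + y\<^sup>2)) \<le> ennreal (4 / (4 ^ k * y)) * indicator (cball 0 (2 ^ k * y)) s"
    using k y by (simp add: indicator_def ennreal_leI)
  also have "\<dots> \<le> (\<Sum>k. ennreal (4 / (4 ^ k * y)) * indicator (cball 0 (2 ^ k * y)) s)"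
  proof -
    have "F k \<le> suminf F" for F :: "nat \<Rightarrow> ennreal"
      using sum_le_suminf[of F "{k}"] by simp
    then show ?thesis .
  qed
  finally show ?thesis .
qed

text \<open>Ball \<open>k\<close> contributes \<open>4 / (4^k * y)\<close> times at most
  \<open>2 * 2^k * y * lam\<close>, that is \<open>8 * lam / 2^k\<close>; the geometric series gives
  16, whatever \<open>y\<close> is.\<close>

lemma poisson_weak_type:
  fixes v :: "real \<Rightarrow> ennreal"
  assumes v [measurable]: "v \<in> borel_measurable borel" and fin: "(\<integral>\<^sup>+t. v t \<partial>lborel) < \<infinity>" and lam: "lam > 0"
  obtains S where "S \<in> sets borel" "ennreal lam * emeasure lborel S \<le> 5 * (\<integral>\<^sup>+t. v t \<partial>lborel)"
    "\<And>x y. x \<notin> S \<Longrightarrow> y > 0 \<Longrightarrow> (\<integral>\<^sup>+t. ennreal (y / ((t - x)\<^sup>2 + y\<^sup>2)) * v t \<partial>lborel) \<le> ennreal (16 * lam)"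
proof -
  have [measurable]: "cball a b \<in> sets borel" for a b :: real by simp
  obtain S where S: "S \<in> sets borel" "ennreal lam * emeasure lborel S \<le> 5 * (\<integral>\<^sup>+t. v t \<partial>lborel)"
    "\<And>x r. x \<notin> S \<Longrightarrow> r > 0 \<Longrightarrow> (\<integral>\<^sup>+t. indicator (cball x r) t * v t \<partial>lborel) \<le> ennreal (2 * r * lam)"
    using vitali_weak_type[OF assms] by blast
  have "(\<integral>\<^sup>+t. ennreal (y / ((t - x)\<^sup>2 + y\<^sup>2)) * v t \<partial>lborel) \<le> ennreal (16 * lam)"
    if x: "x \<notin> S" and y: "y > 0" for x y
  proof -
    have "(\<integral>\<^sup>+t. ennreal (y / ((t - x)\<^sup>2 + y\<^sup>2)) * v t \<partial>lborel) \<le>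
        (\<integral>\<^sup>+t. (\<Sum>k. ennreal (4 / (4 ^ k * y)) * (indicator (cball x (2 ^ k * y)) t * v t)) \<partial>lborel)"
    proof (rule nn_integral_mono)
      fix t
      have "ennreal (y / ((t - x)\<^sup>2 + y\<^sup>2)) * v t \<le>
         (\<Sum>k. ennreal (4 / (4 ^ k * y)) * indicator (cball 0 (2 ^ k * y)) (t - x)) * v t"
        by (intro mult_right_mono poisson_kernel_le_dyadic y) auto
      also have "\<dots> = (\<Sum>k. ennreal (4 / (4 ^ k * y)) * (indicator (cball x (2 ^ k * y)) t * v t))"
        by (subst ennreal_suminf_multc[symmetric]) (simp add: indicator_def dist_real_def abs_minus_commute mult.assoc)
      finally show "ennreal (y / ((t - x)\<^sup>2 + y\<^sup>2)) * v t \<le>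
         (\<Sum>k. ennreal (4 / (4 ^ k * y)) * (indicator (cball x (2 ^ k * y)) t * v t))" .
    qed
    also have "\<dots> = (\<Sum>k. ennreal (4 / (4 ^ k * y)) * (\<integral>\<^sup>+t. indicator (cball x (2 ^ k * y)) t * v t \<partial>lborel))"
      by (subst nn_integral_suminf) (auto simp: nn_integral_cmult)
    also have "\<dots> \<le> (\<Sum>k. ennreal (4 / (4 ^ k * y)) * ennreal (2 * (2 ^ k * y) * lam))"
      using S(3)[OF x] y by (intro suminf_le mult_left_mono) auto
    also have "\<dots> = (\<Sum>k. ennreal (8 * lam * (1 / 2) ^ k))"
    proof (intro suminf_cong)
      fix k :: nat
      have "(4::real) ^ k = 2 ^ k * 2 ^ k" by (simp flip: power_mult_distrib)
      then have "4 / (4 ^ k * y) * (2 * (2 ^ k * y) * lam) = 8 * lam * (1 / 2) ^ k"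
        using y by (simp add: power_divide field_simps)
      then show "ennreal (4 / (4 ^ k * y)) * ennreal (2 * (2 ^ k * y) * lam) = ennreal (8 * lam * (1 / 2) ^ k)"
        using y lam by (simp flip: ennreal_mult)
    qed
    also have "\<dots> = ennreal (16 * lam)"
    proof (rule suminf_ennreal_eq)
      have "(\<lambda>k. 8 * lam * (1 / 2) ^ k) sums (8 * lam * (1 / (1 - 1 / 2)))"
        by (intro sums_mult geometric_sums) simp
      then show "(\<lambda>k. 8 * lam * (1 / 2) ^ k) sums (16 * lam)" by simp
    qed (use lam in auto)
    finally show ?thesis .
  qed
  then show ?thesis using that[OF S(1,2)] by blast
qed

section \<open>The Hardy space and its boundary values\<close>

lemma H2_holomorphic: "h \<in> H2 \<Longrightarrow> h holomorphic_on UHP"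
  by (simp add: H2_def)

lemma continuous_on_horizontal:
  assumes "h holomorphic_on UHP" "y > 0"
  shows "continuous_on UNIV (\<lambda>x. h (Complex x y))"
proof (rule continuous_on_compose2[OF holomorphic_on_imp_continuous_on[OF assms(1)]])
  show "continuous_on UNIV (\<lambda>x. Complex x y)" by (intro continuous_on_Complex continuous_intros)
qed (use assms(2) in \<open>auto simp: UHP_def\<close>)

lemma measurable_horizontal:
  assumes "h holomorphic_on UHP" "y > 0"
  shows "(\<lambda>x. h (Complex x y)) \<in> borel_measurable borel"
  using continuous_on_horizontal[OF assms] by (rule borel_measurable_continuous_onI)

text \<open>\<open>H2\<close> is phrased with the gauge integral. For nonnegative Borel functions it
  agrees with the Lebesgue integral, which gives access to Fubini, Fatou and dominated
  convergence.\<close>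

lemma nonneg_borel_integrable_on_imp_lborel:
  fixes f :: "real \<Rightarrow> real"
  assumes "f \<in> borel_measurable borel" "\<And>x. 0 \<le> f x" "f integrable_on UNIV"
  shows "integrable lborel f"
proof (rule integrableI_bounded)
  have "integral\<^sup>N lborel f = ennreal (integral UNIV f)"
    using assms by (intro nn_integral_has_integral_lborel) (auto simp: has_integral_integral)
  then show "(\<integral>\<^sup>+x. ennreal (norm (f x)) \<partial>lborel) < \<infinity>" using assms(2) by simp
qed (use assms in auto)

lemma H2_line_integrable:
  assumes "h \<in> H2" "y > 0"
  shows "integrable lborel (\<lambda>x. (cmod (h (Complex x y)))\<^sup>2)"
proof (rule nonneg_borel_integrable_on_imp_lborel)
  show "(\<lambda>x. (cmod (h (Complex x y)))\<^sup>2) \<in> borel_measurable borel"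
    using measurable_horizontal[OF H2_holomorphic[OF assms(1)] assms(2)] by measurable
qed (use assms in \<open>auto simp: H2_def\<close>)

lemma H2_line_bound:
  assumes "h \<in> H2"
  obtains C where "C \<ge> 0" "\<And>y. y > 0 \<Longrightarrow> (LBINT x. (cmod (h (Complex x y)))\<^sup>2) \<le> C"
proof -
  obtain C where C: "\<And>y. y > 0 \<Longrightarrow> integral UNIV (\<lambda>x. (cmod (h (Complex x y)))\<^sup>2) \<le> C"
    using assms by (auto simp: H2_def)
  have *: "(LBINT x. (cmod (h (Complex x y)))\<^sup>2) \<le> C" if "y > 0" for y
    using C[OF that] integral_lborel[OF H2_line_integrable[OF assms that]] by simp
  show ?thesis
  proof (rule that[OF _ *])
    have "0 \<le> (LBINT x. (cmod (h (Complex x 1)))\<^sup>2)" by (rule integral_nonneg_AE) simp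
    from order_trans[OF this *[of 1]] show "0 \<le> C" by simp
  qed
qed

lemma H2_I:
  assumes "h holomorphic_on UHP"
    and "\<And>y. y > 0 \<Longrightarrow> integrable lborel (\<lambda>x. (cmod (h (Complex x y)))\<^sup>2)"
    and "\<And>y. y > 0 \<Longrightarrow> (LBINT x. (cmod (h (Complex x y)))\<^sup>2) \<le> C"
  shows "h \<in> H2"
  using assms integrable_on_lborel[OF assms(2)] integral_lborel[OF assms(2)]
  unfolding H2_def by (auto intro!: exI[of _ C])

text \<open>Serves to place \<open>B z * g z\<close> in \<open>H2\<close>, a Blaschke product being
  bounded by 1.\<close>

lemma H2_mono:
  assumes "h \<in> H2" "g holomorphic_on UHP" "\<And>z. z \<in> UHP \<Longrightarrow> cmod (g z) \<le> cmod (h z)"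
  shows "g \<in> H2"
proof -
  obtain C where C: "\<And>y. y > 0 \<Longrightarrow> (LBINT x. (cmod (h (Complex x y)))\<^sup>2) \<le> C"
    using H2_line_bound[OF assms(1)] by blast
  have le: "(cmod (g (Complex x y)))\<^sup>2 \<le> (cmod (h (Complex x y)))\<^sup>2" if "y > 0" for x y
    using assms(3) that by (intro power_mono) (auto simp: UHP_def)
  have int: "integrable lborel (\<lambda>x. (cmod (g (Complex x y)))\<^sup>2)" if "y > 0" for y
  proof (rule Bochner_Integration.integrable_bound[OF H2_line_integrable[OF assms(1) that]])
    show "(\<lambda>x. (cmod (g (Complex x y)))\<^sup>2) \<in> borel_measurable lborel"
      using measurable_horizontal[OF assms(2) that] by measurable
  qed (use le[OF that] in auto)
  show ?thesis
  proof (rule H2_I[OF assms(2) int])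
    fix y :: real assume "y > 0"
    then show "(LBINT x. (cmod (g (Complex x y)))\<^sup>2) \<le> C"
      using C[of y] integral_mono[OF int H2_line_integrable[OF assms(1)] le] by fastforce
  qed
qed

text \<open>Lets the maximal bounds for \<open>H2\<close> functions be applied to the difference of
  a function and its vertical translate.\<close>

lemma H2_shift_diff:
  assumes "h \<in> H2" "d \<ge> 0"
  shows "(\<lambda>z. h (z + \<i> * of_real d) - h z) \<in> H2"
proof -
  obtain C where C: "\<And>y. y > 0 \<Longrightarrow> (LBINT x. (cmod (h (Complex x y)))\<^sup>2) \<le> C"
    using H2_line_bound[OF assms(1)] by blast
  have hol: "h holomorphic_on UHP" using H2_holomorphic assms by blast
  have hol': "(\<lambda>z. h (z + \<i> * of_real d) - h z) holomorphic_on UHP"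
    using assms(2) by (intro holomorphic_intros holomorphic_on_compose_gen[OF _ hol, unfolded o_def] hol)
      (auto simp: UHP_def)
  have sq: "(cmod (a - b))\<^sup>2 \<le> 2 * (cmod a)\<^sup>2 + 2 * (cmod b)\<^sup>2" for a b :: complex
  proof -
    have "(cmod (a - b))\<^sup>2 \<le> (cmod a + cmod b)\<^sup>2" by (intro power_mono norm_triangle_ineq4) auto
    also have "\<dots> \<le> 2 * (cmod a)\<^sup>2 + 2 * (cmod b)\<^sup>2"
      using sum_squares_bound[of "cmod a" "cmod b"] by (simp add: power2_sum)
    finally show ?thesis .
  qed
  have e: "Complex x y + \<i> * of_real d = Complex x (y + d)" for x y by (simp add: complex_eq_iff)
  have int2: "integrable lborel (\<lambda>x. 2 * (cmod (h (Complex x (y + d))))\<^sup>2 + 2 * (cmod (h (Complex x y)))\<^sup>2)"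
    if "y > 0" for y
    using that assms by (intro Bochner_Integration.integrable_add integrable_mult_right H2_line_integrable) auto
  have int: "integrable lborel (\<lambda>x. (cmod (h (Complex x y + \<i> * of_real d) - h (Complex x y)))\<^sup>2)" if "y > 0" for y
  proof (rule Bochner_Integration.integrable_bound[OF int2[OF that]])
    show "(\<lambda>x. (cmod (h (Complex x y + \<i> * of_real d) - h (Complex x y)))\<^sup>2) \<in> borel_measurable lborel"
      using measurable_horizontal[OF hol' that] by measurable
  qed (use sq in \<open>auto simp: e\<close>)
  show ?thesis
  proof (rule H2_I[OF hol' int])
    fix y :: real assume y: "y > 0"
    have "(LBINT x. (cmod (h (Complex x y + \<i> * of_real d) - h (Complex x y)))\<^sup>2) \<le>
       (LBINT x. 2 * (cmod (h (Complex x (y + d))))\<^sup>2 + 2 * (cmod (h (Complex x y)))\<^sup>2)"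
      using sq by (intro integral_mono int y int2) (auto simp: e)
    also have "\<dots> = 2 * (LBINT x. (cmod (h (Complex x (y + d))))\<^sup>2) + 2 * (LBINT x. (cmod (h (Complex x y)))\<^sup>2)"
      using y assms by (subst Bochner_Integration.integral_add) (auto intro!: integrable_mult_right H2_line_integrable)
    also have "\<dots> \<le> 2 * C + 2 * C" using C[of y] C[of "y + d"] y assms by simp
    finally show "(LBINT x. (cmod (h (Complex x y + \<i> * of_real d) - h (Complex x y)))\<^sup>2) \<le> 2 * C + 2 * C" .
  qed
qed

text \<open>The difference is the derivative of \<open>w \<mapsto> \<integral>\<^sub>0\<^sup>r h (w + u) du\<close>, which the line norms bound on the whole
  half-plane, so the Cauchy inequality applies.\<close>

lemma H2_horizontal_difference_bounded:
  assumes h: "h \<in> H2" and b: "b > 0"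
  obtains M where "\<And>w r. Im w \<ge> b \<Longrightarrow> 0 \<le> r \<Longrightarrow> r \<le> 1 \<Longrightarrow> cmod (h (w + of_real r) - h w) \<le> M"
proof -
  obtain C where C: "\<And>y. y > 0 \<Longrightarrow> integral UNIV (\<lambda>x. (cmod (h (Complex x y)))\<^sup>2) \<le> C"
    and I: "\<And>y. y > 0 \<Longrightarrow> (\<lambda>x. (cmod (h (Complex x y)))\<^sup>2) integrable_on UNIV"
    using h by (auto simp: H2_def)
  have hol: "h holomorphic_on UHP" using H2_holomorphic h by blast
  have UHP: "open UHP" "convex UHP"
    using open_halfspace_Im_gt[of 0] convex_halfspace_Im_gt[of 0] by (auto simp: UHP_def)
  obtain H where H: "\<And>z. z \<in> UHP \<Longrightarrow> (H has_field_derivative h z) (at z)"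
    using holomorphic_convex_primitive'[OF UHP(2,1) hol] by (metis UHP(1) at_within_open)
  have bd: "cmod (H (w + of_real r) - H w) \<le> (1 + C) / 2" if w: "Im w > 0" and r: "0 \<le> r" "r \<le> 1" for w r
  proof -
    have W: "w + of_real u = Complex (Re w + u) (Im w)" for u by (simp add: complex_eq_iff)
    have "((\<lambda>u. h (w + of_real u)) has_integral (H (w + of_real r) - H (w + of_real 0))) {0..r}"
    proof (rule fundamental_theorem_of_calculus[OF r(1)])
      fix u :: real
      have "((\<lambda>u. w + complex_of_real u) has_vector_derivative 1) (at u within {0..r})"
        by (auto intro!: derivative_eq_intros)
      moreover have "(H has_field_derivative h (w + of_real u)) (at (w + of_real u))"
        using H w by (simp add: UHP_def)
      ultimately show "((\<lambda>u. H (w + of_real u)) has_vector_derivative h (w + of_real u)) (at u within {0..r})"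
        using field_vector_diff_chain_within[of "\<lambda>u. w + complex_of_real u" 1 u "{0..r}" H] 
        by (auto simp: o_def intro: has_field_derivative_at_within)
    qed
    then have i: "((\<lambda>u. h (w + of_real u)) has_integral (H (w + of_real r) - H w)) {0..r}" by simp
    have I': "(\<lambda>u. (cmod (h (w + of_real u)))\<^sup>2) integrable_on UNIV"
    proof -
      have "integrable lborel (\<lambda>u. (cmod (h (Complex (Re w + 1 * u) (Im w))))\<^sup>2)"
        using w by (subst lborel_integrable_real_affine_iff) (auto intro!: H2_line_integrable h)
      then show ?thesis unfolding W by (intro integrable_on_lborel) simp
    qed
    have "integral UNIV (\<lambda>u. (cmod (h (w + of_real u)))\<^sup>2) = (LBINT u. (cmod (h (Complex (Re w + 1 * u) (Im w))))\<^sup>2)"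
    proof -
      have "integrable lborel (\<lambda>u. (cmod (h (Complex (Re w + 1 * u) (Im w))))\<^sup>2)"
        using w by (subst lborel_integrable_real_affine_iff) (auto intro!: H2_line_integrable h)
      then show ?thesis unfolding W by (subst integral_lborel) simp_all
    qed
    also have "\<dots> = (LBINT u. (cmod (h (Complex u (Im w))))\<^sup>2)"
      using lborel_integral_real_affine[of 1 "\<lambda>u. (cmod (h (Complex u (Im w))))\<^sup>2" "Re w"] by simp
    also have "\<dots> \<le> C" using C[OF w] integral_lborel[OF H2_line_integrable[OF h w]] by simp
    finally have I2: "integral UNIV (\<lambda>u. (cmod (h (w + of_real u)))\<^sup>2) \<le> C" .
    have I3: "(\<lambda>u. (cmod (h (w + of_real u)))\<^sup>2) integrable_on {0..r}"
      using integrable_on_subcbox[OF I', of 0 r] by simp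
    \<comment> \<open>The inequality \<open>t \<le> (1 + t^2) / 2\<close> stands in for
      Cauchy-Schwarz; over a segment of length \<open>r \<le> 1\<close> it bounds the integral by
      \<open>(1 + C) / 2\<close>.\<close>
    have "cmod (integral {0..r} (\<lambda>u. h (w + of_real u))) \<le>
        integral {0..r} (\<lambda>u. 1/2 + (cmod (h (w + of_real u)))\<^sup>2 / 2)"
    proof (rule integral_norm_bound_integral)
      fix u
      show "cmod (h (w + of_real u)) \<le> 1/2 + (cmod (h (w + of_real u)))\<^sup>2 / 2"
        using sum_squares_bound[of 1 "cmod (h (w + of_real u))"] by simp
    qed (use i I3 in \<open>auto intro!: integrable_add integrable_on_divide\<close>)
    also have "\<dots> = r / 2 + integral {0..r} (\<lambda>u. (cmod (h (w + of_real u)))\<^sup>2) / 2"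
      using I3 r by (subst Henstock_Kurzweil_Integration.integral_add) (auto intro!: integrable_on_divide)
    also have "integral {0..r} (\<lambda>u. (cmod (h (w + of_real u)))\<^sup>2) \<le> integral UNIV (\<lambda>u. (cmod (h (w + of_real u)))\<^sup>2)"
      by (rule integral_subset_le[OF _ I3 I']) auto
    finally show ?thesis using i I2 r by (simp add: integral_unique)
  qed
  have "cmod (h (w + of_real r) - h w) \<le> fact 1 * ((1 + C) / 2) / (b / 2) ^ 1"
    if w: "Im w \<ge> b" and r: "0 \<le> r" "r \<le> 1" for w r
  proof -
    define G where "G = (\<lambda>z. H (z + of_real r) - H z)"
    have sub: "Im z > 0" if "z \<in> cball w (b/2)" for z
    proof -
      have "\<bar>Im (w - z)\<bar> \<le> b / 2" using that abs_Im_le_cmod[of "w - z"] by (simp add: dist_norm)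
      then show ?thesis using w b by (simp only: minus_complex.simps)
    qed
    have dG: "(G has_field_derivative (h (z + of_real r) - h z)) (at z)" if "Im z > 0" for z
    proof -
      have "((\<lambda>z. H (z + of_real r)) has_field_derivative h (z + of_real r)) (at z)"
        using H[of "z + of_real r"] that DERIV_shift[of H "h (z + of_real r)" z "of_real r"]
        by (simp add: UHP_def)
      then show ?thesis unfolding G_def using H[of z] that by (intro DERIV_diff) (auto simp: UHP_def)
    qed
    have hG: "G holomorphic_on cball w (b/2)"
      unfolding holomorphic_on_def field_differentiable_def
      using dG sub by (meson has_field_derivative_at_within)
    have "cmod ((deriv ^^ 1) G w) \<le> fact 1 * ((1 + C) / 2) / (b / 2) ^ 1"
    proof (rule Cauchy_inequality)
      show "G holomorphic_on ball w (b/2)" using hG ball_subset_cball holomorphic_on_subset by blast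
      show "continuous_on (cball w (b/2)) G" using hG holomorphic_on_imp_continuous_on by blast
      fix x assume "cmod (w - x) = b / 2"
      then show "cmod (G x) \<le> (1 + C) / 2"
        unfolding G_def using sub[of x] r by (intro bd) (auto simp: dist_norm)
    qed (use b in auto)
    moreover have "deriv G w = h (w + of_real r) - h w"
      using dG[of w] w b by (intro DERIV_imp_deriv) auto
    ultimately show ?thesis by simp
  qed
  then show ?thesis using that by blast
qed

text \<open>Over a unit segment of a horizontal line \<open>h\<close> differs from its initial value
  by at most \<open>M\<close>. A value beyond \<open>M + 1 + C\<close> would keep
  \<open>cmod h\<close> at least \<open>1 + C\<close> on the segment and push the line integral of
  its square beyond \<open>C\<close>.\<close>

lemma H2_bounded_above_height:
  assumes h: "h \<in> H2" and b: "b > 0"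
  obtains M where "\<And>w. Im w \<ge> b \<Longrightarrow> cmod (h w) \<le> M"
proof -
  obtain M where M: "\<And>w r. Im w \<ge> b \<Longrightarrow> 0 \<le> r \<Longrightarrow> r \<le> 1 \<Longrightarrow> cmod (h (w + of_real r) - h w) \<le> M"
    using H2_horizontal_difference_bounded[OF assms] by blast
  obtain C where C: "C \<ge> 0" "\<And>y. y > 0 \<Longrightarrow> (LBINT x. (cmod (h (Complex x y)))\<^sup>2) \<le> C"
    using H2_line_bound[OF h] by blast
  have "cmod (h w) \<le> M + (1 + C)" if w: "Im w \<ge> b" for w
  proof (rule ccontr)
    assume n: "\<not> cmod (h w) \<le> M + (1 + C)"
    have big: "indicator {Re w..Re w + 1} x * (1 + C) \<le> (cmod (h (Complex x (Im w))))\<^sup>2" for x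
    proof (cases "x \<in> {Re w..Re w + 1}")
      case True
      have "Complex x (Im w) = w + of_real (x - Re w)" by (simp add: complex_eq_iff)
      then have "cmod (h (Complex x (Im w)) - h w) \<le> M" using M[OF w, of "x - Re w"] True by simp
      then have "1 + C \<le> cmod (h (Complex x (Im w)))"
        using n norm_triangle_ineq3[of "h (Complex x (Im w))" "h w"] by linarith
      then have "(1 + C) * 1 \<le> cmod (h (Complex x (Im w))) * cmod (h (Complex x (Im w)))"
        using C(1) by (intro mult_mono) auto
      then show ?thesis using True by (simp add: power2_eq_square)
    qed auto
    have "(LBINT x. indicator {Re w..Re w + 1} x * (1 + C)) \<le> (LBINT x. (cmod (h (Complex x (Im w))))\<^sup>2)"
      using big w b by (intro integral_mono H2_line_integrable h integrable_mult_left) auto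
    then show False using C(2)[of "Im w"] w b by simp
  qed
  then show ?thesis using that by blast
qed

section \<open>The Poisson semigroup on horizontal lines\<close>

lemma nn_integral_poisson_kernel_finite:
  assumes "r > 0"
  shows "(\<integral>\<^sup>+s. ennreal (r / (s\<^sup>2 + r\<^sup>2)) \<partial>lborel) < \<infinity>"
proof -
  have "integrable lborel (\<lambda>s. r / (s\<^sup>2 + r\<^sup>2))"
  proof (rule integrable_dominated_inverse_square[where C = "r * (1 + 1 / r\<^sup>2)"])
    fix s :: real
    have p: "s\<^sup>2 + r\<^sup>2 > 0" using assms by (simp add: add_nonneg_pos)
    have "1 + s\<^sup>2 \<le> (1 + 1 / r\<^sup>2) * (s\<^sup>2 + r\<^sup>2)"
      using assms by (simp add: field_simps)
    then have "r * (1 + s\<^sup>2) \<le> r * ((1 + 1 / r\<^sup>2) * (s\<^sup>2 + r\<^sup>2))"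
      using assms by (intro mult_left_mono) auto
    then show "norm (r / (s\<^sup>2 + r\<^sup>2)) \<le> r * (1 + 1 / r\<^sup>2) / (1 + s\<^sup>2)"
      using assms p by (simp add: pos_divide_le_eq pos_le_divide_eq add_pos_nonneg mult.assoc)
  qed measurable
  then show ?thesis
    using assms by (simp add: integrable_iff_bounded)
qed

text \<open>The Fubini hypothesis behind self-adjointness. Bounding
  \<open>cmod (u t) * cmod (v x)\<close> by the sum of the squares splits the double integral in
  two, and in each the kernel integrates to the same constant \<open>K\<close> in the free
  variable.\<close>

lemma integrable_poisson_product:
  fixes u v :: "real \<Rightarrow> complex"
  assumes [measurable]: "u \<in> borel_measurable borel" "v \<in> borel_measurable borel"
    and u: "integrable lborel (\<lambda>t. (cmod (u t))\<^sup>2)" and v: "integrable lborel (\<lambda>t. (cmod (v t))\<^sup>2)"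
    and r: "r > 0"
  shows "integrable (lborel \<Otimes>\<^sub>M lborel) (\<lambda>(x, t). of_real (r / ((t - x)\<^sup>2 + r\<^sup>2)) * u t * v x)"
proof (rule integrableI_bounded)
  let ?P = "\<lambda>s. ennreal (r / (s\<^sup>2 + r\<^sup>2))"
  let ?U = "\<lambda>t. ennreal ((cmod (u t))\<^sup>2)" and ?V = "\<lambda>t. ennreal ((cmod (v t))\<^sup>2)"
  define K where "K = (\<integral>\<^sup>+s. ?P s \<partial>lborel)"
  have K1: "(\<integral>\<^sup>+x. ?P (t - x) \<partial>lborel) = K" for t
    unfolding K_def using nn_integral_real_affine[of ?P "-1" t] by simp
  have K2: "(\<integral>\<^sup>+t. ?P (t - x) \<partial>lborel) = K" for x
    unfolding K_def using nn_integral_real_affine[of ?P 1 "-x"] by simp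
  have "(\<integral>\<^sup>+p. norm (case p of (x, t) \<Rightarrow> of_real (r / ((t - x)\<^sup>2 + r\<^sup>2)) * u t * v x) \<partial>(lborel \<Otimes>\<^sub>M lborel))
      \<le> (\<integral>\<^sup>+p. (case p of (x, t) \<Rightarrow> ?P (t - x) * ?U t) + (case p of (x, t) \<Rightarrow> ?P (t - x) * ?V x) \<partial>(lborel \<Otimes>\<^sub>M lborel))"
  proof (rule nn_integral_mono)
    fix p :: "real \<times> real"
    obtain x t where p: "p = (x, t)" by (cases p)
    have P0: "r / ((t - x)\<^sup>2 + r\<^sup>2) \<ge> 0" using r by (intro divide_nonneg_nonneg) auto
    have "2 * (cmod (u t) * cmod (v x)) \<le> (cmod (u t))\<^sup>2 + (cmod (v x))\<^sup>2"
      using sum_squares_bound[of "cmod (u t)" "cmod (v x)"] by simp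
    then have "cmod (u t) * cmod (v x) \<le> (cmod (u t))\<^sup>2 + (cmod (v x))\<^sup>2"
      using mult_nonneg_nonneg[OF norm_ge_zero[of "u t"] norm_ge_zero[of "v x"]] by linarith
    then have "r / ((t - x)\<^sup>2 + r\<^sup>2) * (cmod (u t) * cmod (v x)) \<le> r / ((t - x)\<^sup>2 + r\<^sup>2) * ((cmod (u t))\<^sup>2 + (cmod (v x))\<^sup>2)"
      by (rule mult_left_mono[OF _ P0])
    moreover have "norm (of_real (r / ((t - x)\<^sup>2 + r\<^sup>2)) * u t * v x) = r / ((t - x)\<^sup>2 + r\<^sup>2) * (cmod (u t) * cmod (v x))"
      using P0 by (simp only: norm_mult norm_of_real abs_of_nonneg mult.assoc)
    ultimately have "ennreal (norm (of_real (r / ((t - x)\<^sup>2 + r\<^sup>2)) * u t * v x)) \<le>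
        ennreal (r / ((t - x)\<^sup>2 + r\<^sup>2) * (cmod (u t))\<^sup>2 + r / ((t - x)\<^sup>2 + r\<^sup>2) * (cmod (v x))\<^sup>2)"
      by (intro ennreal_leI) (simp only: distrib_left)
    also have "\<dots> = ?P (t - x) * ?U t + ?P (t - x) * ?V x"
      by (subst ennreal_plus) (use P0 in \<open>simp_all only: ennreal_mult mult_nonneg_nonneg zero_le_power2\<close>)
    finally show "ennreal (norm (case p of (x, t) \<Rightarrow> of_real (r / ((t - x)\<^sup>2 + r\<^sup>2)) * u t * v x)) \<le>
        (case p of (x, t) \<Rightarrow> ?P (t - x) * ?U t) + (case p of (x, t) \<Rightarrow> ?P (t - x) * ?V x)"
      unfolding p by simp
  qed
  also have "\<dots> = (\<integral>\<^sup>+p. (case p of (x, t) \<Rightarrow> ?P (t - x) * ?U t) \<partial>(lborel \<Otimes>\<^sub>M lborel))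
     + (\<integral>\<^sup>+p. (case p of (x, t) \<Rightarrow> ?P (t - x) * ?V x) \<partial>(lborel \<Otimes>\<^sub>M lborel))"
    by (rule nn_integral_add) measurable
  also have "(\<integral>\<^sup>+p. (case p of (x, t) \<Rightarrow> ?P (t - x) * ?U t) \<partial>(lborel \<Otimes>\<^sub>M lborel)) = (\<integral>\<^sup>+t. \<integral>\<^sup>+x. ?P (t - x) * ?U t \<partial>lborel \<partial>lborel)"
    by (subst lborel_pair.nn_integral_snd[symmetric]) auto
  also have "\<dots> = K * (\<integral>\<^sup>+t. ?U t \<partial>lborel)"
    by (simp add: nn_integral_multc K1 nn_integral_cmult)
  also have "(\<integral>\<^sup>+p. (case p of (x, t) \<Rightarrow> ?P (t - x) * ?V x) \<partial>(lborel \<Otimes>\<^sub>M lborel)) = (\<integral>\<^sup>+x. \<integral>\<^sup>+t. ?P (t - x) * ?V x \<partial>lborel \<partial>lborel)"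
    by (subst lborel.nn_integral_fst[symmetric]) auto
  also have "\<dots> = K * (\<integral>\<^sup>+t. ?V t \<partial>lborel)"
    by (simp add: nn_integral_multc K2 nn_integral_cmult)
  also have "K * (\<integral>\<^sup>+t. ?U t \<partial>lborel) + K * (\<integral>\<^sup>+t. ?V t \<partial>lborel) < \<infinity>"
    using nn_integral_poisson_kernel_finite[OF r] u v
    by (simp add: K_def[symmetric] ennreal_mult_less_top integrable_iff_bounded)
  finally show "(\<integral>\<^sup>+p. norm (case p of (x, t) \<Rightarrow> of_real (r / ((t - x)\<^sup>2 + r\<^sup>2)) * u t * v x) \<partial>(lborel \<Otimes>\<^sub>M lborel)) < \<infinity>" .
qed measurable

text \<open>The line at height \<open>b\<close> plays the role of the boundary, since
  \<open>h\<close> is bounded from there upwards. The formula for the square bounds the square of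
  \<open>cmod h\<close> by a Poisson average of its values on that line, so a weak bound for
  integrable functions suffices for square integrable data.\<close>

lemma H2_poisson:
  fixes h :: "complex \<Rightarrow> complex"
  assumes h: "h \<in> H2" and b: "b > 0" and r: "r > 0"
  shows "(LBINT t. of_real (r / ((t - x)\<^sup>2 + r\<^sup>2)) * h (Complex t b)) = pi * h (Complex x (b + r))"
    and "integrable lborel (\<lambda>t. of_real (r / ((t - x)\<^sup>2 + r\<^sup>2)) * (h (Complex t b))\<^sup>2)"
    and "(LBINT t. of_real (r / ((t - x)\<^sup>2 + r\<^sup>2)) * (h (Complex t b))\<^sup>2) = pi * (h (Complex x (b + r)))\<^sup>2"
proof -
  obtain M where M: "\<And>w. Im w \<ge> b \<Longrightarrow> cmod (h w) \<le> M"
    using H2_bounded_above_height[OF h b] by blast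
  have hol: "(\<lambda>z. h (z + \<i> * of_real b)) holomorphic_on {z. Im z > -b}"
    by (intro holomorphic_on_compose_gen[OF _ H2_holomorphic[OF h], unfolded o_def] holomorphic_intros)
       (auto simp: UHP_def)
  have hol2: "(\<lambda>z. (h (z + \<i> * of_real b))\<^sup>2 :: complex) holomorphic_on {z. Im z > -b}"
    by (rule holomorphic_on_power[OF hol])
  have e: "of_real t + \<i> * of_real b = Complex t b" "Complex t r + \<i> * of_real b = Complex t (b + r)" for t
    by (simp_all add: complex_eq_iff)
  show "(LBINT t. of_real (r / ((t - x)\<^sup>2 + r\<^sup>2)) * h (Complex t b)) = pi * h (Complex x (b + r))"
    using halfplane_poisson(2)[OF hol b M r] unfolding e by simp
  have "cmod ((h (z + \<i> * of_real b))\<^sup>2) \<le> M\<^sup>2" if "Im z \<ge> 0" for z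
    using M[of "z + \<i> * of_real b"] that by (simp add: norm_power power_mono)
  note * = halfplane_poisson[OF hol2 b this r, of x, unfolded e]
  show "integrable lborel (\<lambda>t. of_real (r / ((t - x)\<^sup>2 + r\<^sup>2)) * (h (Complex t b))\<^sup>2)"
    by (rule *(1))
  show "(LBINT t. of_real (r / ((t - x)\<^sup>2 + r\<^sup>2)) * (h (Complex t b))\<^sup>2) = pi * (h (Complex x (b + r)))\<^sup>2"
    by (rule *(2))
qed

text \<open>The Poisson semigroup is self-adjoint, so the inner product of two horizontal lines depends only on
  the sum of their heights.\<close>

lemma H2_line_inner:
  assumes h: "h \<in> H2" and b: "b > 0" and r: "r > 0"
  shows "(LBINT x. h (Complex x (b + 2 * r)) * cnj (h (Complex x b))) =
         of_real (LBINT x. (cmod (h (Complex x (b + r))))\<^sup>2)"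
proof -
  define u v where "u = (\<lambda>t. h (Complex t (b + r)))" and "v = (\<lambda>x. cnj (h (Complex x b)))"
  have hol: "h holomorphic_on UHP" using h H2_holomorphic by blast
  have [measurable]: "u \<in> borel_measurable borel"
    unfolding u_def by (rule measurable_horizontal[OF hol]) (use b r in simp)
  have [measurable]: "v \<in> borel_measurable borel"
    unfolding v_def by (intro borel_measurable_continuous_onI continuous_on_cnj continuous_on_horizontal hol b)
  have I: "integrable (lborel \<Otimes>\<^sub>M lborel) (\<lambda>(x, t). of_real (r / ((t - x)\<^sup>2 + r\<^sup>2)) * u t * v x)"
  proof (rule integrable_poisson_product[OF _ _ _ _ r])
    show "integrable lborel (\<lambda>t. (cmod (u t))\<^sup>2)" "integrable lborel (\<lambda>t. (cmod (v t))\<^sup>2)"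
      using b r by (auto simp: u_def v_def intro!: H2_line_integrable h)
  qed measurable
  \<comment> \<open>The kernel lifts \<open>u\<close> from height \<open>b + r\<close> to
    \<open>b + 2 * r\<close>. After Fubini, being symmetric in \<open>x\<close> and
    \<open>t\<close>, it lifts \<open>v\<close> from \<open>b\<close> to \<open>b + r\<close>
    instead, where \<open>v\<close> meets \<open>u\<close>.\<close>
  have "pi * (LBINT x. h (Complex x (b + 2 * r)) * cnj (h (Complex x b))) =
     (LBINT x. (LBINT t. of_real (r / ((t - x)\<^sup>2 + r\<^sup>2)) * u t * v x))"
  proof -
    have "(LBINT t. of_real (r / ((t - x)\<^sup>2 + r\<^sup>2)) * u t * v x) = pi * (h (Complex x (b + 2 * r)) * v x)" for x
    proof -
      have "(LBINT t. of_real (r / ((t - x)\<^sup>2 + r\<^sup>2)) * u t * v x) = (LBINT t. of_real (r / ((t - x)\<^sup>2 + r\<^sup>2)) * u t) * v x"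
        by (rule integral_mult_left_zero)
      also have "(LBINT t. of_real (r / ((t - x)\<^sup>2 + r\<^sup>2)) * u t) = pi * h (Complex x (b + r + r))"
        unfolding u_def using b r by (intro H2_poisson(1) h) auto
      also have "b + r + r = b + 2 * r" by simp
      finally show ?thesis by (simp only: mult.assoc)
    qed
    then show ?thesis by (simp add: v_def)
  qed
  also have "\<dots> = (LBINT t. (LBINT x. of_real (r / ((t - x)\<^sup>2 + r\<^sup>2)) * u t * v x))"
    by (rule lborel_pair.Fubini_integral[OF I, symmetric])
  also have "\<dots> = (LBINT t. complex_of_real pi * complex_of_real ((cmod (u t))\<^sup>2))"
  proof (rule Bochner_Integration.integral_cong[OF refl])
    fix t
    have "(LBINT x. of_real (r / ((t - x)\<^sup>2 + r\<^sup>2)) * u t * v x) =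
       u t * cnj (LBINT x. of_real (r / ((x - t)\<^sup>2 + r\<^sup>2)) * h (Complex x b))"
    proof -
      have "of_real (r / ((t - x)\<^sup>2 + r\<^sup>2)) * u t * v x = u t * cnj (of_real (r / ((x - t)\<^sup>2 + r\<^sup>2)) * h (Complex x b))" for x
        by (simp only: v_def power2_commute[of t x] complex_cnj_mult complex_cnj_complex_of_real mult_ac)
      then show ?thesis
        by (simp only: integral_mult_right_zero Bochner_Integration.integral_cnj)
    qed
    also have "\<dots> = u t * cnj (pi * u t)" using H2_poisson(1)[OF h b r] by (simp add: u_def)
    also have "\<dots> = complex_of_real pi * complex_of_real ((cmod (u t))\<^sup>2)"
      using complex_norm_square[of "u t"] by (simp add: mult_ac)
    finally show "(LBINT x. of_real (r / ((t - x)\<^sup>2 + r\<^sup>2)) * u t * v x) = complex_of_real pi * complex_of_real ((cmod (u t))\<^sup>2)" .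
  qed
  also have "\<dots> = complex_of_real pi * complex_of_real (LBINT t. (cmod (u t))\<^sup>2)"
    by (simp only: integral_mult_right_zero integral_complex_of_real)
  finally show ?thesis by (simp add: u_def)
qed

text \<open>The cross term depends only on the mean height, so the squared distance of two lines is
  a second difference of the squared line norm. The Cauchy property becomes a question about one
  real function of the height.\<close>

lemma H2_line_diff_norm:
  assumes h: "h \<in> H2" and b: "b > 0" and r: "r > 0"
  shows "(LBINT x. (cmod (h (Complex x (b + 2 * r)) - h (Complex x b)))\<^sup>2) =
     (LBINT x. (cmod (h (Complex x (b + 2 * r))))\<^sup>2) - 2 * (LBINT x. (cmod (h (Complex x (b + r))))\<^sup>2)
     + (LBINT x. (cmod (h (Complex x b)))\<^sup>2)"
proof -
  define u v where "u = (\<lambda>x. h (Complex x (b + 2 * r)))" and "v = (\<lambda>x. h (Complex x b))"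
  have hol: "h holomorphic_on UHP" using h H2_holomorphic by blast
  have [measurable]: "u \<in> borel_measurable borel" "v \<in> borel_measurable borel"
    unfolding u_def v_def using measurable_horizontal[OF hol, of "b + 2 * r"] measurable_horizontal[OF hol, of b] b r by auto
  have iu: "integrable lborel (\<lambda>x. (cmod (u x))\<^sup>2)" and iv: "integrable lborel (\<lambda>x. (cmod (v x))\<^sup>2)"
    unfolding u_def v_def using b r by (auto intro!: H2_line_integrable h)
  have cm [measurable]: "cnj \<in> borel_measurable borel"
    by (intro borel_measurable_continuous_onI continuous_intros)
  have iuv: "integrable lborel (\<lambda>x. u x * cnj (v x))"
  proof (rule Bochner_Integration.integrable_bound)
    show "integrable lborel (\<lambda>x. (cmod (u x))\<^sup>2 + (cmod (v x))\<^sup>2)" using iu iv by simp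
    have "cmod (u x) * cmod (v x) \<le> (cmod (u x))\<^sup>2 + (cmod (v x))\<^sup>2" for x
      using sum_squares_bound[of "cmod (u x)" "cmod (v x)"] mult_nonneg_nonneg[OF norm_ge_zero[of "u x"] norm_ge_zero[of "v x"]]
      by linarith
    then show "AE x in lborel. norm (u x * cnj (v x)) \<le> norm ((cmod (u x))\<^sup>2 + (cmod (v x))\<^sup>2)"
      by (simp add: norm_mult)
  qed measurable
  have "(cmod (a - c))\<^sup>2 = (cmod a)\<^sup>2 + (cmod c)\<^sup>2 - 2 * Re (a * cnj c)" for a c
    unfolding cmod_power2 by (simp add: power2_eq_square algebra_simps)
  then have "(LBINT x. (cmod (u x - v x))\<^sup>2) = (LBINT x. (cmod (u x))\<^sup>2 + (cmod (v x))\<^sup>2 - 2 * Re (u x * cnj (v x)))"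
    by simp
  also have "\<dots> = (LBINT x. (cmod (u x))\<^sup>2) + (LBINT x. (cmod (v x))\<^sup>2) - 2 * Re (LBINT x. u x * cnj (v x))"
    using iu iv integrable_Re[OF iuv]
    by (subst Bochner_Integration.integral_diff)
       (auto simp: integral_Re[OF iuv, symmetric] simp del: times_complex.simps)
  also have "Re (LBINT x. u x * cnj (v x)) = (LBINT x. (cmod (h (Complex x (b + r))))\<^sup>2)"
    unfolding u_def v_def H2_line_inner[OF assms] by simp
  finally show ?thesis by (simp add: u_def v_def)
qed

text \<open>A bounded midconvex \<open>phi\<close> cannot increase: an increase over one step of
  length \<open>r\<close> recurs at every later step, and \<open>phi\<close> would pass
  \<open>C\<close>. So \<open>phi\<close> approaches its supremum at 0, and the second difference is
  at most \<open>phi b - phi (b + r)\<close>.\<close>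

lemma midconvex_bounded_second_difference_small:
  fixes phi :: "real \<Rightarrow> real"
  assumes bd: "\<And>b. b > 0 \<Longrightarrow> 0 \<le> phi b \<and> phi b \<le> C"
    and cv: "\<And>b r. b > 0 \<Longrightarrow> r > 0 \<Longrightarrow> 0 \<le> phi (b + 2 * r) - 2 * phi (b + r) + phi b"
    and eta: "eta > 0"
  obtains d where "d > 0" "\<And>b r. b > 0 \<Longrightarrow> r > 0 \<Longrightarrow> b + r < d \<Longrightarrow> phi (b + 2 * r) - 2 * phi (b + r) + phi b \<le> eta"
proof -
  have dec: "phi (b + r) \<le> phi b" if b: "b > 0" and r: "r > 0" for b r
  proof (rule ccontr)
    define D where "D = phi (b + r) - phi b"
    assume "\<not> ?thesis"
    then have D: "D > 0" by (simp add: D_def)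
    have st: "D \<le> phi (b + real (Suc n) * r) - phi (b + real n * r)" for n
    proof (induction n)
      case (Suc n)
      have "b + real n * r > 0" using b r by (simp add: add_pos_nonneg)
      from cv[OF this r] Suc show ?case by (simp add: algebra_simps)
    qed (simp add: D_def)
    have "phi (b + real n * r) \<ge> phi b + real n * D" for n
    proof (induction n)
      case (Suc n)
      then show ?case using st[of n] by (simp add: algebra_simps)
    qed simp
    moreover obtain n where "real n * D > C" using D reals_Archimedean3 by blast
    moreover have "b + real n * r > 0" for n using b r by (simp add: add_pos_nonneg)
    ultimately show False using bd[OF b] bd[of "b + real n * r"] by (smt (verit))
  qed
  define L where "L = Sup (phi ` {0<..})"
  have bda: "bdd_above (phi ` {0<..})" using bd by (auto intro!: bdd_aboveI[of _ C])
  have le: "phi b \<le> L" if "b > 0" for b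
    unfolding L_def using bda that by (intro cSup_upper) auto
  have "\<exists>d\<in>{0<..}. L - eta < phi d"
    using less_cSup_iff[OF _ bda, of "L - eta"] eta unfolding L_def[symmetric] by auto
  then obtain d where d: "d > 0" "L - eta < phi d" by auto
  show ?thesis
  proof (rule that[OF d(1)])
    fix b r :: real assume br: "b > 0" "r > 0" "b + r < d"
    have "phi d \<le> phi (b + r)" using dec[of "b + r" "d - (b + r)"] br by simp
    moreover have "phi (b + 2 * r) \<le> phi (b + r)" using dec[of "b + r" r] br by (simp add: algebra_simps)
    ultimately show "phi (b + 2 * r) - 2 * phi (b + r) + phi b \<le> eta"
      using le[OF br(1)] d by linarith
  qed
qed

lemma H2_L2_Cauchy:
  assumes h: "h \<in> H2" and eta: "eta > 0"
  obtains d where "d > 0" "\<And>b b'. 0 < b \<Longrightarrow> b < b' \<Longrightarrow> b' < d \<Longrightarrow>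
     (LBINT x. (cmod (h (Complex x b') - h (Complex x b)))\<^sup>2) \<le> eta"
proof -
  define phi where "phi = (\<lambda>b. LBINT x. (cmod (h (Complex x b)))\<^sup>2)"
  obtain C where C: "C \<ge> 0" "\<And>y. y > 0 \<Longrightarrow> phi y \<le> C"
    using H2_line_bound[OF h] unfolding phi_def by blast
  have nn: "0 \<le> phi b" for b unfolding phi_def by (rule integral_nonneg_AE) simp
  have e: "phi (b + 2 * r) - 2 * phi (b + r) + phi b = (LBINT x. (cmod (h (Complex x (b + 2 * r)) - h (Complex x b)))\<^sup>2)"
    if "b > 0" "r > 0" for b r
    using H2_line_diff_norm[OF h that] by (simp add: phi_def)
  have cv: "0 \<le> phi (b + 2 * r) - 2 * phi (b + r) + phi b" if "b > 0" "r > 0" for b r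
    unfolding e[OF that] by (rule integral_nonneg_AE) simp
  obtain d where d: "d > 0" "\<And>b r. b > 0 \<Longrightarrow> r > 0 \<Longrightarrow> b + r < d \<Longrightarrow> phi (b + 2 * r) - 2 * phi (b + r) + phi b \<le> eta"
    using midconvex_bounded_second_difference_small[of phi C eta] C nn cv eta by metis
  show ?thesis
  proof (rule that[OF d(1)])
    fix b b' :: real assume "0 < b" "b < b'" "b' < d"
    then show "(LBINT x. (cmod (h (Complex x b') - h (Complex x b)))\<^sup>2) \<le> eta"
      using d(2)[of b "(b' - b) / 2"] e[of b "(b' - b) / 2"] by (simp add: field_simps)
  qed
qed

section \<open>Maximal bounds and vertical limits almost everywhere\<close>

lemma H2_weak_type_above_height:
  assumes h: "h \<in> H2" and b: "b > 0" and lam: "lam > 0"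
  obtains S where "S \<in> sets borel"
    "ennreal lam * emeasure lborel S \<le> 5 * ennreal (LBINT x. (cmod (h (Complex x b)))\<^sup>2)"
    "\<And>x y. x \<notin> S \<Longrightarrow> y > b \<Longrightarrow> (cmod (h (Complex x y)))\<^sup>2 \<le> 6 * lam"
proof -
  define v where "v = (\<lambda>t. ennreal ((cmod (h (Complex t b)))\<^sup>2))"
  have int: "integrable lborel (\<lambda>t. (cmod (h (Complex t b)))\<^sup>2)" by (rule H2_line_integrable[OF h b])
  have vint: "(\<integral>\<^sup>+t. v t \<partial>lborel) = ennreal (LBINT x. (cmod (h (Complex x b)))\<^sup>2)"
    unfolding v_def by (rule nn_integral_eq_integral[OF int]) simp
  have vm: "v \<in> borel_measurable borel"
    using borel_measurable_integrable[OF int] unfolding v_def by measurable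
  obtain S where S: "S \<in> sets borel" "ennreal lam * emeasure lborel S \<le> 5 * (\<integral>\<^sup>+t. v t \<partial>lborel)"
    "\<And>x y. x \<notin> S \<Longrightarrow> y > 0 \<Longrightarrow> (\<integral>\<^sup>+t. ennreal (y / ((t - x)\<^sup>2 + y\<^sup>2)) * v t \<partial>lborel) \<le> ennreal (16 * lam)"
    using poisson_weak_type[OF vm _ lam] vint by auto
  have "(cmod (h (Complex x y)))\<^sup>2 \<le> 6 * lam" if x: "x \<notin> S" and y: "y > b" for x y
  proof -
    define r where "r = y - b"
    have r: "r > 0" using y by (simp add: r_def)
    let ?q = "\<lambda>t. of_real (r / ((t - x)\<^sup>2 + r\<^sup>2)) * (h (Complex t b))\<^sup>2"
    have P0: "r / ((t - x)\<^sup>2 + r\<^sup>2) \<ge> 0" for t using r by (intro divide_nonneg_nonneg) auto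
    have n: "norm (?q t) = r / ((t - x)\<^sup>2 + r\<^sup>2) * (cmod (h (Complex t b)))\<^sup>2" for t
      using P0[of t] by (simp only: norm_mult norm_of_real norm_power abs_of_nonneg)
    have "ennreal (pi * (cmod (h (Complex x y)))\<^sup>2) = ennreal (norm (LBINT t. ?q t))"
      unfolding H2_poisson(3)[OF h b r] by (simp add: r_def norm_mult norm_power)
    also have "\<dots> \<le> (\<integral>\<^sup>+t. ennreal (norm (?q t)) \<partial>lborel)"
      by (rule integral_norm_bound_ennreal[OF H2_poisson(2)[OF h b r]])
    also have "\<dots> = (\<integral>\<^sup>+t. ennreal (r / ((t - x)\<^sup>2 + r\<^sup>2)) * v t \<partial>lborel)"
      unfolding n v_def using P0 by (simp only: ennreal_mult zero_le_power2)
    also have "\<dots> \<le> ennreal (16 * lam)" by (rule S(3)[OF x r])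
    finally have "pi * (cmod (h (Complex x y)))\<^sup>2 \<le> 16 * lam"
      using lam by (subst (asm) ennreal_le_iff) auto
    \<comment> \<open>Since \<open>pi > 3\<close>, \<open>16 / pi\<close> is less than 6; this is
      the origin of the 6 in the maximal bounds.\<close>
    moreover have "3 * (cmod (h (Complex x y)))\<^sup>2 \<le> pi * (cmod (h (Complex x y)))\<^sup>2"
      using pi_gt3 by (intro mult_right_mono) auto
    ultimately show ?thesis using lam by linarith
  qed
  then show ?thesis using that[OF S(1) S(2)[unfolded vint]] by blast
qed

text \<open>As the base height tends to 0 the exceptional sets \<open>U n\<close> increase, and each
  is open, being a union over \<open>y\<close> of open sets. Continuity of the measure from below
  carries the bound to all heights \<open>y > 0\<close>.\<close>

lemma H2_weak_type:
  assumes h: "h \<in> H2" and lam: "lam > 0" and d: "d > 0"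
    and eta: "\<And>b. 0 < b \<Longrightarrow> b < d \<Longrightarrow> (LBINT x. (cmod (h (Complex x b)))\<^sup>2) \<le> eta"
  obtains U where "U \<in> sets borel" "ennreal lam * emeasure lborel U \<le> 5 * ennreal eta"
    "\<And>x y. x \<notin> U \<Longrightarrow> y > 0 \<Longrightarrow> (cmod (h (Complex x y)))\<^sup>2 \<le> 6 * lam"
proof -
  \<comment> \<open>The offset 2 keeps every height strictly below \<open>d\<close>.\<close>
  define B where "B = (\<lambda>n. d / real (n + 2))"
  have B: "0 < B n" "B n < d" for n
    using d by (auto simp: B_def pos_divide_less_eq mult_less_cancel_left2)
  have Bdec: "B n \<le> B m" if "m \<le> n" for m n
    using that d unfolding B_def by (intro divide_left_mono) auto
  define U where "U = (\<lambda>n. {x. \<exists>y>B n. (cmod (h (Complex x y)))\<^sup>2 > 6 * lam})"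
  have op: "open (U n)" for n
  proof -
    have "U n = (\<Union>y\<in>{B n<..}. {x. (cmod (h (Complex x y)))\<^sup>2 > 6 * lam})" by (auto simp: U_def)
    moreover have "open {x. (cmod (h (Complex x y)))\<^sup>2 > 6 * lam}" if "y > B n" for y
      using that B[of n]
      by (intro open_Collect_less continuous_intros continuous_on_horizontal[OF H2_holomorphic[OF h]]) auto
    ultimately show ?thesis by auto
  qed
  have Um: "U n \<in> sets borel" for n using op by simp
  have inc: "incseq U"
    using Bdec unfolding incseq_def U_def by (auto intro: le_less_trans)
  have em: "ennreal lam * emeasure lborel (U n) \<le> 5 * ennreal eta" for n
  proof -
    obtain S where S: "S \<in> sets borel"
      "ennreal lam * emeasure lborel S \<le> 5 * ennreal (LBINT x. (cmod (h (Complex x (B n))))\<^sup>2)"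
      "\<And>x y. x \<notin> S \<Longrightarrow> y > B n \<Longrightarrow> (cmod (h (Complex x y)))\<^sup>2 \<le> 6 * lam"
      using H2_weak_type_above_height[OF h B(1)[of n] lam] by blast
    have "U n \<subseteq> S" using S(3) by (fastforce simp: U_def not_le[symmetric])
    then have "ennreal lam * emeasure lborel (U n) \<le> ennreal lam * emeasure lborel S"
      using S(1) by (intro mult_left_mono emeasure_mono) auto
    also note S(2)
    also have "5 * ennreal (LBINT x. (cmod (h (Complex x (B n))))\<^sup>2) \<le> 5 * ennreal eta"
      using eta[OF B] by (intro mult_left_mono ennreal_leI) auto
    finally show ?thesis .
  qed
  show ?thesis
  proof (rule that[of "\<Union>n. U n"])
    show "(\<Union>n. U n) \<in> sets borel" using Um by blast
    have "emeasure lborel (\<Union>n. U n) = (SUP n. emeasure lborel (U n))"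
      using Um inc by (subst SUP_emeasure_incseq) auto
    then have "ennreal lam * emeasure lborel (\<Union>n. U n) = (SUP n. ennreal lam * emeasure lborel (U n))"
      by (simp add: SUP_mult_left_ennreal)
    also have "\<dots> \<le> 5 * ennreal eta" by (rule SUP_least) (rule em)
    finally show "ennreal lam * emeasure lborel (\<Union>n. U n) \<le> 5 * ennreal eta" .
    fix x y :: real assume x: "x \<notin> (\<Union>n. U n)" and y: "y > 0"
    have "B \<longlonglongrightarrow> 0" unfolding B_def
      using LIMSEQ_ignore_initial_segment[OF lim_const_over_n[of d], of 2] by simp
    then have "\<forall>\<^sub>F n in sequentially. B n < y" using y by (rule order_tendstoD)
    then obtain n where "B n < y" by (auto simp: eventually_sequentially)
    moreover have "x \<notin> U n" using x by blast
    ultimately show "(cmod (h (Complex x y)))\<^sup>2 \<le> 6 * lam"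
      unfolding U_def using not_less by blast
  qed
qed

text \<open>The failure of the Cauchy criterion for vertical approach at the single scale
  \<open>e\<close>. Fixing the scale reduces convergence almost everywhere to countably many null
  sets, one for each \<open>e = 1 / (n + 1)\<close>.\<close>

definition oscillates :: "(complex \<Rightarrow> complex) \<Rightarrow> real \<Rightarrow> real \<Rightarrow> bool" where
  "oscillates h e x \<longleftrightarrow>
     \<not> (\<exists>d>0. \<forall>y y'. 0 < y \<longrightarrow> y < d \<longrightarrow> 0 < y' \<longrightarrow> y' < d \<longrightarrow> cmod (h (Complex x y) - h (Complex x y')) < e)"

text \<open>A vertical shift of \<open>h\<close> is continuous up to the real line and, by the L2 Cauchy property, close
  to \<open>h\<close> in the vertical maximal function off a set of small measure.\<close>

lemma H2_AE_not_oscillates: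
  assumes h: "h \<in> H2" and e: "e > 0"
  shows "AE x in lborel. \<not> oscillates h e x"
proof -
  \<comment> \<open>Chosen so that \<open>6 * lam = (e / 4)^2\<close>: the final estimate has four
    terms, each bounded by \<open>e / 4\<close>.\<close>
  define lam where "lam = e\<^sup>2 / 96"
  have lam: "lam > 0" using e by (simp add: lam_def)
  have ex: "\<exists>U. U \<in> sets borel \<and> ennreal lam * emeasure lborel U \<le> 5 * ennreal (inverse (real (Suc n)))
      \<and> {x. oscillates h e x} \<subseteq> U" for n
  proof -
    define eta where "eta = inverse (real (Suc n))"
    obtain d where d: "d > 0" "\<And>b b'. 0 < b \<Longrightarrow> b < b' \<Longrightarrow> b' < d \<Longrightarrow>
     (LBINT x. (cmod (h (Complex x b') - h (Complex x b)))\<^sup>2) \<le> eta"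
      using H2_L2_Cauchy[OF h, of eta] by (auto simp: eta_def)
    \<comment> \<open>For \<open>b < s\<close> both \<open>b\<close> and \<open>b + s\<close> stay
      below \<open>d\<close>, so the squared line norms of the difference \<open>D\<close> are at
      most \<open>eta\<close>.\<close>
    define s where "s = d / 2"
    define D where "D = (\<lambda>z. h (z + \<i> * of_real s) - h z)"
    have s: "s > 0" using d by (simp add: s_def)
    have DH: "D \<in> H2" unfolding D_def using s by (intro H2_shift_diff h) simp
    have De: "D (Complex x y) = h (Complex x (y + s)) - h (Complex x y)" for x y
    proof -
      have "Complex x y + \<i> * of_real s = Complex x (y + s)" by (simp add: complex_eq_iff)
      then show ?thesis by (simp add: D_def)
    qed
    have "(LBINT x. (cmod (D (Complex x b)))\<^sup>2) \<le> eta" if "0 < b" "b < s" for b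
      unfolding De using s that by (intro d) (auto simp: s_def)
    then obtain U where U: "U \<in> sets borel" "ennreal lam * emeasure lborel U \<le> 5 * ennreal eta"
      "\<And>x y. x \<notin> U \<Longrightarrow> y > 0 \<Longrightarrow> (cmod (D (Complex x y)))\<^sup>2 \<le> 6 * lam"
      using H2_weak_type[OF DH lam s] by blast
    have "\<not> oscillates h e x" if x: "x \<notin> U" for x
    proof -
      have "isCont (\<lambda>y. h (Complex x y)) s"
      proof -
        have "isCont h (Complex x s)"
          using holomorphic_on_imp_continuous_on[OF H2_holomorphic[OF h]] s open_halfspace_Im_gt[of 0]
          by (auto simp: UHP_def continuous_on_eq_continuous_at)
        moreover have "isCont (\<lambda>y. Complex x y) s"
          unfolding Complex_eq by (intro continuous_intros)
        ultimately show ?thesis using isCont_o2 by blast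
      qed
      then obtain t where t: "t > 0" "\<And>y. \<bar>y - s\<bar> < t \<Longrightarrow> cmod (h (Complex x y) - h (Complex x s)) < e / 4"
        using e unfolding continuous_at_eps_delta dist_norm by (metis real_norm_def zero_less_divide_iff zero_less_numeral)
      have Db: "cmod (D (Complex x y)) \<le> e / 4" if "y > 0" for y
      proof (rule power2_le_imp_le)
        show "(cmod (D (Complex x y)))\<^sup>2 \<le> (e / 4)\<^sup>2"
          using U(3)[OF x that] by (simp add: lam_def power_divide)
      qed (use e in simp)
      have "cmod (h (Complex x y) - h (Complex x y')) < e" if y: "0 < y" "y < t" and y': "0 < y'" "y' < t" for y y'
      proof -
        have "h (Complex x y) - h (Complex x y') = (h (Complex x (y + s)) - h (Complex x s)) - (h (Complex x (y' + s)) - h (Complex x s))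
            - D (Complex x y) + D (Complex x y')" by (simp add: De)
        also have "cmod \<dots> \<le> cmod (h (Complex x (y + s)) - h (Complex x s)) + cmod (h (Complex x (y' + s)) - h (Complex x s))
            + cmod (D (Complex x y)) + cmod (D (Complex x y'))"
          by (intro norm_triangle_le norm_triangle_le_diff add_mono order_refl norm_triangle_ineq4)
        also have "\<dots> < e" using t(2)[of "y + s"] t(2)[of "y' + s"] Db[OF y(1)] Db[OF y'(1)] y y' by simp
        finally show ?thesis .
      qed
      then show ?thesis using t(1) unfolding oscillates_def by blast
    qed
    then show ?thesis using U unfolding eta_def by blast
  qed
  then obtain U where U: "\<And>n. U n \<in> sets borel" 
    "\<And>n. ennreal lam * emeasure lborel (U n) \<le> 5 * ennreal (inverse (real (Suc n)))"
    "\<And>n. {x. oscillates h e x} \<subseteq> U n" by metis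
  have "emeasure lborel (\<Inter>n. U n) = 0"
  proof -
    have le: "ennreal lam * emeasure lborel (\<Inter>n. U n) \<le> ennreal (5 * inverse (real (Suc n)))" for n
    proof -
      have "ennreal lam * emeasure lborel (\<Inter>n. U n) \<le> ennreal lam * emeasure lborel (U n)"
        using U(1) by (intro mult_left_mono emeasure_mono) auto
      also note U(2)[of n]
      finally show ?thesis by (simp add: ennreal_mult')
    qed
    have "(\<lambda>n. ennreal (5 * inverse (real (Suc n)))) \<longlonglongrightarrow> ennreal (5 * 0)"
      by (intro tendsto_ennrealI tendsto_mult tendsto_const LIMSEQ_inverse_real_of_nat)
    then have "ennreal lam * emeasure lborel (\<Inter>n. U n) \<le> ennreal (5 * 0)"
      by (rule LIMSEQ_le_const) (use le in blast)
    then show ?thesis using lam by simp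
  qed
  then have "(\<Inter>n. U n) \<in> null_sets lborel" using U(1) by (intro null_setsI) auto
  then show ?thesis by (rule AE_I') (use U(3) in auto)
qed

text \<open>\<open>bv\<close> is a \<open>Lim\<close> and carries no information where the limit
  fails to exist. Those points form a null set, because almost everywhere the Cauchy criterion holds
  at all scales \<open>1 / (n + 1)\<close>.\<close>

lemma H2_vertical_limit:
  assumes h: "h \<in> H2"
  shows "AE x in lborel. ((\<lambda>y. h (Complex x y)) \<longlongrightarrow> bv h x) (at_right 0)"
proof -
  have "AE x in lborel. \<forall>n. \<not> oscillates h (inverse (real (Suc n))) x"
    unfolding AE_all_countable by (intro allI H2_AE_not_oscillates[OF h]) simp
  then show ?thesis
  proof eventually_elim
    case (elim x)
    define g where "g = (\<lambda>y. h (Complex x y))"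
    have C: "\<exists>d>0. \<forall>y y'. 0 < y \<longrightarrow> y < d \<longrightarrow> 0 < y' \<longrightarrow> y' < d \<longrightarrow> cmod (g y - g y') < e" if e: "e > 0" for e
    proof -
      obtain n where n: "inverse (real (Suc n)) < e" using reals_Archimedean[OF e] by auto
      obtain d where "d > 0" "\<And>y y'. 0 < y \<Longrightarrow> y < d \<Longrightarrow> 0 < y' \<Longrightarrow> y' < d \<Longrightarrow> cmod (g y - g y') < inverse (real (Suc n))"
        using elim[rule_format, of n] unfolding oscillates_def g_def by auto
      then show ?thesis using n by (meson less_trans)
    qed
    have B0: "(\<lambda>n. inverse (real (Suc n))) \<longlonglongrightarrow> 0" by (rule LIMSEQ_inverse_real_of_nat)
    have "Cauchy (\<lambda>n. g (inverse (real (Suc n))))"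
    proof (rule metric_CauchyI)
      fix e :: real assume "e > 0"
      then obtain d where d: "d > 0" "\<And>y y'. 0 < y \<Longrightarrow> y < d \<Longrightarrow> 0 < y' \<Longrightarrow> y' < d \<Longrightarrow> cmod (g y - g y') < e"
        using C by meson
      have "\<forall>\<^sub>F n in sequentially. inverse (real (Suc n)) < d" using B0 d(1) by (rule order_tendstoD)
      then obtain N where "\<And>n. n \<ge> N \<Longrightarrow> inverse (real (Suc n)) < d" by (auto simp: eventually_sequentially)
      then show "\<exists>M. \<forall>m\<ge>M. \<forall>n\<ge>M. dist (g (inverse (real (Suc m)))) (g (inverse (real (Suc n)))) < e"
        using d(2) unfolding dist_norm by (intro exI[of _ N]) simp
    qed
    then obtain L where L: "(\<lambda>n. g (inverse (real (Suc n)))) \<longlonglongrightarrow> L"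
      using Cauchy_convergent_iff convergent_def by blast
    have "(g \<longlongrightarrow> L) (at_right 0)"
    proof (rule tendstoI)
      fix e :: real assume e: "e > 0"
      then obtain d where d: "d > 0" "\<And>y y'. 0 < y \<Longrightarrow> y < d \<Longrightarrow> 0 < y' \<Longrightarrow> y' < d \<Longrightarrow> cmod (g y - g y') < e / 2"
        using C[of "e/2"] by auto
      have "\<forall>\<^sub>F n in sequentially. inverse (real (Suc n)) < d" using B0 d(1) by (rule order_tendstoD)
      moreover have "\<forall>\<^sub>F n in sequentially. dist (g (inverse (real (Suc n)))) L < e / 2"
        using L e by (intro tendstoD) auto
      ultimately have "\<forall>\<^sub>F n in sequentially. inverse (real (Suc n)) < d \<and> dist (g (inverse (real (Suc n)))) L < e / 2"
        by eventually_elim simp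
      then obtain n where n: "inverse (real (Suc n)) < d" "dist (g (inverse (real (Suc n)))) L < e / 2"
        by (auto simp: eventually_sequentially)
      have "dist (g y) L < e" if "0 < y" "y < d" for y
      proof -
        have "dist (g y) (g (inverse (real (Suc n)))) < e / 2" unfolding dist_norm using that n by (intro d(2)) auto
        then show ?thesis using n(2) dist_triangle[of "g y" L "g (inverse (real (Suc n)))"] by linarith
      qed
      then show "\<forall>\<^sub>F y in at_right 0. dist (g y) L < e"
        using d(1) by (intro eventually_at_rightI[of 0 d]) auto
    qed
    moreover from this have "bv h x = L"
      unfolding bv_def g_def by (intro tendsto_Lim) auto
    ultimately show ?case by (simp add: g_def)
  qed
qed

text \<open>\<open>bv\<close> is a limit over a continuum of heights. Passing to the heights
  \<open>1 / (n + 1)\<close> gives a sequence of continuous functions, whose \<open>lim\<close> is a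
  Borel representative that integration can work with.\<close>

lemma bv_AE_eq_LIMSEQ:
  assumes h: "h \<in> H2"
  obtains b where "b \<in> borel_measurable borel" "AE x in lborel. bv h x = b x"
    "AE x in lborel. (\<lambda>n. h (Complex x (inverse (real (Suc n))))) \<longlonglongrightarrow> b x"
proof -
  let ?a = "\<lambda>n x. h (Complex x (inverse (real (Suc n))))"
  define b where "b = (\<lambda>x. lim (\<lambda>n. ?a n x))"
  have [measurable]: "?a n \<in> borel_measurable borel" for n
    using measurable_horizontal[OF H2_holomorphic[OF h], of "inverse (real (Suc n))"] by simp
  have bm: "b \<in> borel_measurable borel" unfolding b_def by measurable
  have *: "AE x in lborel. (\<lambda>n. ?a n x) \<longlonglongrightarrow> bv h x"
    using H2_vertical_limit[OF h]
  proof eventually_elim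
    case (elim x)
    have "filterlim (\<lambda>n. inverse (real (Suc n))) (at_right 0) sequentially"
      unfolding filterlim_at by (auto intro!: LIMSEQ_inverse_real_of_nat always_eventually simp del: of_nat_Suc)
    from filterlim_compose[OF elim this] show ?case .
  qed
  then have eq: "AE x in lborel. bv h x = b x"
    by eventually_elim (simp add: b_def limI)
  with * have "AE x in lborel. (\<lambda>n. ?a n x) \<longlonglongrightarrow> b x"
    by eventually_elim simp
  then show ?thesis using that bm eq by blast
qed

text \<open>Fatou's lemma along the heights \<open>1 / (n + 1)\<close>: the Cauchy bound between two
  lines survives as the lower one sinks to the boundary.\<close>

lemma H2_boundary_L2:
  assumes h: "h \<in> H2" and bm: "b \<in> borel_measurable borel"
    and lim: "AE x in lborel. (\<lambda>n. h (Complex x (inverse (real (Suc n))))) \<longlonglongrightarrow> b x"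
    and eta: "eta > 0"
  obtains d where "d > 0" "\<And>y. 0 < y \<Longrightarrow> y < d \<Longrightarrow>
      (\<integral>\<^sup>+x. ennreal ((cmod (b x - h (Complex x y)))\<^sup>2) \<partial>lborel) \<le> ennreal eta"
proof -
  let ?e = "\<lambda>n. inverse (real (Suc n))"
  obtain d where d: "d > 0" "\<And>b b'. 0 < b \<Longrightarrow> b < b' \<Longrightarrow> b' < d \<Longrightarrow>
     (LBINT x. (cmod (h (Complex x b') - h (Complex x b)))\<^sup>2) \<le> eta"
    using H2_L2_Cauchy[OF h eta] by blast
  have hol: "h holomorphic_on UHP" using H2_holomorphic[OF h] .
  have "(\<integral>\<^sup>+x. ennreal ((cmod (b x - h (Complex x y)))\<^sup>2) \<partial>lborel) \<le> ennreal eta" if y: "0 < y" "y < d" for y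
  proof -
    note [measurable] = bm measurable_horizontal[OF hol y(1)]
    have [measurable]: "(\<lambda>x. h (Complex x (?e n))) \<in> borel_measurable borel" for n
      using measurable_horizontal[OF hol, of "?e n"] by simp
    let ?u = "\<lambda>n x. ennreal ((cmod (h (Complex x (?e n)) - h (Complex x y)))\<^sup>2)"
    have "(\<integral>\<^sup>+x. ennreal ((cmod (b x - h (Complex x y)))\<^sup>2) \<partial>lborel) = (\<integral>\<^sup>+x. liminf (\<lambda>n. ?u n x) \<partial>lborel)"
    proof (rule nn_integral_cong_AE, use lim in eventually_elim)
      case (elim x)
      have "(\<lambda>n. ?u n x) \<longlonglongrightarrow> ennreal ((cmod (b x - h (Complex x y)))\<^sup>2)"
        by (intro tendsto_intros elim)
      from lim_imp_Liminf[OF trivial_limit_sequentially this] show ?case by (rule sym)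
    qed
    also have "\<dots> \<le> liminf (\<lambda>n. \<integral>\<^sup>+x. ?u n x \<partial>lborel)"
      by (rule nn_integral_liminf) measurable
    also have "\<dots> \<le> ennreal eta"
    proof (rule Liminf_le)
      have "\<forall>\<^sub>F n in sequentially. ?e n < y" using LIMSEQ_inverse_real_of_nat y(1) by (rule order_tendstoD)
      then show "\<forall>\<^sub>F n in sequentially. (\<integral>\<^sup>+x. ?u n x \<partial>lborel) \<le> ennreal eta"
      proof eventually_elim
        case (elim n)
        have e: "Complex x s + \<i> * of_real (y - s) = Complex x y" for x s by (simp add: complex_eq_iff)
        have "integrable lborel (\<lambda>x. (cmod (h (Complex x y) - h (Complex x (?e n))))\<^sup>2)"
          using H2_line_integrable[OF H2_shift_diff[OF h, of "y - ?e n"], of "?e n"] elim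
          unfolding e by simp
        then have "(\<integral>\<^sup>+x. ?u n x \<partial>lborel) = ennreal (LBINT x. (cmod (h (Complex x y) - h (Complex x (?e n))))\<^sup>2)"
          unfolding norm_minus_commute[of "h (Complex _ (?e n))"]
          by (intro nn_integral_eq_integral) auto
        also have "\<dots> \<le> ennreal eta" using elim y by (intro ennreal_leI d) auto
        finally show ?case .
      qed
    qed auto
    finally show ?thesis .
  qed
  then show ?thesis using that d(1) by blast
qed

section \<open>The Cauchy formula for boundary values\<close>

lemma norm_square_le_diff_plus:
  fixes a c :: complex
  shows "(cmod a)\<^sup>2 \<le> 2 * (cmod (a - c))\<^sup>2 + 2 * (cmod c)\<^sup>2"
proof -
  have "(cmod a)\<^sup>2 \<le> (cmod (a - c) + cmod c)\<^sup>2"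
    using norm_triangle_ineq[of "a - c" c] by (intro power_mono) auto
  also have "\<dots> \<le> 2 * (cmod (a - c))\<^sup>2 + 2 * (cmod c)\<^sup>2"
    using sum_squares_bound[of "cmod (a - c)" "cmod c"] by (simp add: power2_sum)
  finally show ?thesis .
qed

lemma L2_mult_integrable:
  fixes u v :: "real \<Rightarrow> complex"
  assumes [measurable]: "u \<in> borel_measurable borel" "v \<in> borel_measurable borel"
    and "integrable lborel (\<lambda>x. (cmod (u x))\<^sup>2)" "integrable lborel (\<lambda>x. (cmod (v x))\<^sup>2)"
  shows "integrable lborel (\<lambda>x. u x * v x)"
proof (rule Bochner_Integration.integrable_bound)
  show "integrable lborel (\<lambda>x. (cmod (u x))\<^sup>2 + (cmod (v x))\<^sup>2)" using assms by simp
  have "cmod (u x) * cmod (v x) \<le> (cmod (u x))\<^sup>2 + (cmod (v x))\<^sup>2" for x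
    using sum_squares_bound[of "cmod (u x)" "cmod (v x)"] mult_nonneg_nonneg[OF norm_ge_zero[of "u x"] norm_ge_zero[of "v x"]]
    by linarith
  then show "AE x in lborel. norm (u x * v x) \<le> norm ((cmod (u x))\<^sup>2 + (cmod (v x))\<^sup>2)"
    by (simp add: norm_mult)
qed measurable

text \<open>A weighted substitute for Cauchy-Schwarz. A large \<open>s\<close> makes the term of the
  fixed kernel \<open>v\<close> small, after which \<open>u\<close> can be made small enough by
  approximation.\<close>

lemma L2_mult_integral_bound:
  fixes u v :: "real \<Rightarrow> complex"
  assumes [measurable]: "u \<in> borel_measurable borel" "v \<in> borel_measurable borel"
    and iu: "integrable lborel (\<lambda>x. (cmod (u x))\<^sup>2)" and iv: "integrable lborel (\<lambda>x. (cmod (v x))\<^sup>2)"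
    and s: "s > 0"
  shows "cmod (LBINT x. u x * v x) \<le> s * (LBINT x. (cmod (u x))\<^sup>2) + (LBINT x. (cmod (v x))\<^sup>2) / s"
proof -
  have "cmod (LBINT x. u x * v x) \<le> (LBINT x. cmod (u x * v x))" by (rule integral_norm_bound)
  also have "\<dots> \<le> (LBINT x. s * (cmod (u x))\<^sup>2 + (cmod (v x))\<^sup>2 / s)"
  proof (rule integral_mono)
    show "integrable lborel (\<lambda>x. cmod (u x * v x))"
      by (intro integrable_norm L2_mult_integrable assms)
    show "integrable lborel (\<lambda>x. s * (cmod (u x))\<^sup>2 + (cmod (v x))\<^sup>2 / s)"
      using iu iv by (intro Bochner_Integration.integrable_add integrable_mult_right integrable_divide_zero) auto
    fix x
    have "2 * (s * cmod (u x)) * cmod (v x) \<le> (s * cmod (u x))\<^sup>2 + (cmod (v x))\<^sup>2" by (rule sum_squares_bound)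
    moreover have "0 \<le> s * (cmod (u x) * cmod (v x))" using s by simp
    ultimately have "s * (cmod (u x) * cmod (v x)) \<le> s * s * (cmod (u x))\<^sup>2 + (cmod (v x))\<^sup>2"
      by (simp only: power_mult_distrib power2_eq_square[of s] mult.assoc)
    then have "s * (cmod (u x) * cmod (v x)) \<le> s * (s * (cmod (u x))\<^sup>2 + (cmod (v x))\<^sup>2 / s)"
      using s by (simp add: distrib_left)
    then show "cmod (u x * v x) \<le> s * (cmod (u x))\<^sup>2 + (cmod (v x))\<^sup>2 / s"
      using s by (simp only: norm_mult mult_le_cancel_left_pos)
  qed
  also have "\<dots> = s * (LBINT x. (cmod (u x))\<^sup>2) + (LBINT x. (cmod (v x))\<^sup>2) / s"
    using iu iv by (subst Bochner_Integration.integral_add) auto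
  finally show ?thesis .
qed

text \<open>Above a positive height \<open>h\<close> is known to be bounded, whereas
  \<open>halfplane_cauchy\<close> wants decay; so the formula is stated for
  \<open>h z / (z + \<i>)\<close>. The resulting kernel is square integrable, and convergence of the
  lines in the mean square carries the formula to the boundary.\<close>

theorem H2_boundary_reproducing:
  assumes h: "h \<in> H2"
  obtains b where "b \<in> borel_measurable borel" "AE x in lborel. bv h x = b x"
    "integrable lborel (\<lambda>x. (cmod (b x))\<^sup>2)"
    "\<And>w. Im w > 0 \<Longrightarrow> integrable lborel (\<lambda>t. b t / ((of_real t + \<i>) * (of_real t - w)))"
    "\<And>w. Im w > 0 \<Longrightarrow> (LBINT t. b t / ((of_real t + \<i>) * (of_real t - w))) = 2 * pi * \<i> * h w / (w + \<i>)"
proof -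
  obtain b where b: "b \<in> borel_measurable borel" "AE x in lborel. bv h x = b x"
    "AE x in lborel. (\<lambda>n. h (Complex x (inverse (real (Suc n))))) \<longlonglongrightarrow> b x"
    using bv_AE_eq_LIMSEQ[OF h] by blast
  note [measurable] = b(1)
  have hol: "h holomorphic_on UHP" using H2_holomorphic[OF h] .
  have near: "\<exists>d>0. \<forall>y. 0 < y \<longrightarrow> y < d \<longrightarrow> integrable lborel (\<lambda>x. (cmod (b x - h (Complex x y)))\<^sup>2) \<and>
      (LBINT x. (cmod (b x - h (Complex x y)))\<^sup>2) \<le> eta" if eta: "eta > 0" for eta
  proof -
    obtain d where d: "d > 0" "\<And>y. 0 < y \<Longrightarrow> y < d \<Longrightarrow>
      (\<integral>\<^sup>+x. ennreal ((cmod (b x - h (Complex x y)))\<^sup>2) \<partial>lborel) \<le> ennreal eta"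
      using H2_boundary_L2[OF h b(1,3) eta] by blast
    have "integrable lborel (\<lambda>x. (cmod (b x - h (Complex x y)))\<^sup>2) \<and>
      (LBINT x. (cmod (b x - h (Complex x y)))\<^sup>2) \<le> eta" if y: "0 < y" "y < d" for y
    proof -
      note [measurable] = measurable_horizontal[OF hol y(1)]
      have i: "integrable lborel (\<lambda>x. (cmod (b x - h (Complex x y)))\<^sup>2)"
        by (rule integrableI_bounded) (use le_less_trans[OF d(2)[OF y], of \<infinity>] in \<open>auto\<close>)
      have "ennreal (LBINT x. (cmod (b x - h (Complex x y)))\<^sup>2) \<le> ennreal eta"
        using nn_integral_eq_integral[OF i] d(2)[OF y] by simp
      then show ?thesis using i eta by (auto simp: ennreal_le_iff)
    qed
    then show ?thesis using d(1) by blast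
  qed
  have bi: "integrable lborel (\<lambda>x. (cmod (b x))\<^sup>2)"
  proof -
    obtain d where d: "d > 0" "\<And>y. 0 < y \<Longrightarrow> y < d \<Longrightarrow> integrable lborel (\<lambda>x. (cmod (b x - h (Complex x y)))\<^sup>2)"
      using near[of 1] by auto
    show ?thesis
    proof (rule Bochner_Integration.integrable_bound)
      show "integrable lborel (\<lambda>x. 2 * (cmod (b x - h (Complex x (d/2))))\<^sup>2 + 2 * (cmod (h (Complex x (d/2))))\<^sup>2)"
        using d by (intro Bochner_Integration.integrable_add integrable_mult_right d H2_line_integrable[OF h]) auto
    qed (use norm_square_le_diff_plus in auto)
  qed
  have "integrable lborel (\<lambda>t. b t / ((of_real t + \<i>) * (of_real t - w))) \<and>
    (LBINT t. b t / ((of_real t + \<i>) * (of_real t - w))) = 2 * pi * \<i> * h w / (w + \<i>)" if w: "Im w > 0" for w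
  proof -
    define kap where "kap = (\<lambda>t. 1 / ((complex_of_real t + \<i>) * (of_real t - w)))"
    have nz: "complex_of_real t + \<i> \<noteq> 0" "complex_of_real t - w \<noteq> 0" for t
      using w by (auto simp: complex_eq_iff)
    have kc: "continuous_on UNIV kap" unfolding kap_def using nz by (intro continuous_intros) auto
    have km [measurable]: "kap \<in> borel_measurable borel" by (rule borel_measurable_continuous_onI[OF kc])
    have ki: "integrable lborel (\<lambda>t. (cmod (kap t))\<^sup>2)"
    proof (rule integrable_dominated_inverse_square[of _ "1 / (Im w)\<^sup>2"])
      fix t :: real
      have "cmod (of_real t - w) \<ge> Im w" using abs_Im_le_cmod[of "of_real t - w"] w by simp
      then have 1: "(cmod (of_real t - w))\<^sup>2 \<ge> (Im w)\<^sup>2" using w by (intro power_mono) auto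
      have 2: "(cmod (of_real t + \<i>))\<^sup>2 = 1 + t\<^sup>2" by (simp add: cmod_power2)
      have "norm ((cmod (kap t))\<^sup>2) = 1 / ((1 + t\<^sup>2) * (cmod (of_real t - w))\<^sup>2)"
        unfolding kap_def by (simp add: norm_divide norm_mult power_divide power_mult_distrib 2)
      also have "\<dots> \<le> 1 / ((1 + t\<^sup>2) * (Im w)\<^sup>2)"
        using 1 w by (intro divide_left_mono mult_left_mono) (auto intro!: mult_pos_pos add_pos_nonneg simp: nz)
      finally show "norm ((cmod (kap t))\<^sup>2) \<le> 1 / (Im w)\<^sup>2 / (1 + t\<^sup>2)" by (simp add: mult.commute)
    qed measurable
    let ?e = "\<lambda>n. inverse (real (Suc n))"
    have en: "(LBINT t. h (Complex t y) * kap t) = 2 * pi * \<i> * h (w + \<i> * of_real y) / (w + \<i>)" if y: "y > 0" for y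
    proof -
      obtain M where M: "\<And>w. Im w \<ge> y \<Longrightarrow> cmod (h w) \<le> M"
        using H2_bounded_above_height[OF h y] by blast
      define g where "g = (\<lambda>z. h (z + \<i> * of_real y) / (z + \<i>))"
      have M0: "M \<ge> 0" using M[of "Complex 0 y"] by (simp add: order_trans[OF norm_ge_zero])
      have hg: "g holomorphic_on {z. Im z > - min y 1}"
        unfolding g_def
        by (intro holomorphic_intros holomorphic_on_compose_gen[OF _ hol, unfolded o_def])
           (auto simp: UHP_def complex_eq_iff)
      have bg: "cmod (g z) \<le> (3 * M) / (1 + cmod z)" if z: "Im z \<ge> 0" for z
      proof -
        have "cmod (z + \<i>) \<ge> 1" using abs_Im_le_cmod[of "z + \<i>"] z by simp
        moreover have "cmod (z + \<i>) \<ge> cmod z - 1" using norm_diff_ineq[of z \<i>] by simp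
        ultimately have "1 + cmod z \<le> 3 * cmod (z + \<i>)" by linarith
        moreover have "cmod (h (z + \<i> * of_real y)) \<le> M" using M z by simp
        ultimately have "cmod (g z) \<le> M / ((1 + cmod z) / 3)"
          unfolding g_def norm_divide using M0 by (intro frac_le) (auto intro: add_pos_nonneg)
        then show ?thesis by (simp add: mult.commute)
      qed
      have m: "min y 1 > 0" using y by simp
      have "h (Complex t y) * kap t = g (of_real t) / (of_real t - w)" for t
      proof -
        have "of_real t + \<i> * of_real y = Complex t y" by (simp add: complex_eq_iff)
        then show ?thesis by (simp add: g_def kap_def)
      qed
      then show ?thesis using halfplane_cauchy(2)[OF hg m bg w] by (simp add: g_def)
    qed
    have "(\<lambda>n. LBINT t. h (Complex t (?e n)) * kap t) \<longlonglongrightarrow> (LBINT t. b t * kap t)"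
    proof (rule LIMSEQ_I)
      fix e :: real assume e: "e > 0"
      define K where "K = (LBINT x. (cmod (kap x))\<^sup>2)"
      have K: "K \<ge> 0" unfolding K_def by (rule integral_nonneg_AE) simp
      \<comment> \<open>This makes \<open>K / s\<close> at most \<open>e / 4\<close>;
        \<open>K + 1\<close> keeps \<open>s\<close> positive when \<open>K = 0\<close>.\<close>
      define s where "s = 4 * (K + 1) / e"
      have s: "s > 0" using K e by (simp add: s_def)
      obtain d where d: "d > 0" "\<And>y. 0 < y \<Longrightarrow> y < d \<Longrightarrow> integrable lborel (\<lambda>x. (cmod (b x - h (Complex x y)))\<^sup>2) \<and>
        (LBINT x. (cmod (b x - h (Complex x y)))\<^sup>2) \<le> e / (4 * s)"
        using near[of "e / (4 * s)"] e s by auto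
      have "\<forall>\<^sub>F n in sequentially. ?e n < d" using LIMSEQ_inverse_real_of_nat d(1) by (rule order_tendstoD)
      then obtain N where N: "\<And>n. n \<ge> N \<Longrightarrow> ?e n < d" by (auto simp: eventually_sequentially)
      have "norm ((LBINT t. h (Complex t (?e n)) * kap t) - (LBINT t. b t * kap t)) < e" if n: "n \<ge> N" for n
      proof -
        have y: "0 < ?e n" by simp
        note [measurable] = measurable_horizontal[OF hol y]
        note dn = d(2)[OF y N[OF n]]
        have "(LBINT t. h (Complex t (?e n)) * kap t) - (LBINT t. b t * kap t) = - (LBINT t. (b t - h (Complex t (?e n))) * kap t)"
          using L2_mult_integrable[OF measurable_horizontal[OF hol y] km H2_line_integrable[OF h y] ki]
            L2_mult_integrable[OF b(1) km bi ki]
          by (simp add: left_diff_distrib del: of_nat_Suc)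
        then have "norm ((LBINT t. h (Complex t (?e n)) * kap t) - (LBINT t. b t * kap t)) =
           cmod (LBINT t. (b t - h (Complex t (?e n))) * kap t)" by (simp only: norm_minus_cancel)
        also have "\<dots> \<le> s * (LBINT x. (cmod (b x - h (Complex x (?e n))))\<^sup>2) + K / s"
          unfolding K_def
        proof (rule L2_mult_integral_bound[OF _ km _ ki s])
          show "(\<lambda>x. b x - h (Complex x (?e n))) \<in> borel_measurable borel" by measurable
        qed (use dn in blast)
        also have "\<dots> \<le> s * (e / (4 * s)) + K / s" using dn s by (intro add_right_mono mult_left_mono) auto
        also have "s * (e / (4 * s)) = e / 4" using s by simp
        also have "K / s \<le> e / 4" using K e by (simp add: s_def field_simps)
        also have "e / 4 + e / 4 < e" using e by simp
        finally show ?thesis by simp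
      qed
      then show "\<exists>N. \<forall>n\<ge>N. norm ((LBINT t. h (Complex t (?e n)) * kap t) - (LBINT t. b t * kap t)) < e" by blast
    qed
    moreover have "(\<lambda>n. LBINT t. h (Complex t (?e n)) * kap t) \<longlonglongrightarrow> 2 * pi * \<i> * h w / (w + \<i>)"
    proof -
      have "isCont h w"
        using holomorphic_on_imp_continuous_on[OF hol] w open_halfspace_Im_gt[of 0]
        by (auto simp: UHP_def continuous_on_eq_continuous_at)
      moreover have "(\<lambda>n. w + \<i> * of_real (?e n)) \<longlonglongrightarrow> w + \<i> * of_real 0"
        by (intro tendsto_intros LIMSEQ_inverse_real_of_nat)
      ultimately have "(\<lambda>n. h (w + \<i> * of_real (?e n))) \<longlonglongrightarrow> h w"
        using isCont_tendsto_compose[of w h] by simp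
      moreover have "w + \<i> \<noteq> 0" using w by (auto simp: complex_eq_iff)
      moreover have "(LBINT t. h (Complex t (?e n)) * kap t) = 2 * pi * \<i> * h (w + \<i> * of_real (?e n)) / (w + \<i>)" for n
        by (rule en) simp
      ultimately show ?thesis by (simp only:) (intro tendsto_intros)
    qed
    ultimately have "(LBINT t. b t * kap t) = 2 * pi * \<i> * h w / (w + \<i>)" by (rule LIMSEQ_unique)
    then show ?thesis using L2_mult_integrable[OF b(1) km bi ki] by (simp add: kap_def)
  qed
  then show ?thesis using that b bi by blast
qed

section \<open>Blaschke products\<close>

text \<open>The majorant may depend on the radius \<open>R\<close> and may start late: the factors
  of both products approach 1 at a rate that worsens with \<open>cmod z\<close>.\<close>

lemma
  fixes F :: "nat \<Rightarrow> complex \<Rightarrow> complex"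
  assumes S: "open S" and hol: "\<And>n. F n holomorphic_on S"
    and bd: "\<And>R. \<exists>M. summable M \<and> (\<forall>\<^sub>F n in sequentially. \<forall>z\<in>S. cmod z \<le> R \<longrightarrow> cmod (F n z - 1) \<le> M n)"
  shows convergent_prod_locally_bounded: "\<And>z. z \<in> S \<Longrightarrow> convergent_prod (\<lambda>n. F n z)"
    and holomorphic_on_prodinf: "(\<lambda>z. \<Prod>n. F n z) holomorphic_on S"
proof -
  show conv: "convergent_prod (\<lambda>n. F n z)" if z: "z \<in> S" for z
  proof -
    obtain M where M: "summable M" "\<forall>\<^sub>F n in sequentially. \<forall>w\<in>S. cmod w \<le> cmod z \<longrightarrow> cmod (F n w - 1) \<le> M n"
      using bd[of "cmod z"] by blast
    have "summable (\<lambda>n. norm (F n z - 1))"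
    proof (rule summable_comparison_test_ev[OF _ M(1)])
      show "\<forall>\<^sub>F n in sequentially. norm (norm (F n z - 1)) \<le> M n"
        using M(2) by eventually_elim (use z in auto)
    qed
    then show ?thesis
      by (intro abs_convergent_prod_imp_convergent_prod summable_imp_abs_convergent_prod)
  qed
  show "(\<lambda>z. \<Prod>n. F n z) holomorphic_on S"
  proof (rule holomorphic_uniform_sequence[OF S])
    fix N show "(\<lambda>z. \<Prod>n<N. F n z) holomorphic_on S" by (intro holomorphic_intros hol)
  next
    fix x assume x: "x \<in> S"
    obtain d where d: "d > 0" "cball x d \<subseteq> S" using S x open_contains_cball by blast
    obtain M where M: "summable M" "\<forall>\<^sub>F n in sequentially. \<forall>w\<in>S. cmod w \<le> cmod x + d \<longrightarrow> cmod (F n w - 1) \<le> M n"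
      using bd[of "cmod x + d"] by blast
    have nb: "cmod w \<le> cmod x + d" if "w \<in> cball x d" for w
      using that norm_triangle_sub[of w x] by (simp add: dist_norm norm_minus_commute)
    have "uniformly_convergent_on (cball x d) (\<lambda>N z. \<Prod>n<N. F n z)"
    proof (rule uniformly_convergent_on_prod')
      show "continuous_on (cball x d) (F n)" for n
        using hol d(2) holomorphic_on_imp_continuous_on holomorphic_on_subset by blast
      show "uniformly_convergent_on (cball x d) (\<lambda>N z. \<Sum>n<N. norm (F n z - 1))"
      proof (rule Weierstrass_m_test'_ev[OF _ M(1)])
        show "\<forall>\<^sub>F n in sequentially. \<forall>z\<in>cball x d. norm (norm (F n z - 1)) \<le> M n"
          using M(2) by eventually_elim (use d nb in auto)
      qed
    qed auto
    then obtain L where L: "uniform_limit (cball x d) (\<lambda>N z. \<Prod>n<N. F n z) L sequentially"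
      by (auto simp: uniformly_convergent_on_def)
    have "L z = (\<Prod>n. F n z)" if "z \<in> cball x d" for z
    proof -
      have "(\<lambda>N. \<Prod>n<N. F n z) \<longlonglongrightarrow> L z" using tendsto_uniform_limitI[OF L that] .
      then have "(\<lambda>N. \<Prod>n\<le>N. F n z) \<longlonglongrightarrow> L z"
        using LIMSEQ_Suc by (force simp: lessThan_Suc_atMost)
      moreover have "(\<lambda>N. \<Prod>n\<le>N. F n z) \<longlonglongrightarrow> (\<Prod>n. F n z)"
        using conv that d(2) by (intro convergent_prod_LIMSEQ) auto
      ultimately show ?thesis by (rule LIMSEQ_unique)
    qed
    then have "uniform_limit (cball x d) (\<lambda>N z. \<Prod>n<N. F n z) (\<lambda>z. \<Prod>n. F n z) sequentially"
      using L by (subst uniform_limit_cong'[where g = "\<lambda>N z. \<Prod>n<N. F n z" and i = L]) auto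
    then show "\<exists>d>0. cball x d \<subseteq> S \<and> uniform_limit (cball x d) (\<lambda>N z. \<Prod>n<N. F n z) (\<lambda>z. \<Prod>n. F n z) sequentially"
      using d by blast
  qed
qed

lemma prodinf_eq_0:
  fixes f :: "nat \<Rightarrow> complex"
  assumes "convergent_prod f" "f k = 0"
  shows "prodinf f = 0"
proof (rule LIMSEQ_unique[OF convergent_prod_LIMSEQ[OF assms(1)]])
  have "\<forall>\<^sub>F n in sequentially. (\<Prod>i\<le>n. f i) = 0"
    using assms(2) by (intro eventually_sequentiallyI[of k]) auto
  then show "(\<lambda>n. \<Prod>i\<le>n. f i) \<longlonglongrightarrow> 0" by (rule tendsto_eventually)
qed

text \<open>With \<open>s = sqrt (a\<^sup>2 + 4)\<close> the convergence factor is the unimodular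
  \<open>c = s / (a + 2 * \<i>)\<close>. Both \<open>(z - w) / (z - cnj w)\<close> and
  \<open>1 / c\<close> are \<open>1 + 2 * \<i> / a\<close> up to order \<open>1 / a^2\<close>. This
  cancellation matters: for \<beta> = 1 the series of \<open>1 / a\<close> diverges.\<close>

lemma blaschke_factor_minus_one:
  fixes a :: real and z :: complex
  assumes a: "a > 0" and z: "Im z > 0" and R: "cmod z \<le> R" "a \<ge> 2 * (R + 1)"
  defines "w \<equiv> of_real a + \<i>"
  shows "cmod (of_real (cmod (w\<^sup>2 + 1)) / (w\<^sup>2 + 1) * ((z - w) / (z - cnj w)) - 1) \<le> (16 + 4 * R) / a\<^sup>2"
proof -
  define s where "s = sqrt (a\<^sup>2 + 4)"
  have s0: "s > 0" unfolding s_def using a by (simp add: add_pos_pos)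
  have s2: "s\<^sup>2 = a\<^sup>2 + 4" unfolding s_def by (simp add: add_nonneg_nonneg)
  have sa: "a \<le> s" by (rule power2_le_imp_le) (use s0 s2 in auto)
  have sa2: "s \<le> a + 2" by (rule power2_le_imp_le) (use a s2 in \<open>auto simp: power2_sum\<close>)
  have sq: "s - a \<le> 4 / a"
  proof -
    have "(s - a) * (s + a) = 4" using s2 by (simp add: algebra_simps power2_eq_square)
    moreover have "(s - a) * a \<le> (s - a) * (s + a)" using sa s0 a by (intro mult_left_mono) auto
    ultimately show ?thesis using a by (simp add: pos_le_divide_eq)
  qed
  have w21: "w\<^sup>2 + 1 = of_real a * (of_real a + 2 * \<i>)"
    by (simp add: w_def power2_eq_square algebra_simps)
  have nz: "of_real a + 2 * \<i> \<noteq> (0::complex)" by (simp add: complex_eq_iff)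
  have cm: "cmod (of_real a + 2 * \<i>) = s" by (simp add: s_def cmod_def)
  define c where "c = complex_of_real s / (of_real a + 2 * \<i>)"
  have c: "of_real (cmod (w\<^sup>2 + 1)) / (w\<^sup>2 + 1) = c"
    unfolding w21 c_def using a cm by (simp add: norm_mult)
  have cn: "cmod c = 1" unfolding c_def using cm s0 by (simp add: norm_divide)
  have zc: "z - cnj w = z - of_real a + \<i>" by (simp add: w_def)
  have dz: "cmod (z - cnj w) \<ge> a / 2"
  proof -
    have "cmod (of_real a) \<le> cmod (z - cnj w) + cmod (z + \<i>)"
      using norm_triangle_ineq4[of "z + \<i>" "z - cnj w"] unfolding zc by simp
    moreover have "cmod (z + \<i>) \<le> R + 1" using norm_triangle_ineq[of z \<i>] R by simp
    ultimately show ?thesis using R a by simp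
  qed
  have dz0: "z - cnj w \<noteq> 0" using dz a by auto
  define r where "r = (z - w) / (z - cnj w)"
  have r: "r = 1 - 2 * \<i> / (z - cnj w)"
    using dz0 unfolding r_def by (simp add: field_simps w_def)
  have ci: "c * ((of_real a + 2 * \<i>) / of_real s) = 1" unfolding c_def using nz s0 by simp
  have "c * r - 1 = c * (r - (of_real a + 2 * \<i>) / of_real s)"
    using ci by (simp add: algebra_simps)
  then have "cmod (c * r - 1) = cmod (r - (of_real a + 2 * \<i>) / of_real s)"
    by (simp add: norm_mult cn)
  also have "r - (of_real a + 2 * \<i>) / of_real s =
     of_real ((s - a) / s) - 2 * \<i> * ((of_real s + (z - cnj w)) / (of_real s * (z - cnj w)))"
    unfolding r using s0 dz0 by (simp add: field_simps)
  also have "cmod \<dots> \<le> cmod (of_real ((s - a) / s)) + cmod (2 * \<i> * ((of_real s + (z - cnj w)) / (of_real s * (z - cnj w))))"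
    by (rule norm_triangle_ineq4)
  also have "cmod (of_real ((s - a) / s)) \<le> 4 / a\<^sup>2"
  proof -
    have "cmod (of_real ((s - a) / s)) = (s - a) / s" using sa s0 by (subst norm_of_real) simp
    also have "\<dots> \<le> (4 / a) / a" using sa sq s0 a by (intro frac_le) auto
    finally show ?thesis by (simp add: power2_eq_square)
  qed
  also have "cmod (2 * \<i> * ((of_real s + (z - cnj w)) / (of_real s * (z - cnj w)))) \<le> 2 * ((R + 3) / (a * (a / 2)))"
  proof -
    have "of_real s + (z - cnj w) = of_real (s - a) + (z + \<i>)" unfolding zc by simp
    then have "cmod (of_real s + (z - cnj w)) \<le> cmod (complex_of_real (s - a)) + cmod (z + \<i>)"
      using norm_triangle_ineq[of "of_real (s - a)" "z + \<i>"] by (simp only:)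
    also have "cmod (z + \<i>) \<le> cmod z + 1" using norm_triangle_ineq[of z \<i>] by simp
    also have "cmod (complex_of_real (s - a)) \<le> 2" using sa sa2 by (subst norm_of_real) simp
    finally have "cmod (of_real s + (z - cnj w)) \<le> R + 3" using R by simp
    moreover have "a * (a / 2) \<le> cmod (of_real s * (z - cnj w))"
      unfolding norm_mult using sa dz a s0 by (intro mult_mono) auto
    ultimately have "cmod (of_real s + (z - cnj w)) / cmod (of_real s * (z - cnj w)) \<le> (R + 3) / (a * (a / 2))"
      using a order_trans[OF norm_ge_zero R(1)] by (intro frac_le) auto
    then have "2 * (cmod (of_real s + (z - cnj w)) / cmod (of_real s * (z - cnj w))) \<le> 2 * ((R + 3) / (a * (a / 2)))"
      by (rule mult_left_mono) simp
    moreover have "cmod (2 * \<i> * u) = 2 * cmod u" for u by (simp add: norm_mult)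
    ultimately show ?thesis by (simp only: norm_divide)
  qed
  also have "4 / a\<^sup>2 + 2 * ((R + 3) / (a * (a / 2))) = (16 + 4 * R) / a\<^sup>2"
    using a by (simp add: power2_eq_square field_simps)
  finally show ?thesis unfolding c r_def by simp
qed

text \<open>By \<open>a n \<ge> n + 1\<close>, true of the powers with \<beta> \<ge> 1, the factors
  differ from 1 by at most a multiple of \<open>1 / (n + 1)^2\<close> on bounded sets for large
  \<open>n\<close>. Holomorphy, the bound 1 and the zeros are all that orthogonality draws from
  \<open>B\<close>.\<close>

lemma Blaschke_UHP_properties:
  fixes a :: "nat \<Rightarrow> real"
  assumes a: "\<And>n. a n \<ge> real (Suc n)"
  defines "B \<equiv> blaschke_UHP (\<lambda>n. of_real (a n) + \<i>)"
  shows "B holomorphic_on UHP" "\<And>z. z \<in> UHP \<Longrightarrow> cmod (B z) \<le> 1" "\<And>n. B (of_real (a n) + \<i>) = 0"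
proof -
  define w where "w = (\<lambda>n. complex_of_real (a n) + \<i>)"
  define F where "F = (\<lambda>n z. (of_real (cmod ((w n)\<^sup>2 + 1)) / ((w n)\<^sup>2 + 1)) * ((z - w n) / (z - cnj (w n))))"
  have a0: "a n > 0" for n using a[of n] by linarith
  have Beq: "B = (\<lambda>z. \<Prod>n. F n z)" by (simp add: B_def blaschke_UHP_def F_def w_def fun_eq_iff)
  have op: "open UHP" unfolding UHP_def by (rule open_halfspace_Im_gt)
  have nz: "z - cnj (w n) \<noteq> 0" if "z \<in> UHP" for z n
    using that by (auto simp: UHP_def w_def complex_eq_iff)
  have hF: "F n holomorphic_on UHP" for n
    unfolding F_def using nz by (intro holomorphic_intros) auto
  have bd: "\<exists>M. summable M \<and> (\<forall>\<^sub>F n in sequentially. \<forall>z\<in>UHP. cmod z \<le> R \<longrightarrow> cmod (F n z - 1) \<le> M n)" for R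
  proof (intro exI conjI)
    define R' where "R' = max R 0"
    have "summable (\<lambda>n. inverse ((real (Suc n))\<^sup>2))"
      using inverse_power_summable[of 2, where ?'a = real] by (subst summable_Suc_iff) auto
    then show "summable (\<lambda>n. (16 + 4 * R') * inverse ((real (Suc n))\<^sup>2))" by (rule summable_mult)
    obtain N where N: "real N \<ge> 2 * (R' + 1)" using real_arch_simple by blast
    show "\<forall>\<^sub>F n in sequentially. \<forall>z\<in>UHP. cmod z \<le> R \<longrightarrow> cmod (F n z - 1) \<le> (16 + 4 * R') * inverse ((real (Suc n))\<^sup>2)"
    proof (intro eventually_sequentiallyI[of N] ballI impI)
      fix n z assume n: "N \<le> n" and z: "z \<in> UHP" "cmod z \<le> R"
      have "a n \<ge> 2 * (R' + 1)" using N n a[of n] by simp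
      then have "cmod (F n z - 1) \<le> (16 + 4 * R') / (a n)\<^sup>2"
        unfolding F_def w_def using z a0[of n]
        by (intro blaschke_factor_minus_one) (auto simp: UHP_def R'_def)
      also have "\<dots> \<le> (16 + 4 * R') / (real (Suc n))\<^sup>2"
        using a[of n] by (intro divide_left_mono power_mono) (auto simp: R'_def)
      finally show "cmod (F n z - 1) \<le> (16 + 4 * R') * inverse ((real (Suc n))\<^sup>2)"
        by (simp add: divide_inverse)
    qed
  qed
  show "B holomorphic_on UHP" unfolding Beq by (rule holomorphic_on_prodinf[OF op hF bd])
  have conv: "convergent_prod (\<lambda>n. F n z)" if "z \<in> UHP" for z
    by (rule convergent_prod_locally_bounded[OF op hF bd that])
  show "cmod (B z) \<le> 1" if z: "z \<in> UHP" for z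
  proof -
    have "cmod (F n z) \<le> 1" for n
    proof -
      have "cmod (z - w n) \<le> cmod (z - cnj (w n))"
      proof (rule power2_le_imp_le[OF _ norm_ge_zero])
        show "(cmod (z - w n))\<^sup>2 \<le> (cmod (z - cnj (w n)))\<^sup>2"
          unfolding cmod_power2 using z by (simp add: w_def UHP_def power2_eq_square algebra_simps)
      qed
      then have "cmod ((z - w n) / (z - cnj (w n))) \<le> 1"
        using nz[OF z, of n] by (simp add: norm_divide)
      moreover have "cmod (of_real (cmod ((w n)\<^sup>2 + 1)) / ((w n)\<^sup>2 + 1)) \<le> 1" by (simp add: norm_divide)
      ultimately show ?thesis unfolding F_def norm_mult[of "_ / _"] by (intro mult_le_one) auto
    qed
    then have "cmod (\<Prod>n\<le>N. F n z) \<le> 1" for N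
      unfolding prod_norm[symmetric] by (intro prod_le_1) auto
    then show ?thesis
      unfolding Beq by (intro LIMSEQ_le_const2[OF tendsto_norm[OF convergent_prod_LIMSEQ[OF conv[OF z]]]]) auto
  qed
  show "B (of_real (a n) + \<i>) = 0" for n
    unfolding Beq
  proof (rule prodinf_eq_0[OF conv])
    show "of_real (a n) + \<i> \<in> UHP" by (simp add: UHP_def)
    show "F n (of_real (a n) + \<i>) = 0" by (simp add: F_def w_def)
  qed
qed

section \<open>Products over points interlacing squares\<close>

text \<open>The modulus of the factor \<open>1 - m^2 / j^2\<close> in Euler's product for the sine
  at the integer \<open>m\<close>. Products over \<open>j\<close> have closed forms once the
  vanishing factor \<open>j = m\<close> is left out.\<close>

definition quad_ratio :: "nat \<Rightarrow> nat \<Rightarrow> real" where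
  "quad_ratio m j = \<bar>(real m)\<^sup>2 - (real j)\<^sup>2\<bar> / (real j)\<^sup>2"

lemma quad_ratio_nonneg [simp]: "0 \<le> quad_ratio m j"
  by (simp add: quad_ratio_def)

text \<open>Factoring \<open>m^2 - j^2 = (m - j) * (m + j)\<close> makes the product a quotient of
  factorials. Written with positive binomial coefficients it is visibly at least 1.\<close>

lemma prod_quad_ratio_below:
  assumes "N < m"
  shows "(\<Prod>j\<in>{1..N}. quad_ratio m j) = real ((m - 1) choose N) * real ((m + N) choose N)"
  using assms
proof (induction N)
  case (Suc N)
  have q: "quad_ratio m (Suc N) = (real m - real (Suc N)) * (real m + real (Suc N)) / (real (Suc N))\<^sup>2"
  proof -
    have "(real (Suc N))\<^sup>2 \<le> (real m)\<^sup>2" using Suc.prems by (intro power_mono) auto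
    then have "\<bar>(real m)\<^sup>2 - (real (Suc N))\<^sup>2\<bar> = (real m)\<^sup>2 - (real (Suc N))\<^sup>2" by simp
    also have "\<dots> = (real m - real (Suc N)) * (real m + real (Suc N))"
      by (simp only: power2_eq_square square_diff_square_factored mult.commute)
    finally show ?thesis unfolding quad_ratio_def by (simp only:)
  qed
  have e1: "real (Suc N) * real ((m - 1) choose Suc N) = (real m - real (Suc N)) * real ((m - 1) choose N)"
  proof -
    have "Suc N * ((m - 1) choose Suc N) = (m - 1 - N) * ((m - 1) choose N)"
      by (simp only: binomial_absorption binomial_absorb_comp)
    then have "real (Suc N) * real ((m - 1) choose Suc N) = real (m - 1 - N) * real ((m - 1) choose N)"
      by (metis of_nat_mult)
    also have "real (m - 1 - N) = real m - real (Suc N)" using Suc.prems by simp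
    finally show ?thesis .
  qed
  have e2: "real (Suc N) * real ((m + Suc N) choose Suc N) = (real m + real (Suc N)) * real ((m + N) choose N)"
  proof -
    have "Suc N * ((m + Suc N) choose Suc N) = Suc (m + N) * ((m + N) choose N)"
      using Suc_times_binomial[of N "m + N"] by (simp only: add_Suc_right)
    then show ?thesis by (metis add_Suc_right of_nat_add of_nat_mult)
  qed
  have "(\<Prod>j\<in>{1..Suc N}. quad_ratio m j) = (\<Prod>j\<in>{1..N}. quad_ratio m j) * quad_ratio m (Suc N)" by simp
  also have "\<dots> = ((real m - real (Suc N)) * real ((m - 1) choose N)) * ((real m + real (Suc N)) * real ((m + N) choose N)) / (real (Suc N))\<^sup>2"
    using Suc unfolding q by (simp add: mult_ac del: of_nat_Suc)
  also have "\<dots> = real ((m - 1) choose Suc N) * real ((m + Suc N) choose Suc N)"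
    unfolding e1[symmetric] e2[symmetric] by (simp add: power2_eq_square del: of_nat_Suc binomial_Suc_Suc add_Suc_right)
  finally show ?case .
qed simp

text \<open>The induction starts at \<open>N = m\<close>, where \<open>prod_quad_ratio_below\<close>
  applies with \<open>m - 1\<close> factors. As \<open>N\<close> grows the value decreases to
  \<open>1 / 2\<close>.\<close>

lemma prod_quad_ratio_above:
  assumes "1 \<le> m" "m \<le> N"
  shows "(\<Prod>j\<in>{1..N} - {m}. quad_ratio m j) = fact (N - m) * fact (N + m) / (2 * (fact N)\<^sup>2)"
  using assms(2)
proof (induction N rule: dec_induct)
  case base
  obtain p where p: "m = Suc p" using assms(1) by (cases m) auto
  have "{1..m} - {m} = {1..p}" using p by auto
  then have "(\<Prod>j\<in>{1..m} - {m}. quad_ratio m j) = real ((m + p) choose p)"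
    using prod_quad_ratio_below[of p m] p by simp
  also have "real ((m + p) choose p) = fact (m + p) / (fact p * fact m)"
    by (simp add: binomial_fact)
  also have "\<dots> = fact (m + m) / (2 * (fact m)\<^sup>2)"
  proof -
    have "fact (m + m) = (2 * real m) * (fact (m + p) :: real)" using p by (simp add: algebra_simps)
    moreover have "fact m = real m * (fact p :: real)" using p by simp
    moreover have "Q / (P * (M * P)) = (2 * M * Q) / (2 * (M * P)\<^sup>2)" if "M \<noteq> 0" for M P Q :: real
      using that by (simp add: power2_eq_square)
    ultimately show ?thesis using p by (simp only:)
  qed
  finally show ?case by simp
next
  case (step N)
  have "{1..Suc N} - {m} = insert (Suc N) ({1..N} - {m})" using step by auto
  then have "(\<Prod>j\<in>{1..Suc N} - {m}. quad_ratio m j) = quad_ratio m (Suc N) * (\<Prod>j\<in>{1..N} - {m}. quad_ratio m j)"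
    by simp
  also have "quad_ratio m (Suc N) = (real (Suc N) - real m) * (real (Suc N) + real m) / (real (Suc N))\<^sup>2"
  proof -
    have "(real m)\<^sup>2 \<le> (real (Suc N))\<^sup>2" using step by (intro power_mono) auto
    then show ?thesis by (simp add: quad_ratio_def power2_eq_square algebra_simps del: of_nat_Suc)
  qed
  also have "real (Suc N) - real m = real (Suc N - m)" using step by simp
  also have "real (Suc N) + real m = real (Suc N + m)" by simp
  also have "real (Suc N - m) * real (Suc N + m) / (real (Suc N))\<^sup>2 * (\<Prod>j\<in>{1..N} - {m}. quad_ratio m j) =
     (real (Suc N - m) * fact (N - m)) * (real (Suc N + m) * fact (N + m)) / (2 * (real (Suc N) * fact N)\<^sup>2)"
    unfolding step.IH by (simp add: power_mult_distrib mult_ac del: of_nat_Suc of_nat_add)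
  also have "real (Suc N - m) * fact (N - m) = fact (Suc N - m)" using step by (simp add: Suc_diff_le)
  also have "real (Suc N + m) * fact (N + m) = fact (Suc N + m)" by simp
  also have "real (Suc N) * fact N = fact (Suc N)" by simp
  finally show ?case .
qed

lemma fact_square_le: "m \<le> N \<Longrightarrow> (fact N)\<^sup>2 \<le> (fact (N - m) * fact (N + m) :: real)"
proof (induction m)
  case (Suc m)
  define k where "k = N - Suc m"
  have k: "N - m = Suc k" using Suc.prems by (simp add: k_def)
  have "(fact N)\<^sup>2 \<le> (fact (N - m) * fact (N + m) :: real)" using Suc by simp
  also have "\<dots> = real (Suc k) * (fact k * fact (N + m))" unfolding k by simp
  also have "\<dots> \<le> real (Suc (N + m)) * (fact k * fact (N + m))"
    using k by (intro mult_right_mono) auto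
  finally show ?case by (simp add: k_def mult_ac)
qed (simp add: power2_eq_square)

text \<open>For \<open>N < m\<close> by integrality of the binomial coefficients, otherwise by
  log-convexity of the factorial. The bound is uniform in \<open>m\<close> and \<open>N\<close>,
  which lets \<open>m\<close> follow the point \<open>x\<close>.\<close>

lemma prod_quad_ratio_ge:
  assumes "1 \<le> m"
  shows "1 / 2 \<le> (\<Prod>j\<in>{1..N} - {m}. quad_ratio m j)"
proof (cases "N < m")
  case True
  then have "{1..N} - {m} = {1..N}" by auto
  moreover have "1 * 1 \<le> real ((m - 1) choose N) * real ((m + N) choose N)"
  proof (intro mult_mono)
    have "(m - 1) choose N > 0" "(m + N) choose N > 0" using True by (auto simp: zero_less_binomial_iff)
    then show "1 \<le> real ((m - 1) choose N)" "1 \<le> real ((m + N) choose N)" by linarith+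
  qed auto
  ultimately show ?thesis using prod_quad_ratio_below[OF True] by simp
next
  case False
  then have "m \<le> N" by simp
  then show ?thesis
    unfolding prod_quad_ratio_above[OF assms \<open>m \<le> N\<close>]
    using fact_square_le[of m N] by (simp add: pos_le_divide_eq)
qed

text \<open>A factor is at most \<open>m^2\<close> because \<open>j \<ge> 1\<close>, so dropping up
  to \<open>q\<close> of them costs at most the power \<open>q\<close> of
  \<open>m^2\<close>.\<close>

lemma prod_quad_ratio_subset_ge:
  assumes m: "1 \<le> m" and A: "{1..N} - {m} - A \<subseteq> {1..q}" "A \<subseteq> {1..N} - {m}"
  shows "1 / (2 * (real m)\<^sup>2 ^ q) \<le> (\<Prod>j\<in>A. quad_ratio m j)"
proof -
  define C where "C = {1..N} - {m} - A"
  have fA: "finite A" using A(2) finite_subset by blast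
  have "1 / 2 \<le> (\<Prod>j\<in>{1..N} - {m}. quad_ratio m j)" by (rule prod_quad_ratio_ge[OF m])
  also have "\<dots> = (\<Prod>j\<in>C. quad_ratio m j) * (\<Prod>j\<in>A. quad_ratio m j)"
    unfolding C_def using A(2) by (intro prod.subset_diff) auto
  also have "(\<Prod>j\<in>C. quad_ratio m j) \<le> (real m)\<^sup>2 ^ q"
  proof -
    have "(\<Prod>j\<in>C. quad_ratio m j) \<le> (\<Prod>j\<in>C. (real m)\<^sup>2)"
    proof (intro prod_mono conjI quad_ratio_nonneg)
      fix j assume "j \<in> C"
      then have j: "1 \<le> j" by (simp add: C_def)
      have "\<bar>(real m)\<^sup>2 - (real j)\<^sup>2\<bar> \<le> (real m)\<^sup>2 * (real j)\<^sup>2"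
      proof -
        have "1 \<le> (real m)\<^sup>2" "1 \<le> (real j)\<^sup>2" using m j by simp_all
        then have "(real m)\<^sup>2 \<le> (real m)\<^sup>2 * (real j)\<^sup>2" "(real j)\<^sup>2 \<le> (real m)\<^sup>2 * (real j)\<^sup>2"
          by (simp_all add: mult_le_cancel_left1 mult_le_cancel_right1)
        then show ?thesis using zero_le_power2[of "real m"] zero_le_power2[of "real j"] by linarith
      qed
      then show "quad_ratio m j \<le> (real m)\<^sup>2" using j by (simp add: quad_ratio_def pos_divide_le_eq)
    qed
    also have "\<dots> = (real m)\<^sup>2 ^ card C" by simp
    also have "\<dots> \<le> (real m)\<^sup>2 ^ q"
    proof (rule power_increasing)
      show "card C \<le> q" using A(1) card_mono[of "{1..q}" C] by (simp add: C_def)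
      show "1 \<le> (real m)\<^sup>2" using m by simp
    qed
    finally show ?thesis .
  qed
  finally have "1 / 2 \<le> (real m)\<^sup>2 ^ q * (\<Prod>j\<in>A. quad_ratio m j)"
    by (simp add: mult_right_mono prod_nonneg)
  then show ?thesis using m by (simp add: pos_divide_le_eq mult_ac)
qed

text \<open>The points \<open>l k\<close> interlace the squares \<open>e\<^sup>2 k\<^sup>2\<close>; each factor is compared with a factor of
  \<open>\<Prod>j (1 - m\<^sup>2 / j\<^sup>2)\<close>, with index \<open>k + 2\<close> below \<open>m\<close> and index \<open>k\<close> above. Only the three factors next
  to \<open>m\<close> and boundedly many missing ones cost a power of \<open>x\<close>.\<close>

lemma interlacing_prod_lower_bound:
  fixes l :: "nat \<Rightarrow> real"
  assumes e: "e > 0" and l: "\<And>k. k \<ge> q \<Longrightarrow> e\<^sup>2 * (real k)\<^sup>2 \<le> l k \<and> l k \<le> e\<^sup>2 * (real (k + 1))\<^sup>2"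
    and q: "q \<ge> 1" and x: "x \<ge> 0"
  shows "1 / (2 * ((2 / e\<^sup>2 + 8 * e\<^sup>2 + 5) * (1 + x)) ^ (q + 4)) \<le> (\<Prod>k\<in>{q..N}. cmod (of_real (l k) - \<i> - of_real x) / l k)"
proof -
  \<comment> \<open>The index \<open>m\<close> satisfies
    \<open>e * (m - 1) \<le> sqrt x < e * m\<close>; the sine product is taken at this
    integer.\<close>
  define K where "K = nat \<lfloor>sqrt x / e\<rfloor>"
  define m where "m = K + 1"
  \<comment> \<open>A common bound for \<open>m^2\<close>, the price of a missing factor, and for
    \<open>e^2 * (m + 1)^2\<close>, which dominates \<open>l k\<close> for
    \<open>k \<le> m\<close>.\<close>
  define D where "D = (2 / e\<^sup>2 + 8 * e\<^sup>2 + 5) * (1 + x)"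
  define phi where "phi = (\<lambda>k. cmod (of_real (l k) - \<i> - of_real x) / l k)"
  have K: "real K \<le> sqrt x / e" "sqrt x / e < real K + 1"
    using x e by (simp_all add: K_def of_nat_floor)
  have m: "m \<ge> 1" by (simp add: m_def)
  have xm: "x \<le> e\<^sup>2 * (real m)\<^sup>2"
  proof -
    have "sqrt x \<le> e * real m" using K(2) e by (simp add: m_def field_simps)
    then have "(sqrt x)\<^sup>2 \<le> (e * real m)\<^sup>2" using x by (intro power_mono) auto
    then show ?thesis using x by (simp add: power_mult_distrib)
  qed
  have xm1: "e\<^sup>2 * (real m - 1)\<^sup>2 \<le> x"
  proof -
    have "e * (real m - 1) \<le> sqrt x" using K(1) e by (simp add: m_def field_simps)
    then have "(e * (real m - 1))\<^sup>2 \<le> (sqrt x)\<^sup>2" using e by (intro power_mono) (auto simp: m_def)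
    then show ?thesis using x by (simp add: power_mult_distrib)
  qed
  have l0: "l k > 0" if "k \<ge> q" for k
    using l[OF that] e q that by (smt (verit) mult_pos_pos of_nat_0_less_iff zero_less_power le_trans less_le_trans zero_less_one)
  have phi1: "phi k \<ge> \<bar>l k - x\<bar> / l k" if "k \<ge> q" for k
    unfolding phi_def using l0[OF that] abs_Re_le_cmod[of "of_real (l k) - \<i> - of_real x"]
    by (intro divide_right_mono) auto
  have phi0: "phi k \<ge> 0" if "k \<ge> q" for k
    unfolding phi_def using l0[OF that] by simp
  have high: "quad_ratio m k \<le> phi k" if k: "k \<ge> q" "k > m" for k
  proof -
    have "quad_ratio m k = 1 - (real m)\<^sup>2 / (real k)\<^sup>2"
    proof -
      have "(real m)\<^sup>2 \<le> (real k)\<^sup>2" using k by (intro power_mono) auto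
      then show ?thesis using k m by (simp add: quad_ratio_def field_simps)
    qed
    also have "\<dots> = 1 - (e\<^sup>2 * (real m)\<^sup>2) / (e\<^sup>2 * (real k)\<^sup>2)" using e by simp
    also have "\<dots> \<le> 1 - x / l k"
      using xm x l[OF k(1)] l0[OF k(1)] e k by (intro diff_left_mono frac_le) auto
    also have "\<dots> \<le> \<bar>l k - x\<bar> / l k" using l0[OF k(1)] by (simp add: field_simps abs_if)
    finally show ?thesis using phi1[OF k(1)] by linarith
  qed
  \<comment> \<open>The shift by 2: rounding \<open>x\<close> down and \<open>l k\<close> up leaves
    the ratio \<open>(m - 1) / (k + 1)\<close>, which is at least \<open>m / (k + 2)\<close> exactly
    when \<open>k + 2 \<le> m\<close>.\<close>
  have low: "quad_ratio m (k + 2) \<le> phi k" if k: "k \<ge> q" "k + 3 \<le> m" for k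
  proof -
    have km: "(real (k + 2))\<^sup>2 \<le> (real m)\<^sup>2" using k by (intro power_mono) auto
    have "quad_ratio m (k + 2) = (real m / real (k + 2))\<^sup>2 - 1"
      using km by (simp add: quad_ratio_def field_simps power_divide del: of_nat_add)
    also have "\<dots> \<le> ((real m - 1) / real (k + 1))\<^sup>2 - 1"
    proof -
      have "real m * real (k + 1) \<le> (real m - 1) * real (k + 2)" using k by (simp add: algebra_simps)
      then have "real m / real (k + 2) \<le> (real m - 1) / real (k + 1)"
        by (simp add: divide_le_eq le_divide_eq mult.commute del: of_nat_add)
      then show ?thesis by (intro diff_right_mono power_mono) auto
    qed
    also have "\<dots> = (e\<^sup>2 * (real m - 1)\<^sup>2) / (e\<^sup>2 * (real (k + 1))\<^sup>2) - 1" using e by (simp add: power_divide)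
    also have "\<dots> \<le> x / l k - 1"
      using xm1 x l[OF k(1)] l0[OF k(1)] e by (intro diff_right_mono frac_le) auto
    also have "\<dots> \<le> \<bar>l k - x\<bar> / l k" using l0[OF k(1)] by (simp add: field_simps abs_if)
    finally show ?thesis using phi1[OF k(1)] by linarith
  qed
  have m2: "(real m)\<^sup>2 \<le> 2 * x / e\<^sup>2 + 2" "(real (m + 1))\<^sup>2 \<le> 2 * x / e\<^sup>2 + 8"
  proof -
    have *: "(u + v)\<^sup>2 \<le> 2 * u\<^sup>2 + 2 * v\<^sup>2" for u v :: real
      using sum_squares_bound[of u v] by (simp add: power2_sum)
    have "(real K)\<^sup>2 \<le> x / e\<^sup>2"
      using power_mono[OF K(1), of 2] x by (simp add: power_divide)
    then have K2: "2 * (real K)\<^sup>2 \<le> 2 * x / e\<^sup>2" by simp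
    show "(real m)\<^sup>2 \<le> 2 * x / e\<^sup>2 + 2" using *[of "real K" 1] K2 by (simp add: m_def add.commute)
    show "(real (m + 1))\<^sup>2 \<le> 2 * x / e\<^sup>2 + 8" using *[of "real K" 2] K2 by (simp add: m_def add.commute)
  qed
  have D1: "1 \<le> D" unfolding D_def using x e
    by (intro mult_ge1_I) auto
  have Dm: "(real m)\<^sup>2 \<le> D"
  proof -
    have "2 * x / e\<^sup>2 \<le> (2 / e\<^sup>2) * (1 + x)" by (simp add: divide_right_mono)
    moreover have "0 \<le> 8 * e\<^sup>2 * (1 + x)" using x by simp
    moreover have "5 \<le> 5 * (1 + x)" using x by simp
    moreover have "D = (2 / e\<^sup>2) * (1 + x) + 8 * e\<^sup>2 * (1 + x) + 5 * (1 + x)"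
      by (simp add: D_def distrib_right)
    moreover have "p + 2 \<le> d" if "p \<le> u" "0 \<le> v" "5 \<le> w" "d = u + v + w" for p u v w d :: real
      using that by linarith
    ultimately have "2 * x / e\<^sup>2 + 2 \<le> D" by blast
    then show ?thesis using m2 by linarith
  qed
  have Dm1: "e\<^sup>2 * (real (m + 1))\<^sup>2 \<le> D"
  proof -
    have "e\<^sup>2 * (real (m + 1))\<^sup>2 \<le> e\<^sup>2 * (2 * x / e\<^sup>2 + 8)" using m2 by (intro mult_left_mono) auto
    also have "\<dots> = 2 * x + 8 * e\<^sup>2" using e by (simp add: field_simps)
    also have "\<dots> \<le> D" unfolding D_def using x e by (simp add: algebra_simps)
    finally show ?thesis .
  qed
  \<comment> \<open>For \<open>k\<close> next to \<open>m\<close> only the imaginary part separates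
    \<open>l k - \<i>\<close> from \<open>x\<close>, so the numerator is bounded below by 1.\<close>
  have mid: "1 / D \<le> phi k" if k: "k \<ge> q" "k \<le> m" for k
  proof -
    have "l k \<le> e\<^sup>2 * (real (k + 1))\<^sup>2" using l[OF k(1)] by simp
    also have "\<dots> \<le> e\<^sup>2 * (real (m + 1))\<^sup>2" using k by (intro mult_left_mono power_mono) auto
    finally have "l k \<le> D" using Dm1 by linarith
    moreover have "1 \<le> cmod (of_real (l k) - \<i> - of_real x)"
      using abs_Im_le_cmod[of "of_real (l k) - \<i> - of_real x"] by simp
    ultimately show ?thesis unfolding phi_def using l0[OF k(1)] by (intro frac_le) auto
  qed
  define L M H where "L = {k\<in>{q..N}. k + 3 \<le> m}" and "M = {k\<in>{q..N}. m < k + 3 \<and> k \<le> m}"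
    and "H = {k\<in>{q..N}. k > m}"
  \<comment> \<open>The indices \<open>k + 2\<close> with \<open>k\<close> in \<open>L\<close> stay
    below \<open>m\<close> and those in \<open>H\<close> exceed it, so none is used twice. Up to its
    end \<open>A\<close> misses only \<open>m\<close> and indices among
    \<open>1, ..., q + 1\<close>; with the three factors of \<open>M\<close> this makes the exponent
    \<open>q + 4\<close>.\<close>
  define A where "A = (\<lambda>k. k + 2) ` L \<union> H"
  have split: "{q..N} = L \<union> M \<union> H" by (auto simp: L_def M_def H_def)
  have "(\<Prod>k\<in>{q..N}. phi k) = (\<Prod>k\<in>L. phi k) * (\<Prod>k\<in>M. phi k) * (\<Prod>k\<in>H. phi k)"
    unfolding split
    by (subst prod.union_disjoint, (auto simp: L_def M_def H_def)[3])+ simp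
  moreover have "(\<Prod>k\<in>L. quad_ratio m (k + 2)) \<le> (\<Prod>k\<in>L. phi k)"
    by (rule prod_mono) (use low in \<open>auto simp: L_def\<close>)
  moreover have "(\<Prod>k\<in>H. quad_ratio m k) \<le> (\<Prod>k\<in>H. phi k)"
    by (rule prod_mono) (use high in \<open>auto simp: H_def\<close>)
  moreover have "(1 / D) ^ 3 \<le> (\<Prod>k\<in>M. phi k)"
  proof -
    have "M \<subseteq> {m - 2..m}" by (auto simp: M_def)
    then have "card M \<le> 3" using card_mono[of "{m - 2..m}" M] by simp
    then have "(1 / D) ^ 3 \<le> (1 / D) ^ card M" using D1 by (intro power_decreasing) auto
    also have "\<dots> = (\<Prod>k\<in>M. 1 / D)" by simp
    also have "\<dots> \<le> (\<Prod>k\<in>M. phi k)"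
      by (rule prod_mono) (use mid D1 in \<open>auto simp: M_def\<close>)
    finally show ?thesis .
  qed
  ultimately have 1: "(\<Prod>k\<in>L. quad_ratio m (k + 2)) * (1 / D) ^ 3 * (\<Prod>k\<in>H. quad_ratio m k) \<le> (\<Prod>k\<in>{q..N}. phi k)"
    using D1 phi0 by (auto intro!: mult_mono prod_nonneg mult_nonneg_nonneg simp: L_def H_def M_def)
  have "(\<Prod>k\<in>L. quad_ratio m (k + 2)) * (\<Prod>k\<in>H. quad_ratio m k) = (\<Prod>j\<in>A. quad_ratio m j)"
  proof -
    have "(\<Prod>j\<in>(\<lambda>k. k + 2) ` L. quad_ratio m j) = (\<Prod>k\<in>L. quad_ratio m (k + 2))"
      by (subst prod.reindex) (auto simp: inj_on_def)
    moreover have "(\<lambda>k. k + 2) ` L \<inter> H = {}" by (auto simp: L_def H_def)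
    ultimately show ?thesis unfolding A_def by (subst prod.union_disjoint) (auto simp: L_def H_def)
  qed
  \<comment> \<open>If \<open>N + 3 \<le> m\<close>, then \<open>H\<close> is empty and
    \<open>A\<close> ends by \<open>N + 2\<close>, still below \<open>m\<close>. Otherwise the
    shifted indices may reach \<open>m - 1\<close> even where this exceeds \<open>N\<close>, hence
    the range up to \<open>max N (m - 1)\<close>.\<close>
  moreover have "1 / (2 * (real m)\<^sup>2 ^ (q + 1)) \<le> (\<Prod>j\<in>A. quad_ratio m j)"
  proof (cases "N + 3 \<le> m")
    case True
    have *: "j \<in> A" if "q + 2 \<le> j" "j \<le> N + 2" for j
    proof -
      have "j - 2 \<in> L" using that True by (auto simp: L_def)
      moreover have "j = (j - 2) + 2" using that by simp
      ultimately show ?thesis unfolding A_def by blast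
    qed
    show ?thesis
    proof (rule prod_quad_ratio_subset_ge[OF m, of "N + 2"])
      show "{1..N + 2} - {m} - A \<subseteq> {1..q + 1}"
      proof
        fix j assume "j \<in> {1..N + 2} - {m} - A"
        then show "j \<in> {1..q + 1}" using *[of j] by (cases "q + 2 \<le> j") auto
      qed
    qed (use True q in \<open>auto simp: A_def L_def H_def\<close>)
  next
    case False
    have *: "j \<in> A" if "q + 2 \<le> j" "j \<noteq> m" "j \<le> max N (m - 1)" for j
    proof (cases "j < m")
      case True
      then have "j - 2 \<in> L" using that False by (auto simp: L_def)
      moreover have "j = (j - 2) + 2" using that by simp
      ultimately show ?thesis unfolding A_def by blast
    next
      case False
      then show ?thesis using that unfolding A_def H_def by auto
    qed
    show ?thesis
    proof (rule prod_quad_ratio_subset_ge[OF m, of "max N (m - 1)"])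
      show "{1..max N (m - 1)} - {m} - A \<subseteq> {1..q + 1}"
      proof
        fix j assume "j \<in> {1..max N (m - 1)} - {m} - A"
        then show "j \<in> {1..q + 1}" using *[of j] by (cases "q + 2 \<le> j") auto
      qed
      show "A \<subseteq> {1..max N (m - 1)} - {m}"
        using q unfolding A_def L_def H_def by force
    qed
  qed
  moreover have "1 / (2 * D ^ (q + 1)) \<le> 1 / (2 * (real m)\<^sup>2 ^ (q + 1))"
    using Dm m D1 by (intro divide_left_mono mult_left_mono power_mono) auto
  ultimately have "1 / (2 * D ^ (q + 1)) * (1 / D) ^ 3 \<le> (\<Prod>k\<in>L. quad_ratio m (k + 2)) * (\<Prod>k\<in>H. quad_ratio m k) * (1 / D) ^ 3"
    using D1 by (intro mult_right_mono) auto
  also have "\<dots> \<le> (\<Prod>k\<in>{q..N}. phi k)" using 1 by (simp add: mult_ac)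
  also have "1 / (2 * D ^ (q + 1)) * (1 / D) ^ 3 = 1 / (2 * D ^ (q + 4))"
  proof -
    have "q + 4 = (q + 1) + 3" by simp
    then have "D ^ (q + 4) = D ^ (q + 1) * D ^ 3" by (simp only: power_add)
    then show ?thesis by (simp only: power_one_over) simp
  qed
  finally show ?thesis unfolding phi_def D_def .
qed

lemma power_le_fact_exp:
  fixes x :: real
  assumes "x \<ge> 0"
  shows "x ^ n \<le> fact n * exp x"
proof -
  have "(\<Sum>k\<in>{n}. x ^ k /\<^sub>R fact k) \<le> exp x"
    using assms exp_converges[of x] by (subst sums_unique[OF exp_converges[of x]]) (intro sum_le_suminf sums_summable, auto)
  then show ?thesis by (simp add: field_simps)
qed

text \<open>A consequence of \<open>1 + 2 * u \<le> exp (2 * u)\<close>. It trades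
  \<open>sinh u / u\<close> for \<open>exp u\<close> over a linear factor, uniformly down to
  \<open>u = 0\<close>.\<close>

lemma exp_le_sinh:
  fixes u :: real
  assumes "u > 0"
  shows "exp u * u \<le> (1 + 2 * u) * sinh u"
proof -
  have "exp u * exp u = exp (2 * u)" by (simp add: mult_exp_exp)
  then have "1 + 2 * u \<le> exp u * exp u"
    using exp_ge_add_one_self[of "2 * u"] by (simp only:)
  then have "(1 + 2 * u) * exp (-u) \<le> exp u * exp u * exp (-u)" by (intro mult_right_mono) auto
  also have "exp u * exp u * exp (-u) = exp u" by (simp add: mult_exp_exp)
  finally show ?thesis by (simp add: sinh_field_def algebra_simps)
qed

lemma sinh_product_formula:
  fixes u :: real
  assumes "u > 0"
  shows "(\<lambda>n. \<Prod>k=1..n. 1 + u\<^sup>2 / (real k)\<^sup>2) \<longlonglongrightarrow> sinh (pi * u) / (pi * u)"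
proof -
  have "(\<lambda>n. of_real pi * (\<i> * of_real u) * (\<Prod>k=1..n. 1 - (\<i> * of_real u)\<^sup>2 / (of_nat k)\<^sup>2)) \<longlonglongrightarrow> sin (of_real pi * (\<i> * of_real u))"
    by (rule sin_product_formula_complex)
  then have "(\<lambda>n. - \<i> * (of_real pi * (\<i> * of_real u) * (\<Prod>k=1..n. 1 - (\<i> * of_real u)\<^sup>2 / (of_nat k)\<^sup>2))) \<longlonglongrightarrow> - \<i> * sin (of_real pi * (\<i> * of_real u))"
    by (rule tendsto_mult_left)
  moreover have "- \<i> * (of_real pi * (\<i> * of_real u) * (\<Prod>k=1..n. 1 - (\<i> * of_real u)\<^sup>2 / (of_nat k)\<^sup>2)) =
      complex_of_real (pi * u * (\<Prod>k=1..n. 1 + u\<^sup>2 / (real k)\<^sup>2))" for n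
  proof -
    have "- \<i> * (a * (\<i> * b) * P) = a * b * P" for a b P :: complex by (simp add: algebra_simps)
    then show ?thesis by (simp add: power_mult_distrib)
  qed
  moreover have "- \<i> * sin (of_real pi * (\<i> * of_real u)) = complex_of_real (sinh (pi * u))"
  proof -
    have "complex_of_real (sinh (pi * u)) = sinh (complex_of_real (pi * u))"
      by (simp add: sinh_field_def flip: exp_of_real)
    then show ?thesis unfolding sinh_conv_sin by (simp add: mult_ac)
  qed
  ultimately have "(\<lambda>n. pi * u * (\<Prod>k=1..n. 1 + u\<^sup>2 / (real k)\<^sup>2)) \<longlonglongrightarrow> sinh (pi * u)"
    by (simp only: tendsto_of_real_iff)
  then have "(\<lambda>n. pi * u * (\<Prod>k=1..n. 1 + u\<^sup>2 / (real k)\<^sup>2) / (pi * u)) \<longlonglongrightarrow> sinh (pi * u) / (pi * u)"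
    using assms by (intro tendsto_divide) auto
  then show ?thesis using assms by simp
qed

section \<open>The canonical product \<open>E\<close> and its growth\<close>

lemma norm_factor_eq:
  fixes l :: real
  assumes "l > 0"
  shows "cmod (1 - (z + \<i>) / of_real l) = cmod (of_real l - \<i> - z) / l"
proof -
  have "1 - (z + \<i>) / of_real l = (of_real l - \<i> - z) / of_real l" using assms by (simp add: field_simps)
  then show ?thesis using assms by (simp add: norm_divide)
qed

text \<open>The zero \<open>l - \<i>\<close> lies below the real axis, so rising from
  \<open>Re z\<close> to \<open>z\<close> only increases the distance to it.\<close>

lemma norm_factor_real_le:
  assumes "Im z \<ge> 0"
  shows "cmod (of_real l - \<i> - of_real (Re z)) \<le> cmod (of_real l - \<i> - z)"
proof (rule power2_le_imp_le[OF _ norm_ge_zero])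
  have "1 \<le> (- 1 - Im z)\<^sup>2" using assms by (simp add: power2_eq_square algebra_simps)
  then show "(cmod (of_real l - \<i> - of_real (Re z)))\<^sup>2 \<le> (cmod (of_real l - \<i> - z))\<^sup>2"
    unfolding cmod_power2 by simp
qed

text \<open>The point of index \<open>s + j\<close> is matched with \<open>e^2 * j^2\<close>, so
  \<open>s\<close> counts the surplus. On the positive axis the comparison costs the power
  \<open>q + 4\<close> of \<open>1 + x\<close>, and the first \<open>s + q\<close> factors earn the
  power \<open>s + q\<close>; with \<open>s \<ge> 5\<close> at least one power remains, enough for
  \<open>1 / E\<close> to be square integrable.\<close>

locale interlacing_zeros =
  fixes l :: "nat \<Rightarrow> real" and e :: real and s q :: nat
  assumes e: "e > 0" and pos: "\<And>k. l k > 0" and s: "s \<ge> 5" and q: "q \<ge> 1"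
    and inter: "\<And>j. j \<ge> q \<Longrightarrow> e\<^sup>2 * (real j)\<^sup>2 \<le> l (s + j) \<and> l (s + j) \<le> e\<^sup>2 * (real (j + 1))\<^sup>2"
begin

text \<open>The zero is \<open>l k - \<i>\<close>; centring the numerator at \<open>- \<i>\<close>
  makes the denominator the real number \<open>l k\<close>.\<close>

definition fac :: "nat \<Rightarrow> complex \<Rightarrow> complex" where
  "fac k z = 1 - (z + \<i>) / of_real (l k)"

definition E :: "complex \<Rightarrow> complex" where
  "E z = (\<Prod>k. fac k z)"

lemma norm_fac: "cmod (fac k z) = cmod (of_real (l k) - \<i> - z) / l k"
  unfolding fac_def by (rule norm_factor_eq[OF pos])

lemma norm_fac_real_le:
  assumes "Im z \<ge> 0"
  shows "cmod (fac k (of_real (Re z))) \<le> cmod (fac k z)"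
  unfolding norm_fac using pos[of k] by (intro divide_right_mono norm_factor_real_le assms) simp

lemma norm_fac_neg:
  assumes "t \<ge> 0"
  shows "1 + t / l k \<le> cmod (fac k (of_real (- t)))"
proof -
  have "l k + t \<le> cmod (of_real (l k) - \<i> - of_real (- t))"
    using abs_Re_le_cmod[of "of_real (l k) - \<i> - of_real (- t)"] by simp
  then have "(l k + t) / l k \<le> cmod (of_real (l k) - \<i> - of_real (- t)) / l k"
    using pos[of k] by (intro divide_right_mono) auto
  then show ?thesis unfolding norm_fac using pos[of k] by (simp add: add_divide_distrib)
qed

lemma prod_split:
  fixes g :: "nat \<Rightarrow> 'a::comm_monoid_mult"
  assumes "M \<ge> q"
  shows "(\<Prod>k\<le>s + M. g k) = (\<Prod>k<s + q. g k) * (\<Prod>j\<in>{q..M}. g (s + j))"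
proof -
  have eq: "{..s + M} = {..<s + q} \<union> (+) s ` {q..M}"
    using assms by (auto simp: image_iff)
  have "(\<Prod>k\<in>(+) s ` {q..M}. g k) = (\<Prod>j\<in>{q..M}. g (s + j))"
    by (subst prod.reindex) (auto simp: inj_on_def)
  then show ?thesis unfolding eq by (subst prod.union_disjoint) auto
qed

lemma summable_inverse_l: "summable (\<lambda>k. 1 / l k)"
proof -
  have "summable (\<lambda>j. 1 / l (j + s))"
  proof (rule summable_comparison_test_ev)
    show "summable (\<lambda>j. (1 / e\<^sup>2) * inverse ((real j)\<^sup>2))"
      using inverse_power_summable[of 2, where ?'a = real] by (intro summable_mult) auto
    show "\<forall>\<^sub>F j in sequentially. norm (1 / l (j + s)) \<le> (1 / e\<^sup>2) * inverse ((real j)\<^sup>2)"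
    proof (intro eventually_sequentiallyI[of q])
      fix j assume j: "q \<le> j"
      have "1 / l (j + s) \<le> 1 / (e\<^sup>2 * (real j)\<^sup>2)"
        using inter[OF j] e q j pos[of "j + s"] by (intro divide_left_mono) (auto simp: add.commute)
      then show "norm (1 / l (j + s)) \<le> (1 / e\<^sup>2) * inverse ((real j)\<^sup>2)"
        using pos[of "j + s"] by (simp add: field_simps)
    qed
  qed
  then show ?thesis by (subst (asm) summable_iff_shift)
qed

lemma
  shows convergent_fac: "convergent_prod (\<lambda>k. fac k z)"
    and holomorphic_E: "E holomorphic_on UNIV"
proof -
  have bd: "\<exists>M. summable M \<and> (\<forall>\<^sub>F n in sequentially. \<forall>z\<in>UNIV. cmod z \<le> R \<longrightarrow> cmod (fac n z - 1) \<le> M n)" for R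
  proof (intro exI conjI)
    show "summable (\<lambda>n. (R + 1) * (1 / l n))" by (intro summable_mult summable_inverse_l)
    show "\<forall>\<^sub>F n in sequentially. \<forall>z\<in>UNIV. cmod z \<le> R \<longrightarrow> cmod (fac n z - 1) \<le> (R + 1) * (1 / l n)"
    proof (intro always_eventually allI ballI impI)
      fix n z assume z: "cmod z \<le> R"
      have "cmod (fac n z - 1) = cmod (z + \<i>) / l n"
        using pos[of n] by (simp add: fac_def norm_divide flip: norm_minus_cancel[of "- (_ / _)"])
      also have "\<dots> \<le> (R + 1) / l n"
        using norm_triangle_ineq[of z \<i>] z pos[of n] by (intro divide_right_mono) auto
      finally show "cmod (fac n z - 1) \<le> (R + 1) * (1 / l n)" by simp
    qed
  qed
  have hol: "fac n holomorphic_on UNIV" for n unfolding fac_def using pos[of n] by (intro holomorphic_intros) auto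
  show "convergent_prod (\<lambda>k. fac k z)"
    by (rule convergent_prod_locally_bounded[OF open_UNIV hol bd UNIV_I])
  show "E holomorphic_on UNIV"
    unfolding E_def by (rule holomorphic_on_prodinf[OF open_UNIV hol bd])
qed

lemma partial_prod_tendsto: "(\<lambda>M. \<Prod>k\<le>s + M. fac k z) \<longlonglongrightarrow> E z"
  using LIMSEQ_ignore_initial_segment[OF convergent_prod_LIMSEQ[OF convergent_fac[of z]], of s]
  by (simp add: E_def add.commute)

lemma extra_factors_lower_bound:
  obtains d where "d > 0" "\<And>x::real. d * (1 + \<bar>x\<bar>) ^ (s + q) \<le> (\<Prod>k<s + q. cmod (fac k (of_real x)))"
proof
  define w where "w = (\<lambda>k. complex_of_real (l k) + \<i>)"
  \<comment> \<open>\<open>2 + cmod (w k)\<close> is the constant of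
    \<open>one_plus_norm_le_dist\<close> for a point of height 1.\<close>
  define D where "D = (\<lambda>k. 1 / ((2 + cmod (w k)) * l k))"
  have D: "D k > 0" for k
    unfolding D_def using pos[of k] by (intro divide_pos_pos mult_pos_pos) (auto intro: add_pos_nonneg)
  show "(\<Prod>k<s + q. D k) > 0" by (intro prod_pos) (use D in auto)
  fix x :: real
  have f: "D k * (1 + \<bar>x\<bar>) \<le> cmod (fac k (of_real x))" for k
  proof -
    have "1 + \<bar>x\<bar> \<le> (2 + cmod (w k)) * cmod (of_real x - w k)"
      using one_plus_norm_le_dist[of "w k" "of_real x"] by (simp add: w_def add.commute add.left_commute)
    also have "cmod (of_real x - w k) = cmod (of_real (l k) - \<i> - of_real x)"
      by (simp add: w_def cmod_def power2_commute)
    finally have "(1 + \<bar>x\<bar>) / (2 + cmod (w k)) \<le> cmod (of_real (l k) - \<i> - of_real x)"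
      by (subst pos_divide_le_eq) (auto intro: add_pos_nonneg simp: mult.commute)
    then have "(1 + \<bar>x\<bar>) / (2 + cmod (w k)) / l k \<le> cmod (of_real (l k) - \<i> - of_real x) / l k"
      using pos[of k] by (intro divide_right_mono) auto
    then show ?thesis by (simp add: norm_fac D_def)
  qed
  have "(\<Prod>k<s + q. D k) * (1 + \<bar>x\<bar>) ^ (s + q) = (\<Prod>k<s + q. D k * (1 + \<bar>x\<bar>))"
    by (simp add: prod.distrib)
  also have "\<dots> \<le> (\<Prod>k<s + q. cmod (fac k (of_real x)))"
    by (intro prod_mono) (use f D in \<open>auto intro!: mult_nonneg_nonneg less_imp_le\<close>)
  finally show "(\<Prod>k<s + q. D k) * (1 + \<bar>x\<bar>) ^ (s + q) \<le> (\<Prod>k<s + q. cmod (fac k (of_real x)))" .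
qed

lemma main_factors_lower_bound:
  fixes x :: real
  shows "1 / (2 * ((2 / e\<^sup>2 + 8 * e\<^sup>2 + 5) * (1 + \<bar>x\<bar>)) ^ (q + 4)) \<le> (\<Prod>j\<in>{q..M}. cmod (fac (s + j) (of_real x)))"
proof (cases "x \<ge> 0")
  case True
  show ?thesis
    using interlacing_prod_lower_bound[OF e inter q True, of M] True unfolding norm_fac by simp
next
  case False
  have "1 \<le> 2 / e\<^sup>2 + 8 * e\<^sup>2 + 5" using e by (simp add: add_nonneg_nonneg)
  then have "1 * 1 \<le> (2 / e\<^sup>2 + 8 * e\<^sup>2 + 5) * (1 + \<bar>x\<bar>)" by (intro mult_mono) auto
  then have "1 \<le> ((2 / e\<^sup>2 + 8 * e\<^sup>2 + 5) * (1 + \<bar>x\<bar>)) ^ (q + 4)" by (intro one_le_power) simp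
  then have "1 / (2 * ((2 / e\<^sup>2 + 8 * e\<^sup>2 + 5) * (1 + \<bar>x\<bar>)) ^ (q + 4)) \<le> 1"
    by (subst divide_le_eq_1) linarith
  also have "1 \<le> (\<Prod>j\<in>{q..M}. cmod (fac (s + j) (of_real x)))"
  proof (rule prod_ge_1)
    fix j
    have "0 \<le> - x / l (s + j)" using False pos[of "s + j"] by (intro divide_nonneg_pos) auto
    then show "1 \<le> cmod (fac (s + j) (of_real x))"
      using norm_fac_neg[of "- x" "s + j"] False by simp
  qed
  finally show ?thesis .
qed

text \<open>Uniformity in \<open>M\<close> matters: one constant serves \<open>E\<close> in the
  limit and dominates the reciprocals of all late partial products.\<close>

lemma partial_prod_lower_bound:
  obtains c where "c > 0" "\<And>M z. M \<ge> q \<Longrightarrow> Im z \<ge> 0 \<Longrightarrow> c * (1 + \<bar>Re z\<bar>) \<le> cmod (\<Prod>k\<le>s + M. fac k z)"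
proof -
  obtain d where d: "d > 0" "\<And>x::real. d * (1 + \<bar>x\<bar>) ^ (s + q) \<le> (\<Prod>k<s + q. cmod (fac k (of_real x)))"
    using extra_factors_lower_bound by blast
  define D where "D = 2 / e\<^sup>2 + 8 * e\<^sup>2 + 5"
  have D: "D > 0" using e by (simp add: D_def add_nonneg_pos)
  define c where "c = d / (2 * D ^ (q + 4))"
  have c: "c > 0" using d D by (simp add: c_def)
  have "c * (1 + \<bar>Re z\<bar>) \<le> cmod (\<Prod>k\<le>s + M. fac k z)" if M: "M \<ge> q" and z: "Im z \<ge> 0" for M z
  proof -
    define u where "u = 1 + \<bar>Re z\<bar>"
    have u: "u \<ge> 1" by (simp add: u_def)
    have "u * u ^ (q + 4) = u ^ (q + 5)" by (simp add: numeral_eq_Suc)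
    also have "\<dots> \<le> u ^ (s + q)" using u s by (intro power_increasing) auto
    finally have "u \<le> u ^ (s + q) / u ^ (q + 4)" using u by (simp add: pos_le_divide_eq)
    then have "c * u \<le> c * (u ^ (s + q) / u ^ (q + 4))" using c by (intro mult_left_mono) auto
    also have "\<dots> = d * u ^ (s + q) * (1 / (2 * (D * u) ^ (q + 4)))"
      by (simp only: c_def power_mult_distrib) simp
    also have "\<dots> \<le> (\<Prod>k<s + q. cmod (fac k (of_real (Re z)))) * (\<Prod>j\<in>{q..M}. cmod (fac (s + j) (of_real (Re z))))"
      using d D u main_factors_lower_bound[of "Re z" M] unfolding u_def D_def
      by (intro mult_mono prod_nonneg) auto
    also have "\<dots> = (\<Prod>k\<le>s + M. cmod (fac k (of_real (Re z))))"
      using prod_split[OF M, of "\<lambda>k. cmod (fac k (of_real (Re z)))"] by simp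
    also have "\<dots> \<le> (\<Prod>k\<le>s + M. cmod (fac k z))"
      by (intro prod_mono) (use norm_fac_real_le[OF z] in auto)
    finally show ?thesis by (simp add: prod_norm u_def)
  qed
  then show ?thesis using that c by blast
qed

text \<open>At \<open>- t\<close> the factor of index \<open>s + j\<close> is at least
  \<open>1 + t / l (s + j)\<close>, hence at least the factor \<open>j + 1\<close> of the product
  for \<open>sinh (pi * u) / (pi * u)\<close> with \<open>u = sqrt t / e\<close>. The first
  \<open>q\<close> factors of that product have no counterpart and cost \<open>(1 + u^2)^q\<close>;
  the strict inequality \<open>A * e < pi\<close> leaves \<open>exp (d * u)\<close> to absorb such
  powers.\<close>

lemma negative_axis_lower_bound:
  fixes t A :: real
  assumes A: "A * e < pi"
  obtains C where "C > 0" "\<And>t. t > 0 \<Longrightarrow> exp (A * sqrt t) \<le> C * cmod (E (of_real (- t)))"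
proof -
  define d where "d = pi - A * e"
  have d: "d > 0" using A by (simp add: d_def)
  \<comment> \<open>All polynomial losses are at most \<open>8 * (1 + u)^(2 * q + 1)\<close>, with 8
    from \<open>2 * pi < 8\<close>; \<open>power_le_fact_exp\<close> at \<open>d * (1 + u)\<close>
    gives the rest.\<close>
  define C where "C = 8 * (fact (2 * q + 1) / d ^ (2 * q + 1) * exp d)"
  have C: "C > 0" using d by (simp add: C_def)
  have "exp (A * sqrt t) \<le> C * cmod (E (of_real (- t)))" if t: "t > 0" for t
  proof -
    define u where "u = sqrt t / e"
    have u: "u > 0" using t e by (simp add: u_def)
    have u2: "u\<^sup>2 = t / e\<^sup>2" using t by (simp add: u_def power_divide)
    have lb: "(\<Prod>k=1..M + 1. 1 + u\<^sup>2 / (real k)\<^sup>2) / (1 + u\<^sup>2) ^ q \<le> cmod (\<Prod>k\<le>s + M. fac k (of_real (- t)))"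
      if M: "M \<ge> q" for M
    proof -
      have "{1..M + 1} = {1..q} \<union> {q + 1..M + 1}" using M by auto
      then have "(\<Prod>k=1..M + 1. 1 + u\<^sup>2 / (real k)\<^sup>2) = (\<Prod>k=1..q. 1 + u\<^sup>2 / (real k)\<^sup>2) * (\<Prod>k=q + 1..M + 1. 1 + u\<^sup>2 / (real k)\<^sup>2)"
        by (simp only:) (subst prod.union_disjoint, auto)
      also have "\<dots> \<le> (1 + u\<^sup>2) ^ q * (\<Prod>k=q + 1..M + 1. 1 + u\<^sup>2 / (real k)\<^sup>2)"
      proof (rule mult_right_mono)
        have "(\<Prod>k=1..q. 1 + u\<^sup>2 / (real k)\<^sup>2) \<le> (\<Prod>k=1..q. 1 + u\<^sup>2)"
        proof (intro prod_mono conjI)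
          fix k assume "k \<in> {1..q}"
          then have "u\<^sup>2 / (real k)\<^sup>2 \<le> u\<^sup>2 / 1" by (intro divide_left_mono) auto
          then show "1 + u\<^sup>2 / (real k)\<^sup>2 \<le> 1 + u\<^sup>2" by simp
        qed (simp add: add_nonneg_nonneg)
        then show "(\<Prod>k=1..q. 1 + u\<^sup>2 / (real k)\<^sup>2) \<le> (1 + u\<^sup>2) ^ q" by simp
      qed (intro prod_nonneg, simp add: add_nonneg_nonneg)
      finally have "(\<Prod>k=1..M + 1. 1 + u\<^sup>2 / (real k)\<^sup>2) / (1 + u\<^sup>2) ^ q \<le> (\<Prod>k=q + 1..M + 1. 1 + u\<^sup>2 / (real k)\<^sup>2)"
        using u by (simp add: pos_divide_le_eq add_pos_nonneg mult.commute)
      also have "\<dots> = (\<Prod>j=q..M. 1 + u\<^sup>2 / (real (j + 1))\<^sup>2)"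
        by (rule prod.shift_bounds_cl_nat_ivl)
      also have "\<dots> \<le> (\<Prod>j=q..M. cmod (fac (s + j) (of_real (- t))))"
      proof (intro prod_mono conjI)
        fix j assume j: "j \<in> {q..M}"
        have "u\<^sup>2 / (real (j + 1))\<^sup>2 = t / (e\<^sup>2 * (real (j + 1))\<^sup>2)" unfolding u2 by simp
        also have "\<dots> \<le> t / l (s + j)"
          using inter[of j] j t e pos[of "s + j"] by (intro divide_left_mono) auto
        finally show "1 + u\<^sup>2 / (real (j + 1))\<^sup>2 \<le> cmod (fac (s + j) (of_real (- t)))"
          using norm_fac_neg[of t "s + j"] t by simp
      qed (simp add: add_nonneg_nonneg)
      also have "\<dots> \<le> (\<Prod>k<s + q. cmod (fac k (of_real (- t)))) * (\<Prod>j=q..M. cmod (fac (s + j) (of_real (- t))))"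
      proof -
        have "1 \<le> (\<Prod>k<s + q. cmod (fac k (of_real (- t))))"
        proof (rule prod_ge_1)
          fix k
          have "0 \<le> t / l k" using t pos[of k] by simp
          then show "1 \<le> cmod (fac k (of_real (- t)))" using norm_fac_neg[of t k] t by linarith
        qed
        from mult_right_mono[OF this, of "\<Prod>j=q..M. cmod (fac (s + j) (of_real (- t)))"]
        show ?thesis by (simp add: prod_nonneg)
      qed
      also have "\<dots> = cmod (\<Prod>k\<le>s + M. fac k (of_real (- t)))"
        unfolding prod_norm[symmetric] by (rule prod_split[OF M, symmetric])
      finally show ?thesis .
    qed
    have "sinh (pi * u) / (pi * u) / (1 + u\<^sup>2) ^ q \<le> cmod (E (of_real (- t)))"
    proof (rule LIMSEQ_le)
      show "(\<lambda>M. (\<Prod>k=1..M + 1. 1 + u\<^sup>2 / (real k)\<^sup>2) / (1 + u\<^sup>2) ^ q) \<longlonglongrightarrow> sinh (pi * u) / (pi * u) / (1 + u\<^sup>2) ^ q"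
        using u by (intro tendsto_divide LIMSEQ_ignore_initial_segment[OF sinh_product_formula] tendsto_const)
          (auto simp: add_nonneg_eq_0_iff)
      show "(\<lambda>M. cmod (\<Prod>k\<le>s + M. fac k (of_real (- t)))) \<longlonglongrightarrow> cmod (E (of_real (- t)))"
        by (intro tendsto_norm partial_prod_tendsto)
    qed (use lb in blast)
    moreover have "exp (A * sqrt t) \<le> C * (sinh (pi * u) / (pi * u) / (1 + u\<^sup>2) ^ q)"
    proof -
      have st: "A * sqrt t = pi * u - d * u" using e by (simp add: u_def d_def field_simps)
      have "1 + 2 * (pi * u) \<le> 8 * (1 + u)"
      proof -
        have "pi * u \<le> 4 * u" using pi_less_4 u by (intro mult_right_mono) auto
        then show ?thesis by simp
      qed
      moreover have "(1 + u\<^sup>2) ^ q \<le> ((1 + u)\<^sup>2) ^ q"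
        using u by (intro power_mono) (auto simp: power2_sum)
      ultimately have "(1 + 2 * (pi * u)) * (1 + u\<^sup>2) ^ q \<le> 8 * (1 + u) * ((1 + u)\<^sup>2) ^ q"
        using u by (intro mult_mono) auto
      also have "\<dots> = 8 * (1 + u) ^ (2 * q + 1)" by (simp add: power_mult)
      also have "\<dots> \<le> C * exp (d * u)"
      proof -
        have "d ^ n * (1 + u) ^ n \<le> fact n * (exp d * exp (d * u))" for n
          using power_le_fact_exp[of "d * (1 + u)" n] d u
          by (simp add: power_mult_distrib[symmetric] exp_add[symmetric] distrib_left)
        from this[of "2 * q + 1"] show ?thesis unfolding C_def using d by (simp add: field_simps del: power_Suc fact_Suc)
      qed
      finally have p: "(1 + 2 * (pi * u)) * (1 + u\<^sup>2) ^ q \<le> C * exp (d * u)" .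
      have "exp (A * sqrt t) * exp (d * u) = exp (pi * u)" unfolding st by (simp flip: exp_add)
      then have "exp (A * sqrt t) * ((1 + 2 * (pi * u)) * (1 + u\<^sup>2) ^ q) \<le> C * exp (pi * u)"
        using mult_left_mono[OF p, of "exp (A * sqrt t)"] by (simp add: mult_ac)
      then have "exp (A * sqrt t) * ((1 + 2 * (pi * u)) * (1 + u\<^sup>2) ^ q) * (pi * u) \<le> C * (exp (pi * u) * (pi * u))"
        using u by (simp add: mult_right_mono mult.assoc[symmetric])
      also have "\<dots> \<le> C * ((1 + 2 * (pi * u)) * sinh (pi * u))"
        using exp_le_sinh[of "pi * u"] u C by (intro mult_left_mono) auto
      finally have "(1 + 2 * (pi * u)) * (exp (A * sqrt t) * ((1 + u\<^sup>2) ^ q * (pi * u))) \<le> (1 + 2 * (pi * u)) * (C * sinh (pi * u))"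
        by (simp only: mult_ac)
      moreover have "1 + 2 * (pi * u) > 0" using u by (simp add: add_pos_nonneg)
      ultimately have "exp (A * sqrt t) * ((1 + u\<^sup>2) ^ q * (pi * u)) \<le> C * sinh (pi * u)"
        by (simp only: mult_le_cancel_left_pos)
      moreover have "(1 + u\<^sup>2) ^ q * (pi * u) > 0" using u by (simp add: add_pos_nonneg)
      ultimately have "exp (A * sqrt t) \<le> C * sinh (pi * u) / ((1 + u\<^sup>2) ^ q * (pi * u))"
        by (simp only: pos_le_divide_eq)
      then show ?thesis by (simp add: mult_ac)
    qed
    ultimately show ?thesis using C by (meson mult_left_mono less_imp_le order_trans)
  qed
  then show ?thesis using that C by blast
qed

end

section \<open>Orthogonality of the reciprocal product\<close>

text \<open>A linear numerator over two distinct simple poles has no polynomial part. The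
  coefficients \<alpha> and \<beta> let one statement serve the base case, with a linear numerator,
  and the induction step, with a constant one.\<close>

lemma partial_fractions_step:
  fixes p :: "nat \<Rightarrow> complex" and X :: "complex set"
  assumes "inj p" and X: "\<And>x k. x \<in> X \<Longrightarrow> x \<noteq> p k" and g: "\<And>x. x \<in> X \<Longrightarrow> g x = (\<Sum>k\<le>N. c k / (x - p k))"
  shows "\<exists>c'. \<forall>x\<in>X. (\<alpha> + \<beta> * x) * g x / (x - p (Suc N)) = (\<Sum>k\<le>Suc N. c' k / (x - p k))"
proof -
  let ?r = "p (Suc N)"
  define a where "a = (\<lambda>k. c k * (\<alpha> + \<beta> * p k) / (p k - ?r))"
  define b where "b = (\<lambda>k. c k * (\<alpha> + \<beta> * ?r) / (?r - p k))"
  have "(\<alpha> + \<beta> * x) * g x / (x - ?r) = (\<Sum>k\<le>Suc N. (a(Suc N := (\<Sum>k\<le>N. b k))) k / (x - p k))"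
    if x: "x \<in> X" for x
  proof -
    have "(\<alpha> + \<beta> * x) * g x / (x - ?r) = (\<Sum>k\<le>N. (\<alpha> + \<beta> * x) * (c k / (x - p k)) / (x - ?r))"
      by (simp add: g[OF x] sum_distrib_left sum_divide_distrib)
    also have "\<dots> = (\<Sum>k\<le>N. a k / (x - p k) + b k / (x - ?r))"
    proof (rule sum.cong[OF refl])
      fix k assume "k \<in> {..N}"
      then have "p k \<noteq> ?r" using inj_eq[OF \<open>inj p\<close>] by auto
      moreover have "c0 * A / (P - R) / (x - P) + c0 * B / (R - P) / (x - R) = C0 * (c0 / (x - P)) / (x - R)"
        if "P \<noteq> R" "x \<noteq> P" "x \<noteq> R" and e: "A * (x - R) - B * (x - P) = C0 * (P - R)" for c0 A B C0 P R
      proof -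
        have nz: "P - R \<noteq> 0" "x - P \<noteq> 0" "x - R \<noteq> 0" using that by auto
        have "c0 * A / (P - R) / (x - P) + c0 * B / (R - P) / (x - R) = c0 * (A * (x - R) - B * (x - P)) / ((P - R) * (x - P) * (x - R))"
        proof -
          have "c0 * B / (R - P) = - (c0 * B / (P - R))" by (metis minus_diff_eq minus_divide_right)
          then show ?thesis using nz by (simp add: divide_simps) (simp add: algebra_simps)
        qed
        also have "\<dots> = C0 * (c0 / (x - P)) / (x - R)" unfolding e using nz by simp
        finally show ?thesis .
      qed
      moreover have "(\<alpha> + \<beta> * p k) * (x - ?r) - (\<alpha> + \<beta> * ?r) * (x - p k) = (\<alpha> + \<beta> * x) * (p k - ?r)"
        by (simp add: algebra_simps)
      ultimately show "(\<alpha> + \<beta> * x) * (c k / (x - p k)) / (x - ?r) = a k / (x - p k) + b k / (x - ?r)"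
        unfolding a_def b_def using X[OF x] by metis
    qed
    also have "\<dots> = (\<Sum>k\<le>N. a k / (x - p k)) + (\<Sum>k\<le>N. b k) / (x - ?r)"
      by (simp add: sum.distrib sum_divide_distrib)
    finally show ?thesis by simp
  qed
  then show ?thesis by blast
qed

text \<open>Dividing by \<open>x - w\<close> afterwards, with \<open>w = \<i>\<close>, produces the
  conjugate of the factor \<open>1 / (t + \<i>)\<close> of the reproducing formula. At least two
  poles are taken so that the numerator has the smaller degree.\<close>

lemma partial_fractions_prod:
  fixes p :: "nat \<Rightarrow> complex" and X :: "complex set"
  assumes "inj p" and X: "\<And>x k. x \<in> X \<Longrightarrow> x \<noteq> p k"
  shows "\<exists>c. \<forall>x\<in>X. (x - w) * (\<Prod>k\<le>Suc N. a k / (x - p k)) = (\<Sum>k\<le>Suc N. c k / (x - p k))"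
proof (induction N)
  case 0
  have "\<exists>c'. \<forall>x\<in>X. (- w * a 1 + a 1 * x) * (a 0 / (x - p 0)) / (x - p (Suc 0)) = (\<Sum>k\<le>Suc 0. c' k / (x - p k))"
    by (rule partial_fractions_step[OF assms, where c = a]) auto
  moreover have "(x - w) * (\<Prod>k\<le>Suc 0. a k / (x - p k)) = (- w * a 1 + a 1 * x) * (a 0 / (x - p 0)) / (x - p (Suc 0))" for x
    by (simp add: divide_inverse algebra_simps)
  ultimately show ?case by (simp only:)
next
  case (Suc N)
  then obtain c where c: "\<And>x. x \<in> X \<Longrightarrow> (x - w) * (\<Prod>k\<le>Suc N. a k / (x - p k)) = (\<Sum>k\<le>Suc N. c k / (x - p k))"
    by blast
  have "\<exists>c'. \<forall>x\<in>X. (a (Suc (Suc N)) + 0 * x) * ((x - w) * (\<Prod>k\<le>Suc N. a k / (x - p k))) / (x - p (Suc (Suc N)))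
      = (\<Sum>k\<le>Suc (Suc N). c' k / (x - p k))"
    by (rule partial_fractions_step[OF assms c])
  then show ?case by (simp add: mult_ac)
qed

lemma inverse_square_bound:
  fixes c u :: real
  assumes "c > 0" "c * (1 + \<bar>x\<bar>) \<le> u"
  shows "(1 / u)\<^sup>2 \<le> (1 / c)\<^sup>2 / (1 + x\<^sup>2)"
proof -
  have "0 < c * (1 + \<bar>x\<bar>)" using assms(1) by (intro mult_pos_pos) auto
  then have u: "0 < u\<^sup>2" using assms(2) by simp
  have "c\<^sup>2 * (1 + x\<^sup>2) \<le> (c * (1 + \<bar>x\<bar>))\<^sup>2"
    unfolding power_mult_distrib by (rule mult_left_mono) (simp_all add: power2_sum)
  also have "\<dots> \<le> u\<^sup>2" using assms by (intro power_mono) auto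
  finally have "1 / u\<^sup>2 \<le> 1 / (c\<^sup>2 * (1 + x\<^sup>2))"
    using assms(1) u by (intro divide_left_mono mult_pos_pos) (auto intro: add_pos_nonneg)
  then show ?thesis by (simp add: power_one_over)
qed

lemma bv_continuous:
  assumes "isCont f (of_real x)"
  shows "bv f x = f (of_real x)"
proof -
  have "((\<lambda>y. Complex x y) \<longlongrightarrow> Complex x 0) (at_right 0)"
    unfolding Complex_eq by (intro tendsto_intros)
  then have "((\<lambda>y. f (Complex x y)) \<longlongrightarrow> f (of_real x)) (at_right 0)"
    using assms by (intro isCont_tendsto_compose[of _ f]) (auto simp: complex_of_real_def)
  then show ?thesis unfolding bv_def by (intro tendsto_Lim) auto
qed

context interlacing_zeros
begin

lemma E_lower_bound:
  obtains c where "c > 0" "\<And>z. Im z \<ge> 0 \<Longrightarrow> c * (1 + \<bar>Re z\<bar>) \<le> cmod (E z)"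
    "\<And>M z. M \<ge> q \<Longrightarrow> Im z \<ge> 0 \<Longrightarrow> c * (1 + \<bar>Re z\<bar>) \<le> cmod (\<Prod>k\<le>s + M. fac k z)"
proof -
  obtain c where c: "c > 0" "\<And>M z. M \<ge> q \<Longrightarrow> Im z \<ge> 0 \<Longrightarrow> c * (1 + \<bar>Re z\<bar>) \<le> cmod (\<Prod>k\<le>s + M. fac k z)"
    using partial_prod_lower_bound by blast
  have "c * (1 + \<bar>Re z\<bar>) \<le> cmod (E z)" if "Im z \<ge> 0" for z
    by (rule LIMSEQ_le_const[OF tendsto_norm[OF partial_prod_tendsto]]) (use c(2) that in blast)
  then show ?thesis using that c by blast
qed

lemma E_nonzero:
  assumes "Im z \<ge> 0"
  shows "E z \<noteq> 0"
proof -
  obtain c where c: "c > 0" "\<And>z. Im z \<ge> 0 \<Longrightarrow> c * (1 + \<bar>Re z\<bar>) \<le> cmod (E z)"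
    "\<And>M z. M \<ge> q \<Longrightarrow> Im z \<ge> 0 \<Longrightarrow> c * (1 + \<bar>Re z\<bar>) \<le> cmod (\<Prod>k\<le>s + M. fac k z)"
    using E_lower_bound by blast
  have "0 < c * (1 + \<bar>Re z\<bar>)" using c(1) by (intro mult_pos_pos) auto
  then show ?thesis using c(2)[OF assms] by auto
qed

lemma H2_inverse_E: "(\<lambda>z. 1 / E z) \<in> H2"
proof -
  obtain c where c: "c > 0" "\<And>z. Im z \<ge> 0 \<Longrightarrow> c * (1 + \<bar>Re z\<bar>) \<le> cmod (E z)"
    "\<And>M z. M \<ge> q \<Longrightarrow> Im z \<ge> 0 \<Longrightarrow> c * (1 + \<bar>Re z\<bar>) \<le> cmod (\<Prod>k\<le>s + M. fac k z)"
    using E_lower_bound by blast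
  note nz = E_nonzero
  have hol: "(\<lambda>z. 1 / E z) holomorphic_on UHP"
    using nz by (intro holomorphic_intros holomorphic_on_subset[OF holomorphic_E]) (auto simp: UHP_def)
  have bd: "(cmod (1 / E (Complex x y)))\<^sup>2 \<le> (1 / c)\<^sup>2 * (1 / (1 + x\<^sup>2))" if "y > 0" for x y
    using inverse_square_bound[OF c(1), of x] c(2)[of "Complex x y"] that by (simp add: norm_divide)
  have I: "integrable lborel (\<lambda>x::real. (1 / c)\<^sup>2 * (1 / (1 + x\<^sup>2)))"
    by (intro integrable_mult_right integrable_inverse_one_plus_square)
  have int: "integrable lborel (\<lambda>x. (cmod (1 / E (Complex x y)))\<^sup>2)" if y: "y > 0" for y
  proof (rule Bochner_Integration.integrable_bound[OF I])
    show "(\<lambda>x. (cmod (1 / E (Complex x y)))\<^sup>2) \<in> borel_measurable lborel"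
      using measurable_horizontal[OF hol y] by measurable
    show "AE x in lborel. norm ((cmod (1 / E (Complex x y)))\<^sup>2) \<le> norm ((1 / c)\<^sup>2 * (1 / (1 + x\<^sup>2)))"
      using order_trans[OF bd[OF y] abs_ge_self] by (intro AE_I2) simp
  qed
  show ?thesis
  proof (rule H2_I[OF hol int])
    fix y :: real assume y: "y > 0"
    show "(LBINT x. (cmod (1 / E (Complex x y)))\<^sup>2) \<le> (LBINT x. (1 / c)\<^sup>2 * (1 / (1 + x\<^sup>2)))"
      by (intro integral_mono int I bd y)
  qed
qed

text \<open>By partial fractions the reciprocal of a partial product is a combination of conjugates
  of the kernels \<open>1 / ((t + \<i>) * (t - w))\<close> at \<open>w = l k + \<i>\<close>, against
  which \<open>b\<close> integrates to 0.\<close>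

lemma partial_prod_orthogonal:
  assumes "inj l" and b: "b \<in> borel_measurable borel"
    and kint: "\<And>k. integrable lborel (\<lambda>t. b t / ((of_real t + \<i>) * (of_real t - (of_real (l k) + \<i>))))"
    and k0: "\<And>k. (LBINT t. b t / ((of_real t + \<i>) * (of_real t - (of_real (l k) + \<i>)))) = 0"
  shows "(LBINT x. 1 / (\<Prod>k\<le>Suc N. fac k (of_real x)) * cnj (b x)) = 0"
proof -
  define p where "p = (\<lambda>k. complex_of_real (l k) - \<i>)"
  have "inj p" using assms(1) by (auto simp: p_def inj_def)
  moreover have ne: "x \<noteq> p k" if "x \<in> \<real>" for x k
    using that by (auto simp: p_def complex_is_Real_iff)
  ultimately obtain c where c: "\<And>x. x \<in> \<real> \<Longrightarrow>
      (x - \<i>) * (\<Prod>k\<le>Suc N. - of_real (l k) / (x - p k)) = (\<Sum>k\<le>Suc N. c k / (x - p k))"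
    using partial_fractions_prod[where p = p and X = \<real> and w = \<i> and N = N and a = "\<lambda>k. - of_real (l k)"] by blast
  have eq: "1 / (\<Prod>k\<le>Suc N. fac k (of_real x)) * cnj (b x) =
     (\<Sum>k\<le>Suc N. c k * cnj (b x / ((of_real x + \<i>) * (of_real x - (of_real (l k) + \<i>)))))" for x
  proof -
    have xi: "complex_of_real x - \<i> \<noteq> 0" by (simp add: complex_eq_iff)
    have f: "1 / fac k (of_real x) = - of_real (l k) / (of_real x - p k)" for k
    proof -
      have "fac k (of_real x) = (of_real x - p k) / (- of_real (l k))"
        using pos[of k] by (simp add: fac_def p_def field_simps)
      then show ?thesis by simp
    qed
    have "1 / (\<Prod>k\<le>Suc N. fac k (of_real x)) = (\<Prod>k\<le>Suc N. 1 / fac k (of_real x))"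
      by (simp add: prod_dividef del: prod.atMost_Suc)
    also have "\<dots> = (\<Sum>k\<le>Suc N. c k / (of_real x - p k)) / (of_real x - \<i>)"
      unfolding f using c[of "of_real x"] xi by (simp add: eq_divide_eq mult.commute del: prod.atMost_Suc sum.atMost_Suc)
    also have "\<dots> * cnj (b x) = (\<Sum>k\<le>Suc N. c k / (of_real x - p k) / (of_real x - \<i>) * cnj (b x))"
      by (simp add: sum_divide_distrib sum_distrib_right del: sum.atMost_Suc)
    also have "\<dots> = (\<Sum>k\<le>Suc N. c k * cnj (b x / ((of_real x + \<i>) * (of_real x - (of_real (l k) + \<i>)))))"
      by (rule sum.cong[OF refl]) (simp add: p_def mult_ac)
    finally show ?thesis .
  qed
  have "has_bochner_integral lborel (\<lambda>x. \<Sum>k\<le>Suc N. c k * cnj (b x / ((of_real x + \<i>) * (of_real x - (of_real (l k) + \<i>)))))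
      (\<Sum>k\<le>Suc N. c k * cnj 0)"
  proof (intro has_bochner_integral_sum has_bochner_integral_mult_right has_bochner_integral_cnj)
    fix k
    show "has_bochner_integral lborel (\<lambda>x. b x / ((of_real x + \<i>) * (of_real x - (of_real (l k) + \<i>)))) 0"
      using has_bochner_integral_integrable[OF kint[of k]] k0[of k] by simp
  qed
  then show ?thesis unfolding eq by (simp add: has_bochner_integral_integral_eq del: sum.atMost_Suc)
qed

text \<open>Dominated convergence from the partial products to \<open>E\<close>. The conclusion is a
  gauge integral because \<open>H2_inner\<close> is one, and the Borel representative is exchanged
  for \<open>bv h\<close> outside a null set.\<close>

lemma inverse_E_orthogonal:
  assumes "inj l" and h: "h \<in> H2" and hz: "\<And>k. h (of_real (l k) + \<i>) = 0"
  shows "((\<lambda>x. 1 / E (of_real x) * cnj (bv h x)) has_integral 0) UNIV"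
proof -
  obtain b where b: "b \<in> borel_measurable borel" "AE x in lborel. bv h x = b x"
    "integrable lborel (\<lambda>x. (cmod (b x))\<^sup>2)"
    "\<And>w. Im w > 0 \<Longrightarrow> integrable lborel (\<lambda>t. b t / ((of_real t + \<i>) * (of_real t - w)))"
    "\<And>w. Im w > 0 \<Longrightarrow> (LBINT t. b t / ((of_real t + \<i>) * (of_real t - w))) = 2 * pi * \<i> * h w / (w + \<i>)"
    using H2_boundary_reproducing[OF h] by blast
  obtain c where c: "c > 0" "\<And>z. Im z \<ge> 0 \<Longrightarrow> c * (1 + \<bar>Re z\<bar>) \<le> cmod (E z)"
    "\<And>M z. M \<ge> q \<Longrightarrow> Im z \<ge> 0 \<Longrightarrow> c * (1 + \<bar>Re z\<bar>) \<le> cmod (\<Prod>k\<le>s + M. fac k z)"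
    using E_lower_bound by blast
  note nz = E_nonzero
  have cm [measurable]: "(\<lambda>x. cnj (b x)) \<in> borel_measurable borel"
    using b(1) by (rule measurable_compose) (intro borel_measurable_continuous_onI continuous_intros)
  have Em [measurable]: "(\<lambda>x. E (complex_of_real x)) \<in> borel_measurable borel"
    by (intro borel_measurable_continuous_onI continuous_on_compose2[OF holomorphic_on_imp_continuous_on[OF holomorphic_E]] continuous_intros) auto
  have Pm [measurable]: "(\<lambda>x. \<Prod>k\<le>M. fac k (complex_of_real x)) \<in> borel_measurable borel" for M
  proof -
    have "l k \<noteq> 0" for k using pos[of k] by simp
    then show ?thesis
      unfolding fac_def by (intro borel_measurable_continuous_onI continuous_intros) auto
  qed
  define w where "w = (\<lambda>x::real. (1 / c)\<^sup>2 * (1 / (1 + x\<^sup>2)) + (cmod (b x))\<^sup>2)"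
  have wint: "integrable lborel w"
    unfolding w_def by (intro Bochner_Integration.integrable_add integrable_mult_right integrable_inverse_one_plus_square b)
  have dom: "cmod (1 / u * cnj (b x)) \<le> w x" if "c * (1 + \<bar>x\<bar>) \<le> cmod u" for u x
  proof -
    have "2 * cmod (1 / u) * cmod (b x) \<le> (cmod (1 / u))\<^sup>2 + (cmod (b x))\<^sup>2"
      by (rule sum_squares_bound)
    moreover have "0 \<le> cmod (1 / u) * cmod (b x)" by simp
    moreover have "(cmod (1 / u))\<^sup>2 \<le> (1 / c)\<^sup>2 * (1 / (1 + x\<^sup>2))"
      using inverse_square_bound[OF c(1) that] by (simp add: norm_divide)
    ultimately show ?thesis unfolding w_def norm_mult complex_mod_cnj by linarith
  qed
  have conv: "(\<lambda>n. LBINT x. 1 / (\<Prod>k\<le>s + (q + n). fac k (of_real x)) * cnj (b x)) \<longlonglongrightarrow> (LBINT x. 1 / E (of_real x) * cnj (b x))"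
  proof (rule integral_dominated_convergence[OF _ _ wint])
    show "AE x in lborel. (\<lambda>n. 1 / (\<Prod>k\<le>s + (q + n). fac k (of_real x)) * cnj (b x)) \<longlonglongrightarrow> 1 / E (of_real x) * cnj (b x)"
    proof (intro AE_I2 tendsto_intros)
      fix x
      show "(\<lambda>n. \<Prod>k\<le>s + (q + n). fac k (complex_of_real x)) \<longlonglongrightarrow> E (of_real x)"
        using LIMSEQ_ignore_initial_segment[OF partial_prod_tendsto[of "of_real x"], of q]
        by (simp add: add.commute[of q])
    qed (simp add: nz)
    show "AE x in lborel. norm (1 / (\<Prod>k\<le>s + (q + n). fac k (of_real x)) * cnj (b x)) \<le> w x" for n
      by (intro AE_I2 dom) (use c(3)[of "q + n" "of_real _"] in auto)
  qed measurable
  have kint: "integrable lborel (\<lambda>t. b t / ((of_real t + \<i>) * (of_real t - (of_real (l k) + \<i>))))" for k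
    by (rule b(4)) simp
  have k0: "(LBINT t. b t / ((of_real t + \<i>) * (of_real t - (of_real (l k) + \<i>)))) = 0" for k
    by (subst b(5)) (simp_all add: hz)
  have "(LBINT x. 1 / (\<Prod>k\<le>s + (q + n). fac k (of_real x)) * cnj (b x)) = 0" for n
  proof -
    \<comment> \<open>By \<open>q \<ge> 1\<close> there are at least two factors, as the partial
      fractions demand.\<close>
    obtain N where "s + (q + n) = Suc N" using q by (cases "s + (q + n)") auto
    then show ?thesis using partial_prod_orthogonal[OF assms(1) b(1) kint k0, of N] by simp
  qed
  then have z: "(LBINT x. 1 / E (of_real x) * cnj (b x)) = 0"
    using conv by (simp add: LIMSEQ_const_iff)
  have "integrable lborel (\<lambda>x. 1 / E (of_real x) * cnj (b x))"
  proof (rule Bochner_Integration.integrable_bound[OF wint])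
    show "AE x in lborel. norm (1 / E (of_real x) * cnj (b x)) \<le> norm (w x)"
      using order_trans[OF dom[OF c(2)[of "of_real _"]] abs_ge_self] by (intro AE_I2) auto
  qed measurable
  from has_integral_integral_lborel[OF this] z
  have "((\<lambda>x. 1 / E (of_real x) * cnj (b x)) has_integral 0) UNIV" by simp
  moreover have "AE x in lborel. x \<in> UNIV \<longrightarrow> 1 / E (of_real x) * cnj (bv h x) = 1 / E (of_real x) * cnj (b x)"
    using b(2) by eventually_elim simp
  ultimately show ?thesis by (subst has_integral_AE)
qed

end

text \<open>The witness is \<open>1 / E\<close> divided by the constant of
  \<open>negative_axis_lower_bound\<close>. A product \<open>B z * g z\<close> stays in
  \<open>H2\<close> since \<open>cmod B \<le> 1\<close>, and vanishes at every
  \<open>l k + \<i>\<close> because \<nu> selects these points among the zeros of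
  \<open>B\<close>.\<close>

lemma Adm_minus_B_beta:
  assumes iz: "interlacing_zeros l e s q" and beta: "\<beta> \<ge> 1" and nu: "inj \<nu>"
    and l: "\<And>k. l k = real (Suc (\<nu> k)) powr \<beta>" and A: "A * e < pi"
  shows "Adm_minus (B_beta \<beta>) (W A)"
proof -
  interpret interlacing_zeros l e s q by (rule iz)
  define a where "a = (\<lambda>n. real (Suc n) powr \<beta>)"
  have a: "a n \<ge> real (Suc n)" for n
    unfolding a_def using powr_mono[of 1 \<beta> "real (Suc n)"] beta by simp
  have zb: "zeros_beta \<beta> = (\<lambda>n. of_real (a n) + \<i>)" by (simp add: zeros_beta_def a_def fun_eq_iff)
  have B: "B_beta \<beta> holomorphic_on UHP" "\<And>z. z \<in> UHP \<Longrightarrow> cmod (B_beta \<beta> z) \<le> 1"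
    "\<And>n. B_beta \<beta> (of_real (a n) + \<i>) = 0"
    using Blaschke_UHP_properties[OF a] unfolding B_beta_def zb by auto
  have la: "l k = a (\<nu> k)" for k by (simp add: l a_def)
  have linj: "inj l"
  proof (rule injI)
    fix j k assume "l j = l k"
    moreover have "l i powr (1 / \<beta>) = real (Suc (\<nu> i))" for i
      unfolding l powr_powr using beta by simp
    ultimately have "real (Suc (\<nu> j)) = real (Suc (\<nu> k))" by metis
    then show "j = k" using nu by (auto dest: injD)
  qed
  note nz = E_nonzero
  obtain C where C: "C > 0" "\<And>t. t > 0 \<Longrightarrow> exp (A * sqrt t) \<le> C * cmod (E (of_real (- t)))"
    using negative_axis_lower_bound[OF A] by blast
  define f where "f = (\<lambda>z. of_real (1 / C) * (1 / E z))"
  have bvf: "bv f x = of_real (1 / C) * (1 / E (of_real x))" for x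
  proof -
    have "isCont E (of_real x)"
      using holomorphic_on_imp_continuous_on[OF holomorphic_E] by (simp add: continuous_on_eq_continuous_at)
    then have "isCont f (of_real x)" unfolding f_def using nz[of "of_real x"] by (intro continuous_intros) auto
    from bv_continuous[OF this] show ?thesis by (simp add: f_def)
  qed
  have H: "f \<in> H2"
  proof -
    obtain K where K: "\<And>y. y > 0 \<Longrightarrow> (LBINT x. (cmod (1 / E (Complex x y)))\<^sup>2) \<le> K"
      using H2_line_bound[OF H2_inverse_E] by blast
    have eq: "(cmod (f z))\<^sup>2 = (1 / C)\<^sup>2 * (cmod (1 / E z))\<^sup>2" for z
      unfolding f_def norm_mult power_mult_distrib using C(1) by (simp add: norm_divide)
    show ?thesis
    proof (rule H2_I[where C = "(1 / C)\<^sup>2 * K"])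
      show "f holomorphic_on UHP"
        unfolding f_def by (intro holomorphic_intros H2_holomorphic[OF H2_inverse_E])
      fix y :: real assume y: "y > 0"
      show "integrable lborel (\<lambda>x. (cmod (f (Complex x y)))\<^sup>2)"
        unfolding eq by (intro integrable_mult_right H2_line_integrable[OF H2_inverse_E y])
      show "(LBINT x. (cmod (f (Complex x y)))\<^sup>2) \<le> (1 / C)\<^sup>2 * K"
        unfolding eq integral_mult_right_zero using K[OF y] by (intro mult_left_mono) auto
    qed
  qed
  have orth: "H2_inner f (\<lambda>z. B_beta \<beta> z * g z) = 0" if g: "g \<in> H2" for g
  proof -
    define h where "h = (\<lambda>z. B_beta \<beta> z * g z)"
    have "h \<in> H2"
    proof (rule H2_mono[OF g])
      show "h holomorphic_on UHP" unfolding h_def by (intro holomorphic_intros B H2_holomorphic[OF g])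
      fix z assume "z \<in> UHP"
      from mult_right_mono[OF B(2)[OF this], of "cmod (g z)"] show "cmod (h z) \<le> cmod (g z)" by (simp add: h_def norm_mult)
    qed
    moreover have "h (of_real (l k) + \<i>) = 0" for k by (simp add: h_def la B(3))
    ultimately have "((\<lambda>x. 1 / E (of_real x) * cnj (bv h x)) has_integral 0) UNIV"
      by (intro inverse_E_orthogonal linj)
    from has_integral_mult_right[OF this, of "of_real (1 / C)"]
    have "((\<lambda>x. bv f x * cnj (bv h x)) has_integral 0) UNIV" by (simp add: bvf)
    then show ?thesis unfolding H2_inner_def h_def by (rule integral_unique)
  qed
  have dec: "cmod (bv f x) \<le> W A x" if "x < 0" for x
  proof -
    have "exp (A * sqrt (- x)) \<le> C * cmod (E (of_real x))" using C(2)[of "- x"] that by simp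
    moreover have "C * cmod (E (of_real x)) > 0" using C(1) nz[of "of_real x"] by simp
    ultimately have "1 / (C * cmod (E (of_real x))) \<le> 1 / exp (A * sqrt (- x))"
      by (intro divide_left_mono) auto
    then show ?thesis
      using that C(1) by (simp add: bvf norm_mult norm_divide W_def exp_minus inverse_eq_divide)
  qed
  have "f \<i> \<noteq> 0" using nz[of \<i>] C(1) by (simp add: f_def)
  moreover have "\<i> \<in> UHP" by (simp add: UHP_def)
  ultimately show ?thesis
    unfolding Adm_minus_def model_space_def using H orth dec
    by (intro bexI[of _ f] conjI) (auto intro!: AE_I2)
qed

text \<open>The power \<beta> of \<open>x j = (e * j) powr (2 / \<beta>)\<close> is
  \<open>e^2 * j^2\<close>, so rounding \<open>x j\<close> up to an integer \<open>m j\<close>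
  interlaces once the gaps of \<open>x\<close> are at least 1. All positive integers below
  \<open>m q\<close> go in front; by \<open>start\<close> there are at least \<open>q + 5\<close> of
  them, so \<open>s \<ge> 5\<close>.\<close>

lemma interlacing_subsequence:
  assumes e: "e > 0" and beta: "1 \<le> \<beta>" and q: "q \<ge> 1"
    and gap: "\<And>j. j \<ge> q \<Longrightarrow> (e * real j) powr (2 / \<beta>) + 1 \<le> (e * real (j + 1)) powr (2 / \<beta>)"
    and start: "(e * real q) powr (2 / \<beta>) \<ge> real q + 6"
  obtains \<nu> s where "inj \<nu>" "interlacing_zeros (\<lambda>k. real (Suc (\<nu> k)) powr \<beta>) e s q"
proof -
  define x where "x = (\<lambda>j. (e * real j) powr (2 / \<beta>))"
  define m where "m = (\<lambda>j. nat \<lceil>x j\<rceil>)"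
  have x0: "x j \<ge> 0" for j by (simp add: x_def)
  have m1: "x j \<le> real (m j)" and m2: "real (m j) < x j + 1" for j
    using x0[of j] unfolding m_def by linarith+
  have gap': "x j + 1 \<le> x (Suc j)" if "j \<ge> q" for j using gap[OF that] by (simp add: x_def)
  have mlt: "m j < m (Suc j)" if "j \<ge> q" for j
    using m2[of j] gap'[OF that] m1[of "Suc j"] by linarith
  define s where "s = m q - 1 - q"
  have mq: "m q \<ge> q + 6" using m1[of q] start by (simp add: x_def)
  have s: "s \<ge> 5" "s + q = m q - 1" using mq by (auto simp: s_def)
  \<comment> \<open>Zeros are powers of \<open>Suc n\<close>, hence the \<open>- 1\<close>. At
    \<open>k = s + q\<close> the second branch has the value \<open>m q - 1 = s + q\<close>, right
    after the last value of the first.\<close>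
  define \<nu> where "\<nu> = (\<lambda>k. if k < s + q then k else m (k - s) - 1)"
  have "strict_mono \<nu>"
  proof (rule strict_mono_Suc_iff[THEN iffD2], rule allI)
    fix k
    consider "Suc k < s + q" | "Suc k = s + q" | "k \<ge> s + q" by linarith
    then show "\<nu> k < \<nu> (Suc k)"
    proof cases
      case 2
      then have "Suc k - s = q" by simp
      then show ?thesis using 2 s by (simp add: \<nu>_def)
    next
      case 3
      then have j: "k - s \<ge> q" "Suc k - s = Suc (k - s)" by auto
      have "m (k - s) \<ge> 1"
      proof -
        have "real (m (k - s)) \<ge> x (k - s)" by (rule m1)
        moreover have "x (k - s) > 0" using e q j(1) by (simp add: x_def)
        ultimately show ?thesis by linarith
      qed
      then show ?thesis using 3 mlt[OF j(1)] unfolding \<nu>_def j(2) by simp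
    qed (simp add: \<nu>_def)
  qed
  then have "inj \<nu>" by (rule strict_mono_imp_inj_on)
  moreover have "interlacing_zeros (\<lambda>k. real (Suc (\<nu> k)) powr \<beta>) e s q"
  proof
    fix j assume j: "q \<le> j"
    have xp: "x i powr \<beta> = e\<^sup>2 * (real i)\<^sup>2" if "i \<ge> 1" for i
    proof -
      have "x i powr \<beta> = (e * real i) powr 2" unfolding x_def powr_powr using beta by simp
      also have "\<dots> = (e * real i)\<^sup>2" using e that by (intro powr_numeral) simp
      finally show ?thesis by (simp add: power_mult_distrib)
    qed
    have mj: "m j \<ge> 1"
    proof -
      have "x j > 0" using e q j by (simp add: x_def)
      then show ?thesis using m1[of j] by linarith
    qed
    have eq: "Suc (\<nu> (s + j)) = m j" using j mj by (simp add: \<nu>_def)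
    have "x j powr \<beta> \<le> real (m j) powr \<beta>" using m1[of j] x0 beta by (intro powr_mono2) auto
    moreover have "real (m j) powr \<beta> \<le> x (j + 1) powr \<beta>"
      using m2[of j] gap'[OF j] beta by (intro powr_mono2) auto
    ultimately show "e\<^sup>2 * (real j)\<^sup>2 \<le> real (Suc (\<nu> (s + j))) powr \<beta> \<and>
        real (Suc (\<nu> (s + j))) powr \<beta> \<le> e\<^sup>2 * (real (j + 1))\<^sup>2"
      using xp[of j] xp[of "j + 1"] q j unfolding eq by simp
  qed (use e s q in auto)
  ultimately show ?thesis using that by blast
qed

theorem theorem4p1:
  shows "(\<forall>A::real. 0 < A \<and> A < pi \<longrightarrow> Adm_minus (B_beta 2) (W A)) \<and>
         (\<forall>(\<beta>::real) (A::real). 1 \<le> \<beta> \<and> \<beta> < 2 \<and> 0 < A \<longrightarrow> Adm_minus (B_beta \<beta>) (W A))"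
proof (intro conjI allI impI; elim conjE)
  fix A :: real assume A: "0 < A" "A < pi"
  \<comment> \<open>For \<beta> = 2 the gap condition reads \<open>e \<ge> 1\<close>, and strictness
    lets \<open>e * q\<close> outrun \<open>q + 6\<close>; \<open>A < pi\<close> leaves room for
    such an \<open>e\<close>.\<close>
  obtain e where e: "1 < e" "e < pi / A" using A dense[of 1 "pi / A"] by auto
  have Ae: "A * e < pi" using e A by (simp add: field_simps)
  obtain q where q: "real q \<ge> 6 / (e - 1)" using real_arch_simple by blast
  have q0: "q \<ge> 1"
  proof -
    have "6 / (e - 1) > 0" using e by simp
    then show ?thesis using q by linarith
  qed
  have st: "e * real q \<ge> real q + 6" using q e by (simp add: field_simps)
  obtain \<nu> s where "inj \<nu>" "interlacing_zeros (\<lambda>k. real (Suc (\<nu> k)) powr 2) e s q"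
    by (rule interlacing_subsequence[of e 2 q]) (use e q0 st in \<open>auto simp: algebra_simps\<close>)
  then show "Adm_minus (B_beta 2) (W A)"
    by (intro Adm_minus_B_beta[OF _ _ _ refl Ae]) auto
next
  fix \<beta> A :: real assume b: "1 \<le> \<beta>" "\<beta> < 2" and A: "0 < A"
  \<comment> \<open>Every \<open>e > 0\<close> is admissible when \<beta> < 2, so
    \<open>A * e = 3 < pi\<close> can be arranged for any \<open>A\<close>.\<close>
  define e where "e = 3 / A"
  have e: "e > 0" using A by (simp add: e_def)
  have Ae: "A * e < pi" using A pi_gt3 by (simp add: e_def)
  define g where "g = 2 / \<beta>"
  have g: "g > 1" using b by (simp add: g_def)
  \<comment> \<open>Beyond this threshold \<open>e powr g * j powr (g - 1)\<close> is at least 8.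
    That quantity bounds the gaps from below, and \<open>8 * q \<ge> q + 6\<close> settles the
    start.\<close>
  obtain q1 where q1: "real q1 \<ge> (8 / e powr g) powr (1 / (g - 1))" using real_arch_simple by blast
  have "8 / e powr g \<le> real n powr (g - 1)" if "n \<ge> q1" for n
  proof -
    have "((8 / e powr g) powr (1 / (g - 1))) powr (g - 1) \<le> real n powr (g - 1)"
      using q1 that g by (intro powr_mono2) auto
    then show ?thesis using g e unfolding powr_powr by simp
  qed
  note q1 = this
  define q where "q = max q1 1"
  have big: "8 \<le> e powr g * real j powr (g - 1)" if "j \<ge> q" for j
    using q1[of j] that e by (simp add: q_def field_simps)
  have sp: "(e * real j) powr g = e powr g * real j powr (g - 1) * real j" if "j \<ge> q" for j
    using that e by (simp add: q_def powr_mult powr_diff)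
  have gap: "(e * real j) powr g + 1 \<le> (e * real (j + 1)) powr g" if j: "j \<ge> q" for j
  proof -
    have "e powr g * real j powr (g - 1) \<le> e powr g * real (j + 1) powr (g - 1)"
      using g by (intro mult_left_mono powr_mono2) auto
    then have "e powr g * real j powr (g - 1) * real (j + 1) \<le> e powr g * real (j + 1) powr (g - 1) * real (j + 1)"
      by (rule mult_right_mono) simp
    moreover have "e powr g * real j powr (g - 1) * real (j + 1) = (e * real j) powr g + e powr g * real j powr (g - 1)"
      unfolding sp[OF j] by (simp add: distrib_left)
    ultimately show ?thesis using sp[of "j + 1"] big[OF j] j by simp
  qed
  have st: "(e * real q) powr g \<ge> real q + 6"
  proof -
    have "8 * real q \<le> (e * real q) powr g" unfolding sp[OF order_refl] by (intro mult_right_mono big) auto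
    moreover have "real q \<ge> 1" by (simp add: q_def)
    ultimately show ?thesis by linarith
  qed
  obtain \<nu> s where "inj \<nu>" "interlacing_zeros (\<lambda>k. real (Suc (\<nu> k)) powr \<beta>) e s q"
    by (rule interlacing_subsequence[of e \<beta> q]) (use e b gap st in \<open>auto simp: g_def q_def\<close>)
  then show "Adm_minus (B_beta \<beta>) (W A)"
    by (intro Adm_minus_B_beta[OF _ b(1) _ refl Ae]) auto
qed

end
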